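(* Let $\{E_{2n-1},E_{2n},\gamma_n,\nu_n\}_{n=g_-,\dots,g_+}$ be candidate spectral data as defined in the context, let $\Phi(x,t,z)$ be the solution (assumed to exist) of the Riemann-Hilbert problem defined from these data in the context, which determines the potential $q(x,t)$ as in the context. Let $\Sigma$ and $\mathcal D$ be as in the context. If there exists a function $r_2(z)$ such that: (i) $r_2$ is holomorphic in $\mathbb C\setminus(\mathbb R\setminus\Sigma)$ with continuous boundary values $r_{2\pm}$ on $\mathbb R\setminus\Sigma$ from above and below; (ii) $r_2$ satisfies the jump relation $r_{2+}(z)=r_{2-}^{-1}(z)$ for $z\in\mathbb R\setminus\Sigma$; (iii) $r_2$ satisfies the asymptotic condition $r_2(z)=e^{2iz^2L_2}(1+O(1/z))$ as $z\to\infty$, for some $L_2>0$; (iv) $r_2\in\mathcal A_2(\mathcal D)$; then $q(x,t+L_2)=q(x,t)$.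
   Context: $\sigma_1=\begin{pmatrix}0&1\\1&0\end{pmatrix}$, $\sigma_3=\mathrm{diag}(1,-1)$, $U=\frac1{\sqrt2}\begin{pmatrix}1&1\\-i&i\end{pmatrix}$ (unitary), $[A,B]=AB-BA$; $\mathbb C^\pm$ are the open upper/lower half planes; $\mathcal A_2(\Omega)$ is the algebra of holomorphic $f$ on $\Omega$ such that there are $c,M>0$ with $|f(z)|\le Me^{c|z|^2}$ on $\Omega$. Candidate spectral data: a sequence $\{E_{2n-1},E_{2n},\gamma_n,\nu_n\}_{n=g_-,\dots,g_+}$ of real numbers $E_n$, $\gamma_n$ and signs $\nu_n$, with $g_-<g_+$ either finite or infinite, such that: $E_{2g_--1}<\dots<E_{n-1}<E_n<E_{n+1}<\dots<E_{2g_+}$; $\gamma_n\in[E_{2n-1},E_{2n}]$ and $\nu_n\in\{-1,0,1\}$ for all $n=g_-,\dots,g_+$; $R=\max_k|E_{2k}-E_{2k-1}|<\infty$; if $g_-$ and $g_+$ are finite, there exist $N,C$ such that $|E_n|>Cn^2$ for all $|n|>N$; if either $g_-$ or $g_+$ is infinite, there is $N>0$ such that the discs $D_n$ of radius $R$ centered at $(E_{2n}+E_{2n-1})/2$ are disjoint for $|n|\ge N$. If $g_-$ (resp. $g_+$) is finite, $E_{2g_--2}=-\infty$ (resp. $E_{2g_++1}=+\infty$). The gaps are $(E_{2n-1},E_{2n})$, and $\Sigma=\mathbb R\setminus\bigcup_n(E_{2n-1},E_{2n})$. $\mathcal D=\mathbb C\setminus(\mathbb R\cup\bigcup_n\overline{D_n})$.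 Counting function: $m\equiv0$ if no $\nu_k=0$. Otherwise let $\gamma_*$ be the $\gamma_k$ with $\nu_k=0$ closest to $0$; $m(z)=|\{\gamma_k:\gamma_*\le\gamma_k\le z,\nu_k=0\}|$ for $z\ge\gamma_*$, and $m(z)=|\{\gamma_k:z<\gamma_k<\gamma_*,\nu_k=0\}|$ for $z<\gamma_*$. Matrix $B$: $f^\pm(z)=\prod_{\nu_k=\pm1}\frac{\gamma_k-z}{\pi_k}$ and $$b^4(z)=-\prod_{\nu_k=0}\frac{(\gamma_k-z)^2}{(E_{2k}-z)(E_{2k-1}-z)}\prod_{\nu_k\ne0}\frac{\pi_k^2}{(E_{2k}-z)(E_{2k-1}-z)},$$ with $\pi_k=k\pi$ for $k\ne0$ and $\pi_0=1$ (empty products equal $1$). In $b$, the square root of the product of the factors $\gamma_k-z$ with $\nu_k=0$ has as branch cut the subset of the real axis where $m(z)$ is odd, and the fourth root of the product of the factors $(E_{2k}-z)(E_{2k-1}-z)$ has as branch cut $\bigcup_n[E_{4n-4},E_{4n-1}]$ (over the available indices). $B=i\,b\,\mathrm{diag}(f^-,f^+)$ on $\mathbb C^+$, $B=b\,\mathrm{diag}(f^+,f^-)$ on $\mathbb C^-$. Riemann-Hilbert problem: find a $2\times2$ matrix $\Phi(x,t,z)$ such that (1) $\Phi$ is holomorphic in $z$ for $z\in\mathbb C\setminus\mathbb R$; (2) the boundary values $\Phi^\pm$ from $\mathbb C^\pm$ are continuous for $z\in\mathbb R\setminus\{E_k\}$, with at worst quartic root singularities on $\{E_k\}$; (3) $\Phi^+=\Phi^-\check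 V$, with $\check V=(-1)^{n+m(z)}\mathrm{diag}(f^-/f^+,f^+/f^-)$ on $[E_{2n-2},E_{2n-1}]$ and $\check V=(-1)^{n+m(z)}i\,e^{-2izx\sigma_3-4iz^2t\sigma_3}\sigma_1$ on $[E_{2n-1},E_{2n}]$; (4) $\Phi=U(I+O(1/z))B(z)$ as $z\to\infty$ with $z\in\mathbb C$; (5) there are positive constants $c,M$ with $|\phi_{ij}(x,t,z)|\le Me^{c|z|^2}$ for all $z\in\mathcal D$. Potential: $q(x,t)$ is the $(1,2)$ entry of $Q(x,t)=\lim_{z\to\infty}iz[\sigma_3,U^{-1}\Phi(x,t,z)B(z)^{-1}]$. *)

theory Defs
  imports
    "HOL-Analysis.Analysis"
    "HOL-Library.Landau_Symbols"
    "HOL-Library.Extended"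
begin

section \<open>Candidate spectral data\<close>

text \<open>The bounds \<open>g\<^sub>-\<close>, \<open>g\<^sub>+\<close> live in the integers extended by \<open>Minf\<close>, \<open>Pinf\<close>. The functions
  \<open>edge\<close>, \<open>gam\<close>, \<open>nu\<close> are meaningful only at the indices in \<open>edge_idx\<close>, resp. \<open>gap_idx\<close>.\<close>

record spectral_data =
  g_minus :: "int extended"
  g_plus :: "int extended"
  edge :: "int \<Rightarrow> real"
  gam :: "int \<Rightarrow> real"
  nu :: "int \<Rightarrow> int"

definition gap_idx :: "spectral_data \<Rightarrow> int set" where
  "gap_idx d = {n. g_minus d \<le> Fin n \<and> Fin n \<le> g_plus d}"

definition edge_idx :: "spectral_data \<Rightarrow> int set" where
  "edge_idx d = {j. \<exists>n\<in>gap_idx d. j = 2 * n - 1 \<or> j = 2 * n}"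

text \<open>\<open>R\<close> is the supremum of the gap lengths; finiteness is required in \<open>candidate_spectral_data\<close>.\<close>

definition gap_radius :: "spectral_data \<Rightarrow> real" where
  "gap_radius d = (SUP n\<in>gap_idx d. \<bar>edge d (2 * n) - edge d (2 * n - 1)\<bar>)"

definition disc_center :: "spectral_data \<Rightarrow> int \<Rightarrow> complex" where
  "disc_center d n = of_real ((edge d (2 * n) + edge d (2 * n - 1)) / 2)"

definition candidate_spectral_data :: "spectral_data \<Rightarrow> bool" where
  "candidate_spectral_data d \<longleftrightarrow>
     g_minus d < g_plus d \<and>
     strict_mono_on (edge_idx d) (edge d) \<and>
     (\<forall>n\<in>gap_idx d. gam d n \<in> {edge d (2 * n - 1)..edge d (2 * n)} \<and> nu d n \<in> {-1, 0, 1}) \<and>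
     bdd_above ((\<lambda>n. \<bar>edge d (2 * n) - edge d (2 * n - 1)\<bar>) ` gap_idx d) \<and>
     (g_minus d \<noteq> Minf \<and> g_plus d \<noteq> Pinf \<longrightarrow>
        (\<exists>N C. C > 0 \<and> (\<forall>j\<in>edge_idx d. \<bar>j\<bar> > N \<longrightarrow> \<bar>edge d j\<bar> > C * (real_of_int j)\<^sup>2))) \<and>
     (g_minus d = Minf \<or> g_plus d = Pinf \<longrightarrow>
        (\<exists>N>0. disjoint_family_on (\<lambda>n. ball (disc_center d n) (gap_radius d))
                  {n\<in>gap_idx d. \<bar>n\<bar> \<ge> N}))"

text \<open>The edges with the conventions \<open>E\<^sub>j = -\<infinity>\<close> below and \<open>E\<^sub>j = +\<infinity>\<close> above the available indices.
  Real intervals with such end points are cut off, or empty, where they leave the index range.\<close>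

definition edge_ext :: "spectral_data \<Rightarrow> int \<Rightarrow> real extended" where
  "edge_ext d j = (if j \<in> edge_idx d then Fin (edge d j)
                   else if \<exists>k\<in>edge_idx d. j < k then Minf else Pinf)"

definition edge_interval :: "spectral_data \<Rightarrow> int \<Rightarrow> int \<Rightarrow> real set" where
  "edge_interval d i j = {x. edge_ext d i \<le> Fin x \<and> Fin x \<le> edge_ext d j}"

definition edge_set :: "spectral_data \<Rightarrow> real set" where
  "edge_set d = edge d ` edge_idx d"

definition spectrum :: "spectral_data \<Rightarrow> real set" where
  "spectrum d = UNIV - (\<Union>n\<in>gap_idx d. {edge d (2 * n - 1)<..<edge d (2 * n)})"

definition disc_complement :: "spectral_data \<Rightarrow> complex set" where
  "disc_complement d = UNIV - (\<real> \<union> (\<Union>n\<in>gap_idx d. cball (disc_center d n) (gap_radius d)))"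


section \<open>Counting function\<close>

definition zero_gams :: "spectral_data \<Rightarrow> real set" where
  "zero_gams d = {gam d k | k. k \<in> gap_idx d \<and> nu d k = 0}"

text \<open>A tie for the point closest to \<open>0\<close> leaves two choices of \<open>\<gamma>\<^sub>*\<close>, so it is kept as a parameter.\<close>

definition is_gamma_star :: "spectral_data \<Rightarrow> real \<Rightarrow> bool" where
  "is_gamma_star d gs \<longleftrightarrow>
     (zero_gams d \<noteq> {} \<longrightarrow> gs \<in> zero_gams d \<and> (\<forall>g\<in>zero_gams d. \<bar>gs\<bar> \<le> \<bar>g\<bar>))"

definition count_m :: "spectral_data \<Rightarrow> real \<Rightarrow> real \<Rightarrow> nat" where
  "count_m d gs x =
     (if zero_gams d = {} then 0
      else if gs \<le> x then card {g\<in>zero_gams d. gs \<le> g \<and> g \<le> x}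
      else card {g\<in>zero_gams d. x < g \<and> g < gs})"


section \<open>The products and the matrix \<open>B\<close>\<close>

definition pi_k :: "int \<Rightarrow> complex" where
  "pi_k k = (if k = 0 then 1 else of_int k * of_real pi)"

text \<open>The products over gap indices converge at best conditionally (already
  \<open>\<Prod>(k\<pi> - z) / (k\<pi>)\<close> does), so the indices \<open>k\<close> and \<open>-k\<close> are grouped together:
  \<open>sym_factor d u N\<close> collects the factors with \<open>\<bar>k\<bar> = N\<close>.\<close>

definition sym_factor :: "spectral_data \<Rightarrow> (int \<Rightarrow> complex \<Rightarrow> complex) \<Rightarrow> nat \<Rightarrow> complex \<Rightarrow> complex" where
  "sym_factor d u N z = (\<Prod>k\<in>{k\<in>gap_idx d. \<bar>k\<bar> = int N}. u k z)"

definition f_factor :: "spectral_data \<Rightarrow> int \<Rightarrow> int \<Rightarrow> complex \<Rightarrow> complex" where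
  "f_factor d s k z = (if nu d k = s then (of_real (gam d k) - z) / pi_k k else 1)"

definition b_factor :: "spectral_data \<Rightarrow> int \<Rightarrow> complex \<Rightarrow> complex" where
  "b_factor d k z =
     (if nu d k = 0 then (of_real (gam d k) - z)\<^sup>2 else (pi_k k)\<^sup>2)
       / ((of_real (edge d (2 * k)) - z) * (of_real (edge d (2 * k - 1)) - z))"

text \<open>\<open>f_prod d 1\<close> is \<open>f\<^sup>+\<close> and \<open>f_prod d (-1)\<close> is \<open>f\<^sup>-\<close>.\<close>

definition f_prod :: "spectral_data \<Rightarrow> int \<Rightarrow> complex \<Rightarrow> complex" where
  "f_prod d s z = (\<Prod>N. sym_factor d (f_factor d s) N z)"

definition b4 :: "spectral_data \<Rightarrow> complex \<Rightarrow> complex" where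
  "b4 d z = - (\<Prod>N. sym_factor d (b_factor d) N z)"

definition product_converges_on ::
    "spectral_data \<Rightarrow> (int \<Rightarrow> complex \<Rightarrow> complex) \<Rightarrow> complex set \<Rightarrow> bool" where
  "product_converges_on d u S \<longleftrightarrow>
     (\<forall>z\<in>S. convergent_prod (\<lambda>N. sym_factor d u N z)) \<and>
     (\<forall>K. compact K \<and> K \<subseteq> S \<longrightarrow>
        uniformly_convergent_on K (\<lambda>n z. \<Prod>N\<le>n. sym_factor d u N z))"

text \<open>The conditions on candidate spectral data do not imply that the products defining
  \<open>f\<^sup>\<plusminus>\<close> and \<open>b\<^sup>4\<close> make sense for infinitely many gaps (for finitely many they always do).\<close>

definition products_converge :: "spectral_data \<Rightarrow> bool" where
  "products_converge d \<longleftrightarrow>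
     product_converges_on d (f_factor d 1) UNIV \<and>
     product_converges_on d (f_factor d (-1)) UNIV \<and>
     product_converges_on d (b_factor d) (UNIV - of_real ` edge_set d)"

text \<open>The ``product of the factors \<open>a - z\<close>'' over an infinite set of points \<open>a\<close> is meaningful only
  up to normalisation: an entire function whose zeros are these points, all simple. In the
  quotient \<open>b\<close> the normalisations of numerator and denominator are tied together by \<open>b\<^sup>4\<close>.\<close>

definition entire_simple_zeros :: "(complex \<Rightarrow> complex) \<Rightarrow> real set \<Rightarrow> bool" where
  "entire_simple_zeros F Z \<longleftrightarrow>
     F holomorphic_on UNIV \<and>
     (\<forall>z. F z = 0 \<longleftrightarrow> z \<in> of_real ` Z) \<and>
     (\<forall>z\<in>of_real ` Z. deriv F z \<noteq> 0)"

text \<open>The numerator \<open>s\<close> is the square root of the product of the \<open>\<gamma>\<^sub>k - z\<close> with \<open>\<nu>\<^sub>k = 0\<close>, the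
  denominator \<open>h\<close> is the fourth root of the product of all \<open>E\<^sub>j - z\<close>. Together with the branch
  cuts this determines \<open>b\<close> up to a constant fourth root of unity, which affects neither the
  Riemann--Hilbert problem (up to a constant factor of its solution) nor the potential.\<close>

definition is_b :: "spectral_data \<Rightarrow> real \<Rightarrow> (complex \<Rightarrow> complex) \<Rightarrow> bool" where
  "is_b d gs b \<longleftrightarrow>
     (\<exists>s h F G.
        entire_simple_zeros F (zero_gams d) \<and>
        entire_simple_zeros G (edge_set d) \<and>
        s holomorphic_on - closure (of_real ` {x. odd (count_m d gs x)}) \<and>
        (\<forall>z\<in>- closure (of_real ` {x. odd (count_m d gs x)}). (s z)\<^sup>2 = F z) \<and>
        h holomorphic_on - of_real ` (\<Union>n. edge_interval d (4 * n - 4) (4 * n - 1)) \<and>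
        (\<forall>z\<in>- of_real ` (\<Union>n. edge_interval d (4 * n - 4) (4 * n - 1)). h z ^ 4 = G z) \<and>
        (\<forall>z. z \<notin> \<real> \<longrightarrow> b z = s z / h z \<and> b z ^ 4 = b4 d z))"

definition diag2 :: "complex \<Rightarrow> complex \<Rightarrow> complex^2^2" where
  "diag2 a c = vector [vector [a, 0], vector [0, c]]"

definition sigma1 :: "complex^2^2" where
  "sigma1 = vector [vector [0, 1], vector [1, 0]]"

definition sigma3 :: "complex^2^2" where
  "sigma3 = diag2 1 (-1)"

definition U_mat :: "complex^2^2" where
  "U_mat = mat (1 / of_real (sqrt 2)) ** vector [vector [1, 1], vector [-\<i>, \<i>]]"

text \<open>Only used off the real axis.\<close>

definition B_mat :: "spectral_data \<Rightarrow> (complex \<Rightarrow> complex) \<Rightarrow> complex \<Rightarrow> complex^2^2" where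
  "B_mat d b z =
     (if Im z > 0 then mat (\<i> * b z) ** diag2 (f_prod d (-1) z) (f_prod d 1 z)
      else mat (b z) ** diag2 (f_prod d 1 z) (f_prod d (-1) z))"


section \<open>The Riemann--Hilbert problem and the potential\<close>

definition boundary_values ::
    "(complex \<Rightarrow> 'a::topological_space) \<Rightarrow> real set \<Rightarrow> (real \<Rightarrow> 'a) \<Rightarrow> (real \<Rightarrow> 'a) \<Rightarrow> bool" where
  "boundary_values F S Fp Fm \<longleftrightarrow>
     (\<forall>x\<in>S. (F \<longlongrightarrow> Fp x) (at (of_real x) within {z. Im z > 0}) \<and>
            (F \<longlongrightarrow> Fm x) (at (of_real x) within {z. Im z < 0})) \<and>
     continuous_on S Fp \<and> continuous_on S Fm"

definition jump_band :: "spectral_data \<Rightarrow> real \<Rightarrow> int \<Rightarrow> real \<Rightarrow> complex^2^2" where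
  "jump_band d gs n x =
     mat ((-1) powi (n + int (count_m d gs x))) **
     diag2 (f_prod d (-1) (of_real x) / f_prod d 1 (of_real x))
           (f_prod d 1 (of_real x) / f_prod d (-1) (of_real x))"

definition jump_gap :: "spectral_data \<Rightarrow> real \<Rightarrow> real \<Rightarrow> real \<Rightarrow> int \<Rightarrow> real \<Rightarrow> complex^2^2" where
  "jump_gap d gs x t n y =
     (let w = - 2 * \<i> * of_real y * of_real x - 4 * \<i> * (of_real y)\<^sup>2 * of_real t in
      mat ((-1) powi (n + int (count_m d gs y)) * \<i>) ** diag2 (exp w) (exp (- w)) ** sigma1)"

definition to_infinity_within :: "complex set \<Rightarrow> complex filter" where
  "to_infinity_within S = inf at_infinity (principal S)"

text \<open>On the gaps the jump condition makes the off-diagonal part of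
  \<open>U\<^sup>-\<^sup>1 \<Phi>\<^sup>\<plusminus> (B\<^sup>\<plusminus>)\<^sup>-\<^sup>1\<close> of order \<open>1\<close>, so with infinitely many gaps an expansion uniform
  up to the real axis is impossible; the normalisation is imposed as \<open>z \<rightarrow> \<infinity>\<close> away from the discs
  around the gaps. For finitely many gaps this is the same as \<open>z \<rightarrow> \<infinity>\<close> off the real axis.

  The quartic root bound is imposed on \<open>\<Phi>\<close> in a full neighbourhood of each edge: a bound on the
  boundary values alone would not exclude essential singularities there.\<close>

definition rhp_solution ::
    "spectral_data \<Rightarrow> real \<Rightarrow> (complex \<Rightarrow> complex) \<Rightarrow> real \<Rightarrow> real \<Rightarrow> (complex \<Rightarrow> complex^2^2) \<Rightarrow> bool" where
  "rhp_solution d gs b x t \<Phi> \<longleftrightarrow>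
     (\<forall>i j. (\<lambda>z. \<Phi> z $ i $ j) holomorphic_on - \<real>) \<and>
     (\<exists>\<Phi>p \<Phi>m. boundary_values \<Phi> (UNIV - edge_set d) \<Phi>p \<Phi>m \<and>
        (\<forall>n y. y \<in> edge_interval d (2 * n - 2) (2 * n - 1) - edge_set d \<longrightarrow>
            \<Phi>p y = \<Phi>m y ** jump_band d gs n y) \<and>
        (\<forall>n y. y \<in> edge_interval d (2 * n - 1) (2 * n) - edge_set d \<longrightarrow>
            \<Phi>p y = \<Phi>m y ** jump_gap d gs x t n y)) \<and>
     (\<forall>e\<in>edge_set d. \<forall>i j.
        (\<lambda>z. norm (\<Phi> z $ i $ j))
          \<in> O[at (of_real e) within - \<real>](\<lambda>z. norm (z - of_real e) powr (- 1 / 4))) \<and>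
     (\<exists>A. (\<forall>i j. (\<lambda>z. A z $ i $ j) \<in> O[to_infinity_within (disc_complement d)](\<lambda>z. 1 / z)) \<and>
        (\<forall>\<^sub>F z in to_infinity_within (disc_complement d).
            \<Phi> z = U_mat ** (mat 1 + A z) ** B_mat d b z)) \<and>
     (\<exists>c>0. \<exists>M>0. \<forall>i j. \<forall>z\<in>disc_complement d. norm (\<Phi> z $ i $ j) \<le> M * exp (c * (norm z)\<^sup>2))"

definition commutator :: "complex^2^2 \<Rightarrow> complex^2^2 \<Rightarrow> complex^2^2" where
  "commutator A C = A ** C - C ** A"

definition has_potential ::
    "spectral_data \<Rightarrow> (complex \<Rightarrow> complex) \<Rightarrow> (complex \<Rightarrow> complex^2^2) \<Rightarrow> complex \<Rightarrow> bool" where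
  "has_potential d b \<Phi> q \<longleftrightarrow>
     (\<exists>Q. ((\<lambda>z. mat (\<i> * z) **
                  commutator sigma3 (matrix_inv U_mat ** \<Phi> z ** matrix_inv (B_mat d b z)))
              \<longlongrightarrow> Q) (to_infinity_within (disc_complement d)) \<and>
          q = Q $ 1 $ 2)"


section \<open>Functions of growth order two\<close>

definition A2 :: "complex set \<Rightarrow> (complex \<Rightarrow> complex) set" where
  "A2 \<Omega> = {f. f holomorphic_on \<Omega> \<and>
              (\<exists>c>0. \<exists>M>0. \<forall>z\<in>\<Omega>. norm (f z) \<le> M * exp (c * (norm z)\<^sup>2))}"

definition gap_complement :: "spectral_data \<Rightarrow> complex set" where
  "gap_complement d = UNIV - of_real ` (UNIV - spectrum d)"

text \<open>The set \<open>gap_complement d\<close> contains the gap edges but is not a neighbourhood of them; there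
  ``holomorphic'' means continuous, since the functions in question behave like
  \<open>\<plusminus>1 + O(\<surd>(z - E))\<close>.\<close>

definition holomorphic_off_gaps :: "spectral_data \<Rightarrow> (complex \<Rightarrow> complex) \<Rightarrow> bool" where
  "holomorphic_off_gaps d r \<longleftrightarrow>
     r holomorphic_on interior (gap_complement d) \<and> continuous_on (gap_complement d) r"

end

(* Put s = r2 exp(-2 i z^2 L2) and S = diag(s, 1/s). Since s_+ s_- = exp(-4 i z^2 L2) on the gaps, the
   matrix Phi(x, t + L2) S has the jumps of Phi(x, t), and s = 1 + O(1/z) preserves the normalisation,
   so the two agree by uniqueness, and S disappears in the limit that defines the potential.

   For S to be regular, r2 must not vanish. Consider rho(z) = r2(z) cnj(r2(cnj z)), which tends to 1,
   is unimodular on the gaps and equals 1 at their end points. With finitely many gaps the maximum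
   principle gives |rho| <= 1 while rho is analytic at infinity with value 1; with infinitely many,
   rho + 1/rho - 2 is analytic at infinity and vanishes at the end points of the gaps, which accumulate
   there. In both cases rho = 1.

   For uniqueness, pairing the rows of two solutions gives entire functions. The determinant delta of
   a solution satisfies delta^2 G ~ -T^2 away from the discs, where T and G have simple zeros
   precisely at the gamma_k and at the E_j; there are twice as many E_j as gamma_k inside a circle
   centred on the real axis that avoids the discs, so by Rouche delta has no zeros. The remaining
   quotients are entire and tend to 0 on these circles, hence vanish. *)

theory Submission
  imports Defs "HOL-Complex_Analysis.Complex_Analysis"
begin

text \<open>With infinitely many gaps the discs reach out to infinity, and the normalisation says
  nothing inside them. So Liouville's theorem is not directly applicable to the entire functions
  obtained, and all estimates are made on circles that pass between discs. The gaps to the left and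
  to the right are unrelated, so the circles are not centred at 0: the two end points of a diameter
  are chosen separately.

  The factor b in B is a fourth root with cuts, so det B is used only through its square: b^4 G =
  F^2, where F has its zeros at the gamma_k with nu_k = 0. Hence (det B)^2 G = T^2 with T = F f^+
  f^-, whatever branches were chosen. The sign in delta^2 G ~ -T^2 is (det U)^2.

  The reflection in rho serves two purposes: it cancels exp(2 i z^2 L2), which has no limit at
  infinity, and it exchanges the two sides of a gap, so that r2_+ r2_- = 1 becomes a statement about
  moduli. A zero of r2 would give a pole of 1/s in the second column of Phi S, and at an edge it
  could spoil the quartic root bound.\<close>

no_notation fps_nth (infixl "$" 75)

section \<open>Extension across the real axis\<close>

lemma Reals_iff_Im: "z \<in> \<real> \<longleftrightarrow> Im z = 0"
  by (simp add: complex_is_Real_iff)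

lemma notin_Reals_eq: "- \<real> = {z. Im z > 0} \<union> {z. Im z < 0}"
  by (auto simp: Reals_iff_Im)

lemma open_Compl_Reals: "open (- \<real> :: complex set)"
  using closed_complex_Reals by blast

lemma at_upper_neq_bot [simp]: "at (of_real y) within {z. Im z > 0} \<noteq> (bot :: complex filter)"
proof -
  have "\<exists>x\<in>{z. 0 < Im z}. x \<noteq> of_real y \<and> dist x (of_real y) < e" if "e > 0" for e
    using that by (intro bexI[of _ "of_real y + \<i> * of_real (e/2)"]) (auto simp: dist_norm norm_mult complex_eq_iff)
  then have "complex_of_real y islimpt {z. Im z > 0}"
    unfolding islimpt_approachable by blast
  then show ?thesis by (simp add: trivial_limit_within)
qed

lemma at_nonreal_neq_bot [simp]: "at (of_real y) within - \<real> \<noteq> (bot :: complex filter)"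
proof -
  have "at (of_real y) within {z. Im z > 0} \<le> at (complex_of_real y) within - \<real>"
    by (rule at_le) (auto simp: Reals_iff_Im)
  then show ?thesis
    using at_upper_neq_bot[of y] bot.extremum_uniqueI by metis
qed

lemma tendsto_nonreal_iff:
  "(f \<longlongrightarrow> l) (at x within - \<real>) \<longleftrightarrow>
     (f \<longlongrightarrow> l) (at x within {z. Im z > 0}) \<and> (f \<longlongrightarrow> l) (at x within {z. Im z < 0})"
  unfolding notin_Reals_eq Lim_Un_univ
  by (metis Lim_Un tendsto_within_subset sup_ge1 sup_ge2)

text \<open>Continuity of \<open>l\<close> along the axis is automatic: near a real point z every
  value \<open>l w\<close> is itself a limit of values of \<open>g\<close> at non-real points close
  to z. The estimate at z passes to this limit as a non-strict inequality, hence the margin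
  e/2.\<close>

lemma continuous_on_extend_across_reals:
  fixes g l :: "complex \<Rightarrow> 'a::metric_space"
  assumes U: "open U" and g: "continuous_on (U - \<real>) g"
    and l: "\<And>y. y \<in> U \<Longrightarrow> y \<in> \<real> \<Longrightarrow> (g \<longlongrightarrow> l y) (at y within - \<real>)"
  shows "continuous_on U (\<lambda>z. if z \<in> \<real> then l z else g z)" (is "continuous_on U ?G")
proof -
  have "isCont ?G z" if z: "z \<in> U" for z
  proof (cases "z \<in> \<real>")
    case False
    have op: "open (U - \<real>)" using U closed_complex_Reals by blast
    then have "isCont g z" using g False z by (simp add: continuous_on_eq_continuous_at)
    moreover have "\<forall>\<^sub>F w in nhds z. ?G w = g w"
      using op False z by (intro eventually_mono[OF eventually_nhds_in_open[OF op]]) auto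
    ultimately show ?thesis by (simp add: isCont_cong)
  next
    case True
    show ?thesis
      unfolding continuous_at_eps_delta
    proof (intro allI impI)
      fix e :: real assume e: "e > 0"
      obtain d1 where d1: "d1 > 0" "ball z d1 \<subseteq> U" using U z open_contains_ball by blast
      obtain d2 where d2: "d2 > 0" "\<And>w. w \<notin> \<real> \<Longrightarrow> w \<noteq> z \<Longrightarrow> dist w z < d2 \<Longrightarrow> dist (g w) (l z) < e/2"
        using l[OF z True] e unfolding Lim_within by (metis ComplI half_gt_zero zero_less_dist_iff)
      define d where "d = min d1 d2"
      have "dist (?G w) (?G z) < e" if w: "dist w z < d" for w
      proof (cases "w \<in> \<real>")
        case False
        then show ?thesis using d2(2)[of w] w True e d_def by (cases "w = z") auto
      next
        case wr: True
        have wU: "w \<in> U" using w d1 unfolding d_def by (auto simp: dist_commute)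
        obtain y where y: "w = of_real y" using wr by (auto elim: Reals_cases)
        have lim: "((\<lambda>v. dist (g v) (l z)) \<longlongrightarrow> dist (l w) (l z)) (at w within - \<real>)"
          by (intro tendsto_intros l wU wr)
        have "\<forall>\<^sub>F v in at w within - \<real>. v \<in> ball z d"
          by (rule eventually_at_in_open'[of "ball z d" w, THEN filter_leD[OF at_le, rotated]])
             (use w in \<open>auto simp: dist_commute\<close>)
        moreover have "\<forall>\<^sub>F v in at w within - \<real>. v \<in> - \<real>"
          by (simp add: eventually_at_filter)
        ultimately have "\<forall>\<^sub>F v in at w within - \<real>. dist (g v) (l z) \<le> e/2"
        proof eventually_elim
          case (elim v)
          have "v \<noteq> z" using elim True by auto
          then show ?case using d2(2)[of v] elim unfolding d_def by (auto simp: dist_commute)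
        qed
        then have "dist (l w) (l z) \<le> e/2"
          using tendsto_upperbound[OF lim, of "e/2"] y by simp
        then show ?thesis using wr True e by simp
      qed
      moreover have "d > 0" using d1 d2 d_def by simp
      ultimately show "\<exists>d>0. \<forall>x'. dist x' z < d \<longrightarrow> dist (?G x') (?G z) < e" by blast
    qed
  qed
  then show ?thesis using U continuous_on_eq_continuous_at by blast
qed

text \<open>A Morera argument: continuity across the axis is enough to paste two holomorphic
  functions. The line is the one orthogonal to \<open>\<i>\<close>, because
  \<open>\<i> \<bullet> z\<close> is \<open>Im z\<close>.\<close>

lemma holomorphic_on_extend_across_reals:
  assumes U: "open U" and g: "g holomorphic_on U - \<real>"
    and l: "\<And>y. y \<in> U \<Longrightarrow> y \<in> \<real> \<Longrightarrow> (g \<longlongrightarrow> l y) (at y within - \<real>)"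
  shows "(\<lambda>z. if z \<in> \<real> then l z else g z) holomorphic_on U" (is "?G holomorphic_on U")
proof (rule holomorphic_on_paste_across_line[of U \<i> _ 0])
  have *: "?G holomorphic_on U - \<real>"
    by (rule holomorphic_transform[OF g]) auto
  have "\<i> \<bullet> z = Im z" for z by (simp add: inner_complex_def)
  moreover have "U \<inter> {z. Im z < 0} \<subseteq> U - \<real>" "U \<inter> {z. 0 < Im z} \<subseteq> U - \<real>"
    by (auto simp: Reals_iff_Im)
  ultimately show "?G holomorphic_on U \<inter> {z. \<i> \<bullet> z < 0}" "?G holomorphic_on U \<inter> {z. 0 < \<i> \<bullet> z}"
    using holomorphic_on_subset[OF *] by presburger+
  show "continuous_on U ?G"
    by (rule continuous_on_extend_across_reals[OF U holomorphic_on_imp_continuous_on[OF g] l])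
qed (use U in auto)

text \<open>The exponent -1/2 is what a product of two quartic root singularities produces. It is
  above -1, so (z - e) g(z) tends to 0 at each e in \<open>E\<close>, and Riemann's theorem removes
  the point; local finiteness of \<open>E\<close> makes these points isolated.\<close>

lemma entire_extension:
  fixes E :: "real set" and g :: "complex \<Rightarrow> complex"
  assumes E: "\<And>r. finite (E \<inter> {-r..r})"
    and g: "g holomorphic_on - \<real>"
    and l: "\<And>y. y \<notin> E \<Longrightarrow> \<exists>l. (g \<longlongrightarrow> l) (at (of_real y) within - \<real>)"
    and O: "\<And>e. e \<in> E \<Longrightarrow> (\<lambda>z. norm (g z)) \<in> O[at (of_real e) within - \<real>](\<lambda>z. norm (z - of_real e) powr (-1/2))"
  obtains X where "X holomorphic_on UNIV" "\<And>z. z \<notin> \<real> \<Longrightarrow> X z = g z"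
proof -
  obtain l where l: "\<And>y. y \<notin> E \<Longrightarrow> (g \<longlongrightarrow> l y) (at (of_real y) within - \<real>)"
    using l by metis
  define E' where "E' = complex_of_real ` E"
  define G where "G = (\<lambda>z. if z \<in> \<real> then l (Re z) else g z)"
  have nbhd: "\<exists>r>0. ball z r \<inter> E' \<subseteq> {z}" for z :: complex
  proof -
    have "finite (complex_of_real ` (E \<inter> {-(norm z + 1)..norm z + 1}))"
      by (intro finite_imageI E)
    then obtain d where d: "d > 0" "\<forall>x\<in>complex_of_real ` (E \<inter> {-(norm z + 1)..norm z + 1}). x \<noteq> z \<longrightarrow> d \<le> dist z x"
      using finite_set_avoid by blast
    have "ball z (min d 1) \<inter> E' \<subseteq> {z}"
    proof
      fix w assume w: "w \<in> ball z (min d 1) \<inter> E'"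
      then obtain y where y: "y \<in> E" "w = of_real y" unfolding E'_def by auto
      have "\<bar>y\<bar> \<le> norm z + 1"
        using w y norm_triangle_ineq2[of w z] by (auto simp: dist_norm norm_minus_commute)
      then have "w \<in> complex_of_real ` (E \<inter> {-(norm z + 1)..norm z + 1})"
        unfolding y(2) by (intro imageI) (use y in auto)
      then show "w \<in> {z}" using d w by fastforce
    qed
    then show ?thesis using d by (intro exI[of _ "min d 1"]) auto
  qed
  have cl: "closed E'"
  proof -
    have "\<exists>r>0. ball z r \<subseteq> - E'" if "z \<notin> E'" for z
      using nbhd[of z] that by blast
    then show ?thesis by (metis closed_def openI ComplD)
  qed
  have G: "G holomorphic_on - E'"
    unfolding G_def
  proof (rule holomorphic_on_extend_across_reals)
    show "open (- E')" using cl by blast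
    show "g holomorphic_on - E' - \<real>" by (rule holomorphic_on_subset[OF g]) auto
    fix y assume y: "y \<in> - E'" "y \<in> \<real>"
    then have "Re y \<notin> E" unfolding E'_def
      by (metis ComplD image_eqI of_real_Re)
    from l[OF this] show "(g \<longlongrightarrow> l (Re y)) (at y within - \<real>)" using y by simp
  qed
  \<comment> \<open>At the points of \<open>E\<close> the values of \<open>G\<close> are arbitrary,
    so they have to be replaced.\<close>
  define X where "X = remove_sings G"
  have an: "G analytic_on - E'" using G cl analytic_on_open by blast
  have "X analytic_on {z}" for z
  proof (cases "z \<in> E'")
    case False
    then show ?thesis unfolding X_def
      using analytic_on_subset[OF an, of "{z}"] by (simp add: remove_sings_analytic_on)
  next
    case True
    then obtain e where e: "e \<in> E" "z = of_real e" unfolding E'_def by auto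
    obtain r where r: "r > 0" "ball z r \<inter> E' \<subseteq> {z}" using nbhd by blast
    \<comment> \<open>The bound at z is known only off the real axis. \<open>H\<close> is (w - z)
      G(w) with value 0 at z; its continuity turns the bound into a limit through the full punctured
      neighbourhood, real points included.\<close>
    define H where "H = (\<lambda>w. if w \<in> \<real> then (if w = z then 0 else (w - z) * l (Re w)) else (w - z) * g w)"
    have "continuous_on (ball z r) H"
      unfolding H_def
    proof (rule continuous_on_extend_across_reals)
      show "continuous_on (ball z r - \<real>) (\<lambda>w. (w - z) * g w)"
        by (intro continuous_intros continuous_on_subset[OF holomorphic_on_imp_continuous_on[OF g]]) auto
      fix y assume y: "y \<in> ball z r" "y \<in> \<real>"
      show "((\<lambda>w. (w - z) * g w) \<longlongrightarrow> (if y = z then 0 else (y - z) * l (Re y))) (at y within - \<real>)"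
      proof (cases "y = z")
        case True
        obtain c where c: "c > 0" "\<forall>\<^sub>F w in at z within - \<real>. norm (norm (g w)) \<le> c * norm (norm (w - z) powr (-1/2))"
          using O[OF e(1)] e landau_o.bigE by blast
        have bd: "\<forall>\<^sub>F w in at z within - \<real>. norm ((w - z) * g w) \<le> c * norm (w - z) powr (1/2)"
          using c(2)
        proof eventually_elim
          case (elim w)
          have "norm (w - z) * norm (w - z) powr (-1/2) = norm (w - z) powr (1/2)"
            using powr_add[of "norm (w-z)" 1 "-1/2"] by simp
          moreover have "norm (w - z) * norm (g w) \<le> norm (w - z) * (c * norm (w - z) powr (-1/2))"
            using elim by (intro mult_left_mono) auto
          ultimately show ?case by (simp add: norm_mult mult.left_commute)
        qed
        have "((\<lambda>w. norm (w - z) powr (1/2)) \<longlongrightarrow> 0) (at z within - \<real>)"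
          by (rule tendsto_eq_intros refl | simp)+
        then have "((\<lambda>w. c * norm (w - z) powr (1/2)) \<longlongrightarrow> 0) (at z within - \<real>)"
          by (rule tendsto_mult_right_zero)
        then have "((\<lambda>w. (w - z) * g w) \<longlongrightarrow> 0) (at z within - \<real>)"
          by (rule Lim_null_comparison[rotated]) (use bd in simp)
        then show ?thesis using True by simp
      next
        case False
        then have "Re y \<notin> E" using y r unfolding E'_def
          by (metis IntI image_eqI of_real_Re singletonD subsetD)
        from l[OF this] have "(g \<longlongrightarrow> l (Re y)) (at y within - \<real>)" using y by simp
        then have "((\<lambda>w. (w - z) * g w) \<longlongrightarrow> (y - z) * l (Re y)) (at y within - \<real>)"
          by (intro tendsto_intros)
        then show ?thesis using False by simp
      qed
    qed auto
    then have "isCont H z" using r by (simp add: continuous_on_eq_continuous_at)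
    then have "(H \<longlongrightarrow> 0) (at z)" using e by (simp add: isCont_def H_def)
    then have "((\<lambda>w. (w - z) * G w) \<longlongrightarrow> 0) (at z)"
      by (rule Lim_transform_eventually) (auto simp: eventually_at_filter H_def G_def)
    moreover have "G holomorphic_on ball z r - {z}"
      by (rule holomorphic_on_subset[OF G]) (use r in auto)
    ultimately obtain k where k: "k holomorphic_on ball z r" "\<forall>w\<in>ball z r - {z}. k w = G w"
      using holomorphic_on_extend_lim[of G "ball z r" z] r by auto
    have "(k \<longlongrightarrow> k z) (at z)"
      using k(1) r by (metis centre_in_ball continuous_on_eq_continuous_at holomorphic_on_imp_continuous_on isContD open_ball)
    moreover have "\<forall>\<^sub>F w in at z. k w = G w"
      using k(2) r eventually_at_in_open[of "ball z r" z] by (auto elim!: eventually_mono)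
    ultimately have "(G \<longlongrightarrow> k z) (at z)" by (rule Lim_transform_eventually)
    moreover have "isolated_singularity_at G z"
      by (rule isolated_singularity_at_holomorphic[of G "ball z r"]) (use \<open>G holomorphic_on ball z r - {z}\<close> r in auto)
    ultimately show ?thesis unfolding X_def by (simp add: remove_sings_analytic_at)
  qed
  then have "X analytic_on UNIV" using analytic_on_analytic_at by blast
  then have "X holomorphic_on UNIV" by (rule analytic_imp_holomorphic)
  moreover have "X z = g z" if "z \<notin> \<real>" for z
  proof -
    have "z \<notin> E'" using that unfolding E'_def by auto
    then have "X z = G z" unfolding X_def
      using analytic_on_subset[OF an, of "{z}"] by simp
    then show ?thesis using that G_def by simp
  qed
  ultimately show ?thesis using that by blast
qed

section \<open>Gaps and admissible circles\<close>

locale candidate_data =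
  fixes d :: spectral_data
  assumes cand: "candidate_spectral_data d" and conv: "products_converge d"
begin

abbreviation E where "E \<equiv> edge d"
abbreviation R where "R \<equiv> gap_radius d"

definition ctr :: "int \<Rightarrow> real" where "ctr k = (E (2 * k) + E (2 * k - 1)) / 2"

lemma disc_center_eq: "disc_center d k = of_real (ctr k)"
  by (simp add: disc_center_def ctr_def)

lemma edge_idxI: "k \<in> gap_idx d \<Longrightarrow> 2 * k \<in> edge_idx d" "k \<in> gap_idx d \<Longrightarrow> 2 * k - 1 \<in> edge_idx d"
  by (auto simp: edge_idx_def)

lemma edge_less: "i \<in> edge_idx d \<Longrightarrow> j \<in> edge_idx d \<Longrightarrow> i < j \<Longrightarrow> E i < E j"
  using cand unfolding candidate_spectral_data_def strict_mono_on_def by blast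

lemma gap_less: "k \<in> gap_idx d \<Longrightarrow> E (2 * k - 1) < E (2 * k)"
  by (intro edge_less edge_idxI) auto

lemma gaps_ordered: "k \<in> gap_idx d \<Longrightarrow> l \<in> gap_idx d \<Longrightarrow> k < l \<Longrightarrow> E (2 * k) < E (2 * l - 1)"
  by (intro edge_less edge_idxI) auto

lemma gam_bounds: "k \<in> gap_idx d \<Longrightarrow> E (2 * k - 1) \<le> gam d k" "k \<in> gap_idx d \<Longrightarrow> gam d k \<le> E (2 * k)"
  using cand unfolding candidate_spectral_data_def by auto

lemma nu_cases: "k \<in> gap_idx d \<Longrightarrow> nu d k = -1 \<or> nu d k = 0 \<or> nu d k = 1"
  using cand unfolding candidate_spectral_data_def by auto

lemma ctr_less: "k \<in> gap_idx d \<Longrightarrow> l \<in> gap_idx d \<Longrightarrow> k < l \<Longrightarrow> ctr k < ctr l"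
  using gaps_ordered[of k l] gap_less[of k] gap_less[of l] by (simp add: ctr_def)

lemma ctr_inj: "inj_on ctr (gap_idx d)"
  by (rule inj_onI) (metis ctr_less less_irrefl linorder_neqE)

lemma gap_length_le: "k \<in> gap_idx d \<Longrightarrow> E (2 * k) - E (2 * k - 1) \<le> R"
proof -
  assume k: "k \<in> gap_idx d"
  have "\<bar>E (2 * k) - E (2 * k - 1)\<bar> \<le> R" unfolding gap_radius_def
    by (rule cSUP_upper[OF k]) (use cand in \<open>simp add: candidate_spectral_data_def\<close>)
  then show ?thesis by simp
qed

lemma gap_idx_extend:
  "k \<in> gap_idx d \<Longrightarrow> l \<in> gap_idx d \<Longrightarrow> k \<le> i \<Longrightarrow> i \<le> l \<Longrightarrow> i \<in> gap_idx d"
  unfolding gap_idx_def by (auto intro: order_trans[of _ "Fin k"] order_trans[of _ "Fin l"])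

lemma gap_idx_nonempty: "gap_idx d \<noteq> {}"
proof -
  have "g_minus d < g_plus d" using cand unfolding candidate_spectral_data_def by blast
  then show ?thesis unfolding gap_idx_def
    by (cases "g_minus d"; cases "g_plus d") (auto intro: exI[of _ "0::int"] less_imp_le)
qed

lemma R_pos: "R > 0"
  using gap_idx_nonempty gap_less gap_length_le by fastforce

text \<open>A closed gap reaches at most R/2 from its centre. The strict inequality keeps it off
  every circle that touches its disc at most tangentially on the real axis.\<close>

lemma in_gap_ctr:
  assumes "k \<in> gap_idx d" "E (2 * k - 1) \<le> x" "x \<le> E (2 * k)"
  shows "\<bar>x - ctr k\<bar> < R"
  using assms gap_length_le[of k] R_pos unfolding ctr_def by (auto simp: abs_if field_simps)

lemma finite_gap_idx: "g_minus d \<noteq> Minf \<Longrightarrow> g_plus d \<noteq> Pinf \<Longrightarrow> finite (gap_idx d)"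
proof -
  assume a: "g_minus d \<noteq> Minf" "g_plus d \<noteq> Pinf"
  have "g_minus d < g_plus d" using cand unfolding candidate_spectral_data_def by blast
  then obtain m n where "g_minus d = Fin m" "g_plus d = Fin n"
    using a by (cases "g_minus d"; cases "g_plus d") auto
  then have "gap_idx d \<subseteq> {m..n}" by (auto simp: gap_idx_def)
  then show ?thesis using finite_subset by blast
qed

lemma finite_near:
  fixes N :: int
  shows "finite {k \<in> gap_idx d. \<bar>k\<bar> < N}"
  by (rule finite_subset[of _ "{-N..N}"]) auto

lemma far_separated:
  obtains N :: int where
    "\<And>k l. k \<in> gap_idx d \<Longrightarrow> l \<in> gap_idx d \<Longrightarrow> \<bar>k\<bar> \<ge> N \<Longrightarrow> \<bar>l\<bar> \<ge> N \<Longrightarrow> k \<noteq> l \<Longrightarrow> 2 * R \<le> \<bar>ctr k - ctr l\<bar>"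
proof (cases "g_minus d = Minf \<or> g_plus d = Pinf")
  case True
  then obtain N where N: "disjoint_family_on (\<lambda>n. ball (disc_center d n) R) {n\<in>gap_idx d. \<bar>n\<bar> \<ge> N}"
    using cand unfolding candidate_spectral_data_def by blast
  have "2 * R \<le> \<bar>ctr k - ctr l\<bar>"
    if "k \<in> gap_idx d" "l \<in> gap_idx d" "\<bar>k\<bar> \<ge> N" "\<bar>l\<bar> \<ge> N" "k \<noteq> l" for k l
  proof (rule ccontr)
    assume a: "\<not> ?thesis"
    \<comment> \<open>Open discs of equal radius R whose centres are closer than 2R share the
      midpoint of the centres.\<close>
    define m where "m = complex_of_real ((ctr k + ctr l) / 2)"
    have dm: "dist (complex_of_real (ctr j)) m = \<bar>ctr j - (ctr k + ctr l) / 2\<bar>" for j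
      unfolding m_def dist_norm by (metis norm_of_real of_real_diff real_norm_def)
    have "m \<in> ball (disc_center d k) R" "m \<in> ball (disc_center d l) R"
      using a by (auto simp: disc_center_eq dm abs_if field_simps split: if_splits)
    then show False using N that unfolding disjoint_family_on_def by blast
  qed
  then show ?thesis using that by blast
next
  case False
  then have fin: "finite (gap_idx d)" using finite_gap_idx by blast
  have "bdd_above (abs ` gap_idx d)" using fin by simp
  then obtain N where "\<And>k. k \<in> gap_idx d \<Longrightarrow> \<bar>k\<bar> \<le> N" unfolding bdd_above_def by blast
  \<comment> \<open>With finitely many gaps the bound lies beyond every index, and the separation is
    vacuous.\<close>
  then show ?thesis by (intro that[of "N+1"]) fastforce
qed

text \<open>Local finiteness comes from the separation: the far centres form a uniformly discrete
  set, which meets a bounded interval in finitely many points, and only finitely many indices are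
  not far.\<close>

lemma finite_ctr: "finite {k \<in> gap_idx d. \<bar>ctr k\<bar> \<le> M}"
proof -
  obtain N where N: "\<And>k l. k \<in> gap_idx d \<Longrightarrow> l \<in> gap_idx d \<Longrightarrow> \<bar>k\<bar> \<ge> N \<Longrightarrow> \<bar>l\<bar> \<ge> N \<Longrightarrow> k \<noteq> l \<Longrightarrow> 2 * R \<le> \<bar>ctr k - ctr l\<bar>"
    using far_separated by blast
  define F where "F = {k \<in> gap_idx d. \<bar>ctr k\<bar> \<le> M \<and> \<bar>k\<bar> \<ge> N}"
  have "uniform_discrete (ctr ` F)"
    by (rule uniformI2[of "2 * R"]) (use R_pos N in \<open>auto simp: F_def dist_real_def\<close>)
  moreover have "bounded (ctr ` F)"
    unfolding bounded_iff by (intro exI[of _ M]) (auto simp: F_def)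
  ultimately have "finite (ctr ` F)" using uniform_discrete_finite_iff by blast
  moreover have "inj_on ctr F" by (rule inj_on_subset[OF ctr_inj]) (auto simp: F_def)
  ultimately have "finite F" using finite_imageD by blast
  then have "finite (F \<union> {k \<in> gap_idx d. \<bar>k\<bar> < N})" using finite_near by blast
  moreover have "{k \<in> gap_idx d. \<bar>ctr k\<bar> \<le> M} \<subseteq> F \<union> {k \<in> gap_idx d. \<bar>k\<bar> < N}"
    by (auto simp: F_def)
  ultimately show ?thesis using finite_subset by blast
qed

lemma edge_setE:
  assumes "e \<in> edge_set d"
  obtains k where "k \<in> gap_idx d" "e = E (2 * k) \<or> e = E (2 * k - 1)"
  using assms unfolding edge_set_def edge_idx_def by blast

lemma edge_setI: "k \<in> gap_idx d \<Longrightarrow> E (2 * k) \<in> edge_set d" "k \<in> gap_idx d \<Longrightarrow> E (2 * k - 1) \<in> edge_set d"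
  using edge_idxI unfolding edge_set_def by auto

lemma finite_edges: "finite (edge_set d \<inter> {-M..M})"
proof -
  have "edge_set d \<inter> {-M..M} \<subseteq> (\<Union>k\<in>{k \<in> gap_idx d. \<bar>ctr k\<bar> \<le> M + R}. {E (2 * k), E (2 * k - 1)})"
  proof
    fix e assume e: "e \<in> edge_set d \<inter> {-M..M}"
    then obtain k where k: "k \<in> gap_idx d" "e = E (2 * k) \<or> e = E (2 * k - 1)"
      using edge_setE by blast
    have "\<bar>e - ctr k\<bar> < R"
      using k gap_less[OF k(1)] by (intro in_gap_ctr) auto
    then show "e \<in> (\<Union>k\<in>{k \<in> gap_idx d. \<bar>ctr k\<bar> \<le> M + R}. {E (2 * k), E (2 * k - 1)})"
      using e k by (intro UN_I[of k]) auto
  qed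
  then show ?thesis using finite_ctr[of "M+R"] by (auto intro: finite_subset)
qed

text \<open>The point \<open>a\<close> is \<open>a0\<close> itself, or the right end of the interval containing \<open>a0\<close>: far intervals
  have equal length and are disjoint.\<close>

lemma right_gap_free:
  obtains a where "a \<ge> a0" "\<And>k. k \<in> gap_idx d \<Longrightarrow> ctr k + R \<le> a \<or> a \<le> ctr k - R"
proof -
  obtain N where N: "\<And>k l. k \<in> gap_idx d \<Longrightarrow> l \<in> gap_idx d \<Longrightarrow> \<bar>k\<bar> \<ge> N \<Longrightarrow> \<bar>l\<bar> \<ge> N \<Longrightarrow> k \<noteq> l \<Longrightarrow> 2 * R \<le> \<bar>ctr k - ctr l\<bar>"
    using far_separated by blast
  have "bdd_above (ctr ` {k \<in> gap_idx d. \<bar>k\<bar> < N})" using finite_near by simp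
  then obtain M where M: "\<And>k. k \<in> gap_idx d \<Longrightarrow> \<bar>k\<bar> < N \<Longrightarrow> ctr k \<le> M" unfolding bdd_above_def by blast
  define a1 where "a1 = max a0 (M + R)"
  show ?thesis
  proof (cases "\<forall>k\<in>gap_idx d. ctr k + R \<le> a1 \<or> a1 \<le> ctr k - R")
    case True
    then show ?thesis using that[of a1] a1_def by auto
  next
    case False
    then obtain n where n: "n \<in> gap_idx d" "ctr n + R > a1" "a1 > ctr n - R" by fastforce
    have nN: "\<bar>n\<bar> \<ge> N" using M[of n] n a1_def by fastforce
    have "ctr k + R \<le> ctr n + R \<or> ctr n + R \<le> ctr k - R" if k: "k \<in> gap_idx d" for k
    proof (cases "\<bar>k\<bar> < N")
      case True
      then show ?thesis using M[OF k] n a1_def by auto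
    next
      case False
      then show ?thesis using N[OF k n(1)] nN by (cases "k = n") auto
    qed
    then show ?thesis using that[of "ctr n + R"] n a1_def by auto
  qed
qed

lemma left_gap_free:
  obtains a where "a \<le> a0" "\<And>k. k \<in> gap_idx d \<Longrightarrow> ctr k + R \<le> a \<or> a \<le> ctr k - R"
proof -
  obtain N where N: "\<And>k l. k \<in> gap_idx d \<Longrightarrow> l \<in> gap_idx d \<Longrightarrow> \<bar>k\<bar> \<ge> N \<Longrightarrow> \<bar>l\<bar> \<ge> N \<Longrightarrow> k \<noteq> l \<Longrightarrow> 2 * R \<le> \<bar>ctr k - ctr l\<bar>"
    using far_separated by blast
  have "bdd_below (ctr ` {k \<in> gap_idx d. \<bar>k\<bar> < N})" using finite_near by simp
  then obtain M where M: "\<And>k. k \<in> gap_idx d \<Longrightarrow> \<bar>k\<bar> < N \<Longrightarrow> M \<le> ctr k" unfolding bdd_below_def by blast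
  define a1 where "a1 = min a0 (M - R)"
  show ?thesis
  proof (cases "\<forall>k\<in>gap_idx d. ctr k + R \<le> a1 \<or> a1 \<le> ctr k - R")
    case True
    then show ?thesis using that[of a1] a1_def by auto
  next
    case False
    then obtain n where n: "n \<in> gap_idx d" "ctr n + R > a1" "a1 > ctr n - R" by fastforce
    have nN: "\<bar>n\<bar> \<ge> N" using M[of n] n a1_def by fastforce
    have "ctr k + R \<le> ctr n - R \<or> ctr n - R \<le> ctr k - R" if k: "k \<in> gap_idx d" for k
    proof (cases "\<bar>k\<bar> < N")
      case True
      then show ?thesis using M[OF k] n a1_def by auto
    next
      case False
      then show ?thesis using N[OF k n(1)] nN by (cases "k = n") auto
    qed
    then show ?thesis using that[of "ctr n - R"] n a1_def by auto
  qed
qed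

lemma disc_complement_iff:
  "z \<in> disc_complement d \<longleftrightarrow> z \<notin> \<real> \<and> (\<forall>k\<in>gap_idx d. R < dist (of_real (ctr k)) z)"
  by (auto simp: disc_complement_def disc_center_eq not_le)

text \<open>A circle centred on the real axis can only be tangent to a disc on the real axis.\<close>

lemma admissible_circle:
  obtains x r where "r > 0" "cball 0 \<rho> \<subseteq> ball (complex_of_real x) r"
    "\<And>k. k \<in> gap_idx d \<Longrightarrow> \<bar>ctr k - x\<bar> \<le> r - R \<or> r + R \<le> \<bar>ctr k - x\<bar>"
    "\<And>z. z \<in> sphere (complex_of_real x) r \<Longrightarrow> z \<notin> \<real> \<Longrightarrow> z \<in> disc_complement d"
proof -
  \<comment> \<open>The circle will have the segment from b to a as diameter, with a >= s and b <=
    -s. The summand \<open>\<bar>\<rho>\<bar>\<close> makes it enclose the given disc; the summand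
    \<open>R\<close> gives r > R, which is needed for a disc with the same centre as the
    circle.\<close>
  define s where "s = \<bar>\<rho>\<bar> + R + 1"
  have s: "s > \<bar>\<rho>\<bar>" "s > R" using R_pos s_def by auto
  obtain a where a: "a \<ge> s" "\<And>k. k \<in> gap_idx d \<Longrightarrow> ctr k + R \<le> a \<or> a \<le> ctr k - R"
    using right_gap_free by blast
  obtain b where b: "b \<le> -s" "\<And>k. k \<in> gap_idx d \<Longrightarrow> ctr k + R \<le> b \<or> b \<le> ctr k - R"
    using left_gap_free by blast
  define x where "x = (a + b) / 2"
  define r where "r = (a - b) / 2"
  have r: "r > R" "r > 0" using a b s R_pos unfolding r_def by auto
  have sub: "cball 0 \<rho> \<subseteq> ball (complex_of_real x) r"
  proof
    fix z :: complex assume "z \<in> cball 0 \<rho>"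
    then have "norm z \<le> \<rho>" by simp
    moreover have "norm (complex_of_real x - z) \<le> \<bar>x\<bar> + norm z"
      by (rule order_trans[OF norm_triangle_ineq4]) simp
    moreover have "\<bar>x\<bar> + \<rho> < r"
    proof -
      have "\<rho> < a" "b < - \<rho>" using a(1) b(1) s by linarith+
      then have "x + \<rho> < r" "- x + \<rho> < r" unfolding x_def r_def by (simp_all add: field_simps)
      then show ?thesis by linarith
    qed
    ultimately show "z \<in> ball (complex_of_real x) r" by (simp add: dist_norm)
  qed
  have alt: "\<bar>ctr k - x\<bar> \<le> r - R \<or> r + R \<le> \<bar>ctr k - x\<bar>" if "k \<in> gap_idx d" for k
    using a(2)[OF that] b(2)[OF that] R_pos unfolding x_def r_def by (auto simp: abs_if field_simps)
  have "z \<in> disc_complement d" if z: "z \<in> sphere (complex_of_real x) r" "z \<notin> \<real>" for z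
    unfolding disc_complement_iff
  proof (intro conjI ballI z(2))
    fix k assume k: "k \<in> gap_idx d"
    define u where "u = Re z - x"
    define v where "v = Im z"
    define e where "e = ctr k - x"
    have v: "v \<noteq> 0" using z(2) by (simp add: v_def Reals_iff_Im)
    have "norm (z - of_real x) = r" using z(1) by (simp add: dist_norm norm_minus_commute)
    then have uv: "u\<^sup>2 + v\<^sup>2 = r\<^sup>2" unfolding u_def v_def
      by (smt (verit) cmod_power2 Re_complex_of_real Im_complex_of_real minus_complex.sel)
    have D: "(dist (of_real (ctr k)) z)\<^sup>2 = (u - e)\<^sup>2 + v\<^sup>2"
      unfolding dist_norm norm_minus_commute[of "of_real (ctr k)"] cmod_power2 u_def v_def e_def by simp
    have ur: "\<bar>u\<bar> < r"
    proof -
      have "u\<^sup>2 < r\<^sup>2" using uv v by (smt (verit) zero_less_power2)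
      then show ?thesis using r(2) by (metis power2_abs power2_less_imp_less less_imp_le)
    qed
    \<comment> \<open>On the circle the squared distance to the centre of the disc is r^2 - 2ue +
      e^2, and |u| < r off the real axis. For e nonzero it therefore strictly exceeds (r - |e|)^2,
      its least value on the circle, which is attained on the axis.\<close>
    have "R\<^sup>2 < (u - e)\<^sup>2 + v\<^sup>2"
    proof (cases "e = 0")
      case True
      then have "(u - e)\<^sup>2 + v\<^sup>2 = r\<^sup>2" using uv by simp
      then show ?thesis using r R_pos by (simp add: power_strict_mono)
    next
      case False
      have "u * e \<le> \<bar>u\<bar> * \<bar>e\<bar>" by (metis abs_ge_self abs_mult)
      moreover have "\<bar>u\<bar> * \<bar>e\<bar> < r * \<bar>e\<bar>" using ur False by simp
      moreover have "(u - e)\<^sup>2 + v\<^sup>2 = r\<^sup>2 - 2 * (u * e) + e\<^sup>2" using uv by (simp add: power2_diff)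
      moreover have "(r - \<bar>e\<bar>)\<^sup>2 = r\<^sup>2 - 2 * (r * \<bar>e\<bar>) + e\<^sup>2" by (simp add: power2_diff)
      ultimately have "(r - \<bar>e\<bar>)\<^sup>2 < (u - e)\<^sup>2 + v\<^sup>2" by linarith
      moreover have "R \<le> \<bar>r - \<bar>e\<bar>\<bar>" using alt[OF k] e_def by auto
      then have "R\<^sup>2 \<le> (r - \<bar>e\<bar>)\<^sup>2" using R_pos by (metis abs_of_pos abs_le_square_iff)
      ultimately show ?thesis by linarith
    qed
    then show "R < dist (of_real (ctr k)) z"
      using D by (metis power2_less_imp_less zero_le_dist)
  qed
  then show ?thesis using that[OF r(2) sub alt] by blast
qed

section \<open>Locating a real point in a gap or a band\<close>

lemma edge_intervalI_gap: "n \<in> gap_idx d \<Longrightarrow> E (2 * n - 1) \<le> y \<Longrightarrow> y \<le> E (2 * n) \<Longrightarrow> y \<in> edge_interval d (2 * n - 1) (2 * n)"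
  by (simp add: edge_interval_def edge_ext_def edge_idxI)

lemma edge_idx_even: "2 * k \<in> edge_idx d \<longleftrightarrow> k \<in> gap_idx d"
  unfolding edge_idx_def by (auto, presburger)

lemma edge_idx_odd: "2 * k - 1 \<in> edge_idx d \<longleftrightarrow> k \<in> gap_idx d"
  unfolding edge_idx_def by (auto, presburger)

text \<open>The jump conditions are indexed by n, so a band point needs an index: one more than that
  of the last gap to its left, or that of the first gap to its right if there is none to the left.
  These extremal gaps exist by \<open>finite_ctr\<close>. The band case also keeps the fact that y
  avoids all closed gaps; later this excludes zeros of f^+ and f^- at y.\<close>

lemma real_cases:
  assumes "y \<notin> edge_set d"
  obtains (gap) n where "n \<in> gap_idx d" "E (2 * n - 1) < y" "y < E (2 * n)"
  | (band) n where "\<And>k. k \<in> gap_idx d \<Longrightarrow> y < E (2 * k - 1) \<or> E (2 * k) < y"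
      "y \<in> edge_interval d (2 * n - 2) (2 * n - 1)"
proof (cases "\<exists>n\<in>gap_idx d. E (2 * n - 1) < y \<and> y < E (2 * n)")
  case True
  then show ?thesis using gap by blast
next
  case False
  have alt: "y < E (2 * k - 1) \<or> E (2 * k) < y" if k: "k \<in> gap_idx d" for k
  proof -
    have "y \<noteq> E (2 * k)" "y \<noteq> E (2 * k - 1)" using edge_setI[OF k] assms by auto
    then show ?thesis using False k by fastforce
  qed
  define L where "L = {k\<in>gap_idx d. E (2 * k) < y}"
  define H where "H = {k\<in>gap_idx d. y < E (2 * k - 1)}"
  have LH: "gap_idx d = L \<union> H" using alt unfolding L_def H_def by blast
  have ltLH: "k < l" if "k \<in> L" "l \<in> H" for k l
    using that gaps_ordered[of l k] gap_less[of l] gap_less[of k] unfolding L_def H_def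
    by (cases k l rule: linorder_cases) auto
  show ?thesis
  proof (cases "L = {}")
    case False
    then obtain k0 where k0: "k0 \<in> L" by blast
    have "finite {k \<in> L. k0 \<le> k}"
    proof (rule finite_subset[OF _ finite_ctr[of "\<bar>ctr k0\<bar> + \<bar>y\<bar>"]])
      show "{k \<in> L. k0 \<le> k} \<subseteq> {k \<in> gap_idx d. \<bar>ctr k\<bar> \<le> \<bar>ctr k0\<bar> + \<bar>y\<bar>}"
      proof
        fix k assume k: "k \<in> {k \<in> L. k0 \<le> k}"
        then have "ctr k0 \<le> ctr k" using k0 ctr_less[of k0 k] unfolding L_def
          by (cases "k = k0") auto
        moreover have "ctr k < y" using k gap_less[of k] unfolding L_def ctr_def by auto
        ultimately show "k \<in> {k \<in> gap_idx d. \<bar>ctr k\<bar> \<le> \<bar>ctr k0\<bar> + \<bar>y\<bar>}"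
          using k unfolding L_def by auto
      qed
    qed
    moreover define m where "m = Max {k \<in> L. k0 \<le> k}"
    ultimately have m: "m \<in> L" "\<And>k. k \<in> L \<Longrightarrow> k \<le> m"
      using k0 Max_in[of "{k \<in> L. k0 \<le> k}"] Max_ge[of "{k \<in> L. k0 \<le> k}"] unfolding m_def
      by (auto, metis (mono_tags, lifting) dual_order.trans linorder_le_cases mem_Collect_eq)
    have "edge_ext d (2 * (m + 1) - 2) = Fin (E (2 * m))"
      using m(1) unfolding L_def by (simp add: edge_ext_def edge_idxI)
    moreover have "Fin y \<le> edge_ext d (2 * (m + 1) - 1)"
    proof (cases "m + 1 \<in> gap_idx d")
      case True
      then have "m + 1 \<in> H" using LH m(2)[of "m+1"] by auto
      then show ?thesis using edge_idxI(2)[OF True] unfolding H_def by (simp add: edge_ext_def)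
    next
      case False
      \<comment> \<open>The index set is an interval, so a missing gap m + 1 after the gap m means
        that no further edge exists, and \<open>edge_ext\<close> takes the value
        \<open>Pinf\<close>.\<close>
      have "2 * (m + 1) - 1 \<notin> edge_idx d" using False edge_idx_odd by blast
      moreover have "\<not> (\<exists>k\<in>edge_idx d. 2 * (m + 1) - 1 < k)"
      proof
        assume "\<exists>k\<in>edge_idx d. 2 * (m + 1) - 1 < k"
        then obtain l where l: "l \<in> gap_idx d" "m + 1 \<le> l" unfolding edge_idx_def by fastforce
        then show False using False gap_idx_extend[of m l "m+1"] m(1) unfolding L_def by auto
      qed
      ultimately show ?thesis by (simp add: edge_ext_def)
    qed
    ultimately have "y \<in> edge_interval d (2 * (m + 1) - 2) (2 * (m + 1) - 1)"
      using m(1) unfolding edge_interval_def L_def by (auto simp: less_imp_le)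
    then show ?thesis using band alt by blast
  next
    case True
    then have "H \<noteq> {}" using LH gap_idx_nonempty by blast
    then obtain k0 where k0: "k0 \<in> H" by blast
    have "finite {k \<in> H. k \<le> k0}"
    proof (rule finite_subset[OF _ finite_ctr[of "\<bar>ctr k0\<bar> + \<bar>y\<bar>"]])
      show "{k \<in> H. k \<le> k0} \<subseteq> {k \<in> gap_idx d. \<bar>ctr k\<bar> \<le> \<bar>ctr k0\<bar> + \<bar>y\<bar>}"
      proof
        fix k assume k: "k \<in> {k \<in> H. k \<le> k0}"
        then have "ctr k \<le> ctr k0" using k0 ctr_less[of k k0] unfolding H_def
          by (cases "k = k0") auto
        moreover have "y < ctr k" using k gap_less[of k] unfolding H_def ctr_def by auto
        ultimately show "k \<in> {k \<in> gap_idx d. \<bar>ctr k\<bar> \<le> \<bar>ctr k0\<bar> + \<bar>y\<bar>}"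
          using k unfolding H_def by auto
      qed
    qed
    moreover define m where "m = Min {k \<in> H. k \<le> k0}"
    ultimately have m: "m \<in> H" "\<And>k. k \<in> H \<Longrightarrow> m \<le> k"
      using k0 Min_in[of "{k \<in> H. k \<le> k0}"] Min_le[of "{k \<in> H. k \<le> k0}"] unfolding m_def
      by (auto, metis (mono_tags, lifting) dual_order.trans linorder_le_cases mem_Collect_eq)
    have mg: "m \<in> gap_idx d" using m unfolding H_def by auto
    have "m - 1 \<notin> gap_idx d" using LH True m(2)[of "m-1"] by auto
    then have "2 * (m - 1) \<notin> edge_idx d" using edge_idx_even by blast
    then have "edge_ext d (2 * m - 2) = Minf"
      using edge_idxI(1)[OF mg] by (auto simp: edge_ext_def algebra_simps intro!: bexI[of _ "2 * m"])
    moreover have "edge_ext d (2 * m - 1) = Fin (E (2 * m - 1))"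
      using edge_idxI[OF mg] by (simp add: edge_ext_def)
    ultimately have "y \<in> edge_interval d (2 * m - 2) (2 * m - 1)"
      using m(1) unfolding edge_interval_def H_def by (auto simp: less_imp_le)
    then show ?thesis using band alt by blast
  qed
qed

lemma edges_unbounded:
  assumes "infinite (gap_idx d)"
  shows "\<exists>k\<in>gap_idx d. M < \<bar>E (2 * k)\<bar>"
proof (rule ccontr)
  assume a: "\<not> ?thesis"
  have "gap_idx d \<subseteq> {k \<in> gap_idx d. \<bar>ctr k\<bar> \<le> M + R}"
  proof
    fix k assume k: "k \<in> gap_idx d"
    then have "\<bar>E (2 * k) - ctr k\<bar> < R" using gap_less[OF k] by (intro in_gap_ctr) auto
    then show "k \<in> {k \<in> gap_idx d. \<bar>ctr k\<bar> \<le> M + R}" using a k by force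
  qed
  then show False using assms finite_ctr finite_subset by blast
qed

end

section \<open>The products\<close>

text \<open>Estimates from the normalisation stop at the two points where the circle crosses the
  real axis. A circle is connected with more than one point, hence has no isolated points; so its
  non-real part is dense in it and the bound extends by continuity.\<close>

lemma sphere_bound_from_nonreal:
  fixes u v :: "complex \<Rightarrow> complex"
  assumes r: "r > 0" and u: "continuous_on UNIV u" and v: "continuous_on UNIV v"
    and le: "\<And>z. z \<in> sphere (of_real x) r \<Longrightarrow> z \<notin> \<real> \<Longrightarrow> norm (u z) \<le> c * norm (v z)"
    and z: "z \<in> sphere (of_real x) r"
  shows "norm (u z) \<le> c * norm (v z)"
proof -
  let ?S = "sphere (complex_of_real x) r"
  have in_S: "of_real (x + r) \<in> ?S" "of_real (x - r) \<in> ?S"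
    using r by (simp_all add: dist_of_real dist_real_def del: of_real_add of_real_diff)
  have ne: "complex_of_real (x + r) \<noteq> of_real (x - r)"
    using r by (simp only: of_real_eq_iff)
  have "?S \<noteq> {a}" for a
  proof
    assume S: "?S = {a}"
    have "of_real (x + r) = a" "of_real (x - r) = a"
      by (rule singletonD, rule subst[OF S], fact in_S)+
    then show False using ne by argo
  qed
  then have "z islimpt ?S"
    by (rule connected_imp_perfect[OF connected_sphere z, rotated]) simp
  moreover have sub: "?S \<subseteq> (?S - \<real>) \<union> {of_real (x + r), of_real (x - r)}"
  proof
    fix w assume w: "w \<in> ?S"
    show "w \<in> (?S - \<real>) \<union> {of_real (x + r), of_real (x - r)}"
    proof (cases "w \<in> \<real>")
      case True
      then obtain y where y: "w = of_real y" by (auto elim: Reals_cases)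
      have "dist (complex_of_real x) (complex_of_real y) = r" using w y by simp
      then have "\<bar>x - y\<bar> = r" by (simp add: dist_of_real dist_real_def)
      then have "y = x + r \<or> y = x - r" by linarith
      then show ?thesis using y by auto
    qed (use w in auto)
  qed
  ultimately have "z islimpt (?S - \<real>) \<union> {of_real (x + r), of_real (x - r)}"
    by (rule islimpt_subset)
  then have "z islimpt (?S - \<real>)"
    unfolding islimpt_Un using islimpt_finite[of "{complex_of_real (x + r), of_real (x - r)}" z] by simp
  then have "z \<in> closure (?S - \<real>)" by (simp add: closure_def)
  then have "norm (u z) - c * norm (v z) \<le> 0"
    by (rule continuous_le_on_closure[rotated])
      (auto intro!: continuous_intros continuous_on_subset[OF u] continuous_on_subset[OF v] simp: le)
  then show ?thesis by simp
qed

lemma eventually_to_infinity_within: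
  "eventually P (to_infinity_within S) \<longleftrightarrow> (\<exists>\<rho>. \<forall>z\<in>S. \<rho> \<le> norm z \<longrightarrow> P z)"
  unfolding to_infinity_within_def eventually_inf_principal eventually_at_infinity by auto

lemma entire_simple_zeros_mult:
  assumes F: "entire_simple_zeros F Z" and H: "entire_simple_zeros H W" and d: "Z \<inter> W = {}"
  shows "entire_simple_zeros (\<lambda>z. F z * H z) (Z \<union> W)"
proof -
  have hol: "F holomorphic_on UNIV" "H holomorphic_on UNIV"
    and F0: "\<And>z. F z = 0 \<longleftrightarrow> z \<in> of_real ` Z" and H0: "\<And>z. H z = 0 \<longleftrightarrow> z \<in> of_real ` W"
    and F': "\<And>z. z \<in> of_real ` Z \<Longrightarrow> deriv F z \<noteq> 0" and H': "\<And>z. z \<in> of_real ` W \<Longrightarrow> deriv H z \<noteq> 0"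
    using F H unfolding entire_simple_zeros_def by auto
  have dj: "complex_of_real ` Z \<inter> of_real ` W = {}" using d by auto
  have "deriv (\<lambda>z. F z * H z) z \<noteq> 0" if z: "z \<in> of_real ` (Z \<union> W)" for z
  proof -
    have "deriv (\<lambda>z. F z * H z) z = F z * deriv H z + deriv F z * H z"
      by (rule deriv_mult) (use hol holomorphic_on_imp_differentiable_at in auto)
    then show ?thesis using z dj F0[of z] H0[of z] F'[of z] H'[of z]
      by (cases "z \<in> of_real ` Z") (auto simp: image_Un)
  qed
  moreover have "(F z * H z = 0) = (z \<in> of_real ` (Z \<union> W))" for z
    using F0[of z] H0[of z] by (auto simp: image_Un)
  ultimately show ?thesis
    unfolding entire_simple_zeros_def using hol by (auto intro!: holomorphic_intros)
qed

lemma zorder_simple_zero: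
  assumes "entire_simple_zeros F Z"
  shows "zorder F z = (if F z = 0 then 1 else 0)"
proof (cases "F z = 0")
  case True
  then have "zorder F z = 1"
    using assms unfolding entire_simple_zeros_def
    by (intro zorder_zero_eqI[of F UNIV]) auto
  then show ?thesis using True by simp
next
  case False
  then have "zorder F z = 0"
    using assms unfolding entire_simple_zeros_def
    by (intro zorder_zero_eqI[of F UNIV]) auto
  then show ?thesis using False by simp
qed

lemma eventually_nonzero_at:
  assumes "f holomorphic_on UNIV" "f w \<noteq> 0"
  shows "eventually (\<lambda>z. f z \<noteq> 0) (at z)"
  using non_zero_neighbour_alt[of f UNIV z w] assms
  by (auto elim: eventually_mono)

lemma zorder_entire_nonneg:
  assumes "f holomorphic_on UNIV" "f w \<noteq> 0"
  shows "zorder f z \<ge> 0" "f z = 0 \<Longrightarrow> zorder f z \<ge> 1"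
proof -
  have "\<exists>w\<in>UNIV. f w \<noteq> 0" using assms(2) by blast
  from zorder_exist_zero[OF assms(1) open_UNIV connected_UNIV UNIV_I this, of z]
  have *: "if f z = 0 then zorder f z > 0 else zorder f z = 0" by (rule conjunct1)
  then show "zorder f z \<ge> 0" by (simp split: if_splits)
  show "zorder f z \<ge> 1" if "f z = 0" using * that by simp
qed

lemma pi_k_nonzero: "pi_k k \<noteq> 0"
  by (simp add: pi_k_def)

context candidate_data
begin

text \<open>Factor k sits in the group N = |k|. Replacing it by the constant 1 pulls it out of a
  partial product without disturbing the symmetric grouping on which convergence rests.\<close>

lemma partial_product_split:
  fixes n :: nat
  assumes k: "k \<in> gap_idx d" "nat \<bar>k\<bar> \<le> n"
  shows "(\<Prod>N\<le>n. sym_factor d u N z) = u k z * (\<Prod>N\<le>n. sym_factor d (u(k := \<lambda>_. 1)) N z)"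
proof -
  have fin: "finite {j \<in> gap_idx d. \<bar>j\<bar> = int N}" for N
    by (rule finite_subset[of _ "{-int N..int N}"]) auto
  have "sym_factor d u N z = (if nat \<bar>k\<bar> = N then u k z else 1) * sym_factor d (u(k := \<lambda>_. 1)) N z" for N
  proof -
    have "sym_factor d u N z = (\<Prod>j\<in>{j \<in> gap_idx d. \<bar>j\<bar> = int N}. (if j = k then u k z else 1) * (u(k := \<lambda>_. 1)) j z)"
      unfolding sym_factor_def by (intro prod.cong) auto
    also have "\<dots> = (if k \<in> {j \<in> gap_idx d. \<bar>j\<bar> = int N} then u k z else 1) * sym_factor d (u(k := \<lambda>_. 1)) N z"
      unfolding prod.distrib sym_factor_def by (subst prod.delta[OF fin]) simp
    finally show ?thesis using k by auto
  qed
  then have "(\<Prod>N\<le>n. sym_factor d u N z) =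
      (\<Prod>N\<le>n. if nat \<bar>k\<bar> = N then u k z else 1) * (\<Prod>N\<le>n. sym_factor d (u(k := \<lambda>_. 1)) N z)"
    by (simp add: prod.distrib)
  also have "(\<Prod>N\<le>n. if nat \<bar>k\<bar> = N then u k z else 1) = u k z"
    using k(2) by (subst prod.delta') auto
  finally show ?thesis .
qed

lemma sym_factor_nonzero: "(\<And>k. k \<in> gap_idx d \<Longrightarrow> u k z \<noteq> 0) \<Longrightarrow> sym_factor d u N z \<noteq> 0"
proof -
  assume u: "\<And>k. k \<in> gap_idx d \<Longrightarrow> u k z \<noteq> 0"
  have "finite {j \<in> gap_idx d. \<bar>j\<bar> = int N}"
    by (rule finite_subset[of _ "{-int N..int N}"]) auto
  then show ?thesis using u by (simp add: sym_factor_def)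
qed

section \<open>Convergence and zeros of f^+ and f^-\<close>

lemma f_factor_holomorphic: "f_factor d s k holomorphic_on A"
  by (cases "nu d k = s") (auto simp: f_factor_def[abs_def] pi_k_nonzero intro!: holomorphic_intros)

lemma f_factor_conv:
  assumes "s = 1 \<or> s = -1"
  shows "convergent_prod (\<lambda>N. sym_factor d (f_factor d s) N z)"
    "compact K \<Longrightarrow> uniform_limit K (\<lambda>n z. \<Prod>N\<le>n. sym_factor d (f_factor d s) N z) (f_prod d s) sequentially"
proof -
  have pc: "product_converges_on d (f_factor d s) UNIV"
    using conv assms unfolding products_converge_def by auto
  then show c: "convergent_prod (\<lambda>N. sym_factor d (f_factor d s) N z)" for z
    unfolding product_converges_on_def by blast
  assume "compact K"
  then have "uniformly_convergent_on K (\<lambda>n z. \<Prod>N\<le>n. sym_factor d (f_factor d s) N z)"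
    using pc unfolding product_converges_on_def by blast
  then have *: "uniform_limit K (\<lambda>n z. \<Prod>N\<le>n. sym_factor d (f_factor d s) N z)
      (\<lambda>z. lim (\<lambda>n. \<Prod>N\<le>n. sym_factor d (f_factor d s) N z)) sequentially"
    by (simp add: uniformly_convergent_uniform_limit_iff)
  have "(\<lambda>z. lim (\<lambda>n. \<Prod>N\<le>n. sym_factor d (f_factor d s) N z)) = f_prod d s"
    unfolding f_prod_def by (intro ext limI convergent_prod_LIMSEQ c)
  with * show "uniform_limit K (\<lambda>n z. \<Prod>N\<le>n. sym_factor d (f_factor d s) N z) (f_prod d s) sequentially"
    by simp
qed

text \<open>Locally uniform limits of partial products are entire, and a convergent product vanishes
  only where a factor does. For simplicity of a zero, the derivatives converge too: at gamma_k the
  derivative of a long partial product is -1/pi_k times the product of the other factors, whose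
  limit is nonzero.\<close>

lemma f_prod_simple_zeros:
  assumes s: "s = 1 \<or> s = -1"
  shows "entire_simple_zeros (f_prod d s) {gam d k | k. k \<in> gap_idx d \<and> nu d k = s}"
proof -
  define P where "P n z = (\<Prod>N\<le>n. sym_factor d (f_factor d s) N z)" for n z
  have symhol: "sym_factor d u N holomorphic_on A" if "\<And>k. u k holomorphic_on A" for u N A
    unfolding sym_factor_def by (intro holomorphic_intros that)
  have Phol: "P n holomorphic_on UNIV" for n
    unfolding P_def by (intro holomorphic_intros symhol f_factor_holomorphic)
  have ul: "\<exists>e>0. cball x e \<subseteq> UNIV \<and> uniform_limit (cball x e) P (f_prod d s) sequentially" for x
    unfolding P_def by (intro exI[of _ 1] conjI f_factor_conv(2)[OF s]) auto
  have hol: "f_prod d s holomorphic_on UNIV"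
    by (rule holomorphic_uniform_sequence[OF _ Phol ul]) auto
  have zero: "f_prod d s z = 0 \<longleftrightarrow> (\<exists>N. sym_factor d (f_factor d s) N z = 0)" for z
    using convergent_prod_to_zero_iff[OF f_factor_conv(1)[OF s], of z]
      convergent_prod_LIMSEQ[OF f_factor_conv(1)[OF s], of z] LIMSEQ_unique
    unfolding f_prod_def by metis
  have "(\<exists>N. sym_factor d (f_factor d s) N z = 0) \<longleftrightarrow> (\<exists>k\<in>gap_idx d. f_factor d s k z = 0)" for z
  proof
    assume "\<exists>N. sym_factor d (f_factor d s) N z = 0"
    then show "\<exists>k\<in>gap_idx d. f_factor d s k z = 0" using sym_factor_nonzero by blast
  next
    assume "\<exists>k\<in>gap_idx d. f_factor d s k z = 0"
    then obtain k where k: "k \<in> gap_idx d" "f_factor d s k z = 0" by blast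
    have "finite {j \<in> gap_idx d. \<bar>j\<bar> = int (nat \<bar>k\<bar>)}"
      by (rule finite_subset[of _ "{-\<bar>k\<bar>..\<bar>k\<bar>}"]) auto
    then have "sym_factor d (f_factor d s) (nat \<bar>k\<bar>) z = 0"
      unfolding sym_factor_def using k by (intro prod_zero) auto
    then show "\<exists>N. sym_factor d (f_factor d s) N z = 0" by blast
  qed
  with zero have zeros: "f_prod d s z = 0 \<longleftrightarrow> z \<in> of_real ` {gam d k | k. k \<in> gap_idx d \<and> nu d k = s}" for z
    by (auto simp: f_factor_def pi_k_nonzero split: if_splits)
  have "deriv (f_prod d s) (of_real (gam d k)) \<noteq> 0" if k: "k \<in> gap_idx d" "nu d k = s" for k
  proof -
    define g where "g = complex_of_real (gam d k)"
    define u' where "u' = (f_factor d s)(k := \<lambda>_. 1)"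
    define Q where "Q n z = (\<Prod>N\<le>n. sym_factor d u' N z)" for n z
    have PD: "\<And>n x. (P n has_field_derivative deriv (P n) x) (at x)"
      using Phol by (intro holomorphic_derivI) auto
    obtain f' where f': "\<And>x. (f_prod d s has_field_derivative f' x) (at x)" "\<And>x. (\<lambda>n. deriv (P n) x) \<longlonglongrightarrow> f' x"
      using has_complex_derivative_uniform_sequence[OF open_UNIV PD ul] by (metis UNIV_I)
    have u'hol: "u' j holomorphic_on A" for j A
      unfolding u'_def by (auto intro!: holomorphic_intros f_factor_holomorphic)
    have dP: "deriv (P n) g = - Q n g / pi_k k" if n: "n \<ge> nat \<bar>k\<bar>" for n
    proof -
      have "P n = (\<lambda>z. (g - z) / pi_k k * Q n z)"
        using partial_product_split[OF k(1) n, of "f_factor d s"] k(2)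
        by (auto simp: P_def Q_def u'_def f_factor_def g_def)
      moreover have "Q n holomorphic_on UNIV"
        unfolding Q_def by (intro holomorphic_intros symhol u'hol)
      then have "(Q n has_field_derivative deriv (Q n) g) (at g)" by (intro holomorphic_derivI) auto
      then have "((\<lambda>z. (g - z) / pi_k k * Q n z) has_field_derivative (- Q n g / pi_k k)) (at g)"
        by (auto intro!: derivative_eq_intros simp: pi_k_nonzero)
      ultimately show ?thesis by (simp add: DERIV_imp_deriv)
    qed
    have nz: "sym_factor d u' N g \<noteq> 0" for N
    proof (rule sym_factor_nonzero)
      fix j assume j: "j \<in> gap_idx d"
      have "gam d j \<noteq> gam d k" if "j \<noteq> k"
        using that gaps_ordered[OF j k(1)] gaps_ordered[OF k(1) j] gam_bounds[OF j] gam_bounds[OF k(1)]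
        by (cases j k rule: linorder_cases) auto
      then show "u' j g \<noteq> 0" unfolding u'_def f_factor_def g_def by (auto simp: pi_k_nonzero)
    qed
    \<comment> \<open>The full product vanishes at \<open>g\<close>, so convergence is transferred
      on the tail beyond |k|, where \<open>u'\<close> and \<open>f_factor d s\<close> give the same
      groups.\<close>
    have "convergent_prod (\<lambda>N. sym_factor d (f_factor d s) (N + Suc (nat \<bar>k\<bar>)) g)"
      using f_factor_conv(1)[OF s] by (rule convergent_prod_ignore_initial_segment)
    moreover have "sym_factor d (f_factor d s) (N + Suc (nat \<bar>k\<bar>)) g = sym_factor d u' (N + Suc (nat \<bar>k\<bar>)) g" for N
      unfolding sym_factor_def u'_def by (intro prod.cong) auto
    ultimately have "convergent_prod (\<lambda>N. sym_factor d u' (N + Suc (nat \<bar>k\<bar>)) g)" by simp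
    then have "convergent_prod (\<lambda>N. sym_factor d u' N g)" by (rule convergent_prod_offset)
    then have "(\<lambda>n. Q n g) \<longlonglongrightarrow> (\<Prod>N. sym_factor d u' N g)" "(\<Prod>N. sym_factor d u' N g) \<noteq> 0"
      unfolding Q_def using convergent_prod_LIMSEQ convergent_prod_to_zero_iff[of "\<lambda>N. sym_factor d u' N g"] nz by metis+
    then have "(\<lambda>n. - Q n g / pi_k k) \<longlonglongrightarrow> - (\<Prod>N. sym_factor d u' N g) / pi_k k"
      by (intro tendsto_intros) (auto simp: pi_k_nonzero)
    moreover have "\<forall>\<^sub>F n in sequentially. - Q n g / pi_k k = deriv (P n) g"
      using eventually_ge_at_top[of "nat \<bar>k\<bar>"] by eventually_elim (simp add: dP)
    ultimately have "(\<lambda>n. deriv (P n) g) \<longlonglongrightarrow> - (\<Prod>N. sym_factor d u' N g) / pi_k k"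
      by (rule Lim_transform_eventually)
    then have "f' g = - (\<Prod>N. sym_factor d u' N g) / pi_k k" using f'(2) LIMSEQ_unique by blast
    then have "f' g \<noteq> 0" using \<open>(\<Prod>N. sym_factor d u' N g) \<noteq> 0\<close> pi_k_nonzero by simp
    then show ?thesis using f'(1)[of g] by (simp add: DERIV_imp_deriv g_def)
  qed
  then show ?thesis unfolding entire_simple_zeros_def using hol zeros by auto
qed

lemma gam_inj: "inj_on (gam d) (gap_idx d)"
proof (rule inj_onI)
  fix j k assume j: "j \<in> gap_idx d" and k: "k \<in> gap_idx d" and eq: "gam d j = gam d k"
  show "j = k"
    using gaps_ordered[OF j k] gaps_ordered[OF k j] gam_bounds[OF j] gam_bounds[OF k] eq
    by (cases j k rule: linorder_cases) auto
qed

lemma f_prod_nonzero: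
  assumes "s = 1 \<or> s = -1" "\<And>k. k \<in> gap_idx d \<Longrightarrow> z \<noteq> of_real (gam d k)"
  shows "f_prod d s z \<noteq> 0"
  using f_prod_simple_zeros[OF assms(1)] assms(2) unfolding entire_simple_zeros_def by auto

text \<open>Squaring b^2 f^+ f^- removes all roots: s^4 = F^2 and h^4 = G off the real axis, where
  every cut lies. \<open>T\<close> collects all gamma_k, those with nu_k = 0 from F and the others
  from f^+ and f^-; its zeros are simple because the closed gaps are disjoint.\<close>

lemma b_square_product:
  assumes b: "is_b d gs b"
  obtains T G where "entire_simple_zeros T (gam d ` gap_idx d)" "entire_simple_zeros G (edge_set d)"
    "\<And>z. z \<notin> \<real> \<Longrightarrow> b z \<noteq> 0"
    "\<And>z. z \<notin> \<real> \<Longrightarrow> ((b z)\<^sup>2 * (f_prod d 1 z * f_prod d (-1) z))\<^sup>2 * G z = (T z)\<^sup>2"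
proof -
  let ?S1 = "closure (complex_of_real ` {x. odd (count_m d gs x)})"
  let ?S2 = "complex_of_real ` (\<Union>n. edge_interval d (4 * n - 4) (4 * n - 1))"
  obtain s h F G where F: "entire_simple_zeros F (zero_gams d)" and G: "entire_simple_zeros G (edge_set d)"
    and s: "\<And>z. z \<in> - ?S1 \<Longrightarrow> (s z)\<^sup>2 = F z" and h: "\<And>z. z \<in> - ?S2 \<Longrightarrow> h z ^ 4 = G z"
    and bz: "\<And>z. z \<notin> \<real> \<Longrightarrow> b z = s z / h z"
    using b unfolding is_b_def by blast
  define Z where "Z s = {gam d k | k. k \<in> gap_idx d \<and> nu d k = s}" for s
  define T where "T z = F z * (f_prod d 1 z * f_prod d (-1) z)" for z
  have dj: "Z i \<inter> Z j = {}" if "i \<noteq> j" for i j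
    using gam_inj that unfolding Z_def inj_on_def by blast
  have ff: "entire_simple_zeros (\<lambda>z. f_prod d 1 z * f_prod d (-1) z) (Z 1 \<union> Z (-1))"
    unfolding Z_def
    by (rule entire_simple_zeros_mult[OF f_prod_simple_zeros f_prod_simple_zeros dj[unfolded Z_def]]) auto
  have F0: "entire_simple_zeros F (Z 0)" using F by (simp add: Z_def zero_gams_def)
  have dj0: "Z 0 \<inter> (Z 1 \<union> Z (-1)) = {}" using dj[of 0 1] dj[of 0 "-1"] by (simp add: Int_Un_distrib)
  have "entire_simple_zeros T (Z 0 \<union> (Z 1 \<union> Z (-1)))"
    unfolding T_def[abs_def] by (rule entire_simple_zeros_mult[OF F0 ff dj0])
  moreover have "Z 0 \<union> (Z 1 \<union> Z (-1)) = gam d ` gap_idx d"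
    using nu_cases unfolding Z_def by blast
  ultimately have T: "entire_simple_zeros T (gam d ` gap_idx d)" by simp
  have nz: "F z \<noteq> 0" "G z \<noteq> 0" "(s z)\<^sup>2 = F z" "h z ^ 4 = G z" if z: "z \<notin> \<real>" for z
  proof -
    show "F z \<noteq> 0" "G z \<noteq> 0" using F G z unfolding entire_simple_zeros_def by auto
    have "?S1 \<subseteq> \<real>" by (rule closure_minimal) (auto intro: closed_complex_Reals)
    then show "(s z)\<^sup>2 = F z" using s z by auto
    have "?S2 \<subseteq> \<real>" by auto
    then have "z \<in> - ?S2" using z by blast
    then show "h z ^ 4 = G z" by (rule h)
  qed
  have "b z \<noteq> 0" if "z \<notin> \<real>" for z
    using nz[OF that] bz[OF that] by auto
  moreover have "((b z)\<^sup>2 * (f_prod d 1 z * f_prod d (-1) z))\<^sup>2 * G z = (T z)\<^sup>2" if z: "z \<notin> \<real>" for z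
  proof -
    have "((b z)\<^sup>2)\<^sup>2 = ((s z)\<^sup>2)\<^sup>2 / (h z ^ 4)" unfolding bz[OF z]
      by (simp add: power_divide flip: power_mult)
    then have "((b z)\<^sup>2)\<^sup>2 * G z = (F z)\<^sup>2" using nz[OF z] by simp
    moreover have "((b z)\<^sup>2 * (f_prod d 1 z * f_prod d (-1) z))\<^sup>2 * G z
        = ((b z)\<^sup>2)\<^sup>2 * G z * (f_prod d 1 z * f_prod d (-1) z)\<^sup>2"
      by (simp only: power_mult_distrib mult_ac)
    ultimately show ?thesis by (simp only: T_def power_mult_distrib)
  qed
  ultimately show ?thesis using that T G by blast
qed

text \<open>Substitute for Liouville's theorem: the limit is known only away from the discs, so the
  maximum principle is applied on an admissible circle around z and beyond the radius where |w| <
  e.\<close>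

lemma entire_zero_if_vanishing:
  assumes w: "w holomorphic_on UNIV" and lim: "(w \<longlongrightarrow> 0) (to_infinity_within (disc_complement d))"
  shows "w z = 0"
proof -
  have "norm (w z) \<le> e" if e: "e > 0" for e
  proof -
    have "\<forall>\<^sub>F u in to_infinity_within (disc_complement d). norm (w u) < e"
      using tendstoD[OF lim e] by (simp add: dist_norm)
    then obtain \<rho> where \<rho>: "\<And>u. u \<in> disc_complement d \<Longrightarrow> \<rho> \<le> norm u \<Longrightarrow> norm (w u) < e"
      unfolding eventually_to_infinity_within by blast
    obtain x r where xr: "r > 0" "cball 0 (max \<rho> (norm z)) \<subseteq> ball (complex_of_real x) r"
      "\<And>u. u \<in> sphere (complex_of_real x) r \<Longrightarrow> u \<notin> \<real> \<Longrightarrow> u \<in> disc_complement d"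
      using admissible_circle by metis
    have big: "\<rho> \<le> norm u" if "u \<in> sphere (complex_of_real x) r" for u
    proof (rule ccontr)
      assume "\<not> \<rho> \<le> norm u"
      then have "u \<in> cball 0 (max \<rho> (norm z))" by simp
      then have "u \<in> ball (complex_of_real x) r" using xr(2) by blast
      then show False using that by auto
    qed
    have cw: "continuous_on UNIV w" using w holomorphic_on_imp_continuous_on by blast
    have bd: "norm (w u) \<le> e" if u: "u \<in> sphere (complex_of_real x) r" for u
      using sphere_bound_from_nonreal[OF xr(1) cw, of "\<lambda>_. 1" x e u] \<rho> big xr(3) u by (simp add: less_imp_le)
    show ?thesis
    proof (rule maximum_modulus_frontier[of w "ball (complex_of_real x) r"])
      show "w holomorphic_on interior (ball (complex_of_real x) r)" using w holomorphic_on_subset by blast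
      show "continuous_on (closure (ball (complex_of_real x) r)) w" using cw continuous_on_subset by blast
      have "z \<in> cball 0 (max \<rho> (norm z))" by simp
      then show "z \<in> ball (complex_of_real x) r" using xr(2) by blast
    qed (use bd xr(1) in auto)
  qed
  then have "norm (w z) \<le> 0" by (rule field_le_epsilon[of _ 0, simplified])
  then show ?thesis by simp
qed

end

section \<open>Zeros of the determinant\<close>

context candidate_data
begin

lemma zero_free:
  assumes \<delta>: "\<delta> holomorphic_on UNIV"
    and T: "entire_simple_zeros T (gam d ` gap_idx d)" and G: "entire_simple_zeros G (edge_set d)"
    and lim: "((\<lambda>z. (\<delta> z)\<^sup>2 * G z / (T z)\<^sup>2) \<longlongrightarrow> c) (to_infinity_within (disc_complement d))"
    and c: "c \<noteq> 0"
  shows "\<delta> z0 \<noteq> 0"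
proof
  assume z0: "\<delta> z0 = 0"
  have Th: "T holomorphic_on UNIV" and T0: "\<And>z. T z = 0 \<longleftrightarrow> z \<in> of_real ` gam d ` gap_idx d"
    and Gh: "G holomorphic_on UNIV" and G0: "\<And>z. G z = 0 \<longleftrightarrow> z \<in> of_real ` edge_set d"
    using T G unfolding entire_simple_zeros_def by auto
  define X where "X z = (\<delta> z)\<^sup>2 * G z" for z
  define Y where "Y z = c * (T z)\<^sup>2" for z
  have Xh: "X holomorphic_on A" and Yh: "Y holomorphic_on A" for A
    unfolding X_def[abs_def] Y_def[abs_def] using holomorphic_on_subset[of _ UNIV A] \<delta> Th Gh
    by (auto intro!: holomorphic_intros)
  have "\<forall>\<^sub>F z in to_infinity_within (disc_complement d). norm ((\<delta> z)\<^sup>2 * G z / (T z)\<^sup>2 - c) < norm c / 2"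
    using tendstoD[OF lim, of "norm c / 2"] c by (simp add: dist_norm)
  then obtain \<rho> where \<rho>: "\<And>z. z \<in> disc_complement d \<Longrightarrow> \<rho> \<le> norm z \<Longrightarrow>
      norm ((\<delta> z)\<^sup>2 * G z / (T z)\<^sup>2 - c) < norm c / 2"
    unfolding eventually_to_infinity_within by blast
  obtain x r where r: "r > 0" and sub: "cball 0 (max \<rho> (norm z0)) \<subseteq> ball (complex_of_real x) r"
    and alt: "\<And>k. k \<in> gap_idx d \<Longrightarrow> \<bar>ctr k - x\<bar> \<le> r - R \<or> r + R \<le> \<bar>ctr k - x\<bar>"
    and sph: "\<And>z. z \<in> sphere (complex_of_real x) r \<Longrightarrow> z \<notin> \<real> \<Longrightarrow> z \<in> disc_complement d"
    using admissible_circle by metis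
  define K where "K = {k \<in> gap_idx d. \<bar>ctr k - x\<bar> \<le> r - R}"
  have finK: "finite K" unfolding K_def by (rule finite_subset[OF _ finite_ctr[of "\<bar>x\<bar> + r"]]) (use R_pos in auto)
  \<comment> \<open>The circle cannot cut a closed gap: along the axis it stays at distance at least
    R from each gap centre, while the gap lies strictly within R. So gamma_k and both edges of gap k
    are inside together or outside together.\<close>
  have inside: "\<bar>y - x\<bar> < r \<longleftrightarrow> k \<in> K" "\<bar>y - x\<bar> \<noteq> r"
    if "k \<in> gap_idx d" "E (2 * k - 1) \<le> y" "y \<le> E (2 * k)" for k y
    using in_gap_ctr[OF that] alt[OF that(1)] that(1) unfolding K_def by auto
  let ?S = "sphere (complex_of_real x) r"
  have dist_real: "dist (complex_of_real x) (of_real y) = \<bar>y - x\<bar>" for y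
    by (simp add: dist_of_real dist_real_def abs_minus_commute)
  have in_ball: "complex_of_real y \<in> ball (of_real x) r \<longleftrightarrow> \<bar>y - x\<bar> < r" for y
    by (simp only: mem_ball dist_real)
  have T_sph: "T z \<noteq> 0" if "z \<in> ?S" for z
  proof
    assume "T z = 0"
    then obtain k where k: "k \<in> gap_idx d" "z = of_real (gam d k)" using T0 by auto
    then show False using inside(2)[OF k(1) gam_bounds(1)[OF k(1)] gam_bounds(2)[OF k(1)]] that
        dist_real[of "gam d k"] by (simp only: k(2) mem_sphere)
  qed
  \<comment> \<open>The estimate of the quotient within |c|/2 of its limit is multiplied by T^2.
    Between entire functions it then extends to the two real points of the circle, and the factor
    1/2 leaves the strict inequality that Rouche's theorem requires.\<close>
  have XY: "norm (X z - Y z) \<le> 1/2 * norm (Y z)" if z: "z \<in> ?S" for z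
  proof (rule sphere_bound_from_nonreal[OF r _ _ _ z])
    show "continuous_on UNIV (\<lambda>z. X z - Y z)" "continuous_on UNIV Y"
      by (intro holomorphic_on_imp_continuous_on holomorphic_intros Xh Yh)+
    fix w assume w: "w \<in> ?S" "w \<notin> \<real>"
    have "\<rho> \<le> norm w"
    proof (rule ccontr)
      assume "\<not> \<rho> \<le> norm w"
      then have "w \<in> cball 0 (max \<rho> (norm z0))" by simp
      then have "w \<in> ball (complex_of_real x) r" using sub by blast
      then show False using w by simp
    qed
    from \<rho>[OF sph[OF w] this] have "norm (X w / (T w)\<^sup>2 - c) * norm ((T w)\<^sup>2) \<le> norm c / 2 * norm ((T w)\<^sup>2)"
      unfolding X_def by (intro mult_right_mono) auto
    moreover have "X w - Y w = (X w / (T w)\<^sup>2 - c) * (T w)\<^sup>2"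
      using T_sph[OF w(1)] by (simp add: Y_def field_simps)
    ultimately show "norm (X w - Y w) \<le> 1/2 * norm (Y w)"
      by (simp add: Y_def norm_mult)
  qed
  have Y_sph: "Y z \<noteq> 0" if "z \<in> ?S" for z using T_sph[OF that] c by (simp add: Y_def)
  have X_sph: "X z \<noteq> 0" if "z \<in> ?S" for z using XY[OF that] Y_sph[OF that] by auto
  have "complex_of_real (x + r) \<in> ?S" unfolding mem_sphere dist_real using r by simp
  then obtain z1 where z1: "z1 \<in> ?S" by blast
  \<comment> \<open>An open set around the circle for Rouche's theorem. Zeros in the additional
    annulus have winding number 0 and drop out of the count.\<close>
  let ?D = "ball (complex_of_real x) (r + 1)"
  have X_nonconst: "X z0 = 0" "X z1 \<noteq> 0" using z0 z1 X_sph by (auto simp: X_def)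
  have "\<not> X constant_on UNIV" using X_nonconst unfolding constant_on_def by (metis UNIV_I)
  then have "finite {z \<in> cball (complex_of_real x) (r+1). X z = 0}"
    by (intro holomorphic_compact_finite_zeros[OF Xh[of UNIV]]) auto
  then have finX: "finite {z \<in> ?D. X z = 0}" by (rule rev_finite_subset) auto
  have finY: "finite {z \<in> ?D. Y z = 0}"
  proof (rule finite_subset)
    show "finite (complex_of_real ` gam d ` {k \<in> gap_idx d. \<bar>ctr k\<bar> \<le> \<bar>x\<bar> + r + 1 + R})"
      using finite_ctr by blast
    show "{z \<in> ?D. Y z = 0} \<subseteq> complex_of_real ` gam d ` {k \<in> gap_idx d. \<bar>ctr k\<bar> \<le> \<bar>x\<bar> + r + 1 + R}"
    proof
      fix z assume z: "z \<in> {z \<in> ?D. Y z = 0}"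
      then obtain k where k: "k \<in> gap_idx d" "z = of_real (gam d k)" using T0 c by (auto simp: Y_def)
      have "\<bar>gam d k - x\<bar> < r + 1" using z k dist_real[of "gam d k"] by simp
      moreover have "\<bar>gam d k - ctr k\<bar> < R" using gam_bounds k by (intro in_gap_ctr) auto
      ultimately show "z \<in> complex_of_real ` gam d ` {k \<in> gap_idx d. \<bar>ctr k\<bar> \<le> \<bar>x\<bar> + r + 1 + R}"
        using k by auto
    qed
  qed
  let ?\<gamma> = "circlepath (complex_of_real x) r"
  have pi: "path_image ?\<gamma> = ?S" using r by (simp add: path_image_circlepath)
  have w1: "winding_number ?\<gamma> p = 1" if "p \<in> ball (complex_of_real x) r" for p
    using that by (intro winding_number_circlepath) (auto simp: dist_norm norm_minus_commute)
  have w0: "winding_number ?\<gamma> p = 0" if "p \<notin> cball (complex_of_real x) r" for p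
    by (rule winding_number_zero_outside[of _ "cball (complex_of_real x) r"]) (use that pi in auto)
  have "(\<Sum>p\<in>{p\<in>?D. Y p + (X p - Y p) = 0}. winding_number ?\<gamma> p * zorder (\<lambda>p. Y p + (X p - Y p)) p)
      = (\<Sum>p\<in>{p\<in>?D. Y p = 0}. winding_number ?\<gamma> p * zorder Y p)"
  proof (rule Rouche_theorem)
    show "finite {p \<in> ?D. Y p + (X p - Y p) = 0}" using finX by simp
    show "\<forall>z\<in>path_image ?\<gamma>. norm (X z - Y z) < norm (Y z)"
      unfolding pi
    proof
      fix z assume z: "z \<in> ?S"
      have "norm (Y z) > 0" using Y_sph[OF z] by simp
      then show "norm (X z - Y z) < norm (Y z)" using XY[OF z] by linarith
    qed
    show "\<forall>z. z \<notin> ?D \<longrightarrow> winding_number ?\<gamma> z = 0"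
      by (intro allI impI w0) auto
    show "(\<lambda>z. X z - Y z) holomorphic_on ?D" by (intro holomorphic_intros Xh Yh)
  qed (use finY Yh pi r in auto)
  then have rouche: "(\<Sum>p\<in>{p\<in>?D. X p = 0}. winding_number ?\<gamma> p * zorder X p)
      = (\<Sum>p\<in>{p\<in>?D. Y p = 0}. winding_number ?\<gamma> p * zorder Y p)"
    by (simp add: fun_eq_iff)
  let ?B = "ball (complex_of_real x) r"
  have count: "(\<Sum>p\<in>{p\<in>?D. F p = 0}. winding_number ?\<gamma> p * zorder F p) = of_int (\<Sum>p\<in>{p\<in>?B. F p = 0}. zorder F p)"
    if "finite {p\<in>?D. F p = 0}" "\<And>z. z \<in> ?S \<Longrightarrow> F z \<noteq> 0" for F :: "complex \<Rightarrow> complex"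
  proof -
    have "(\<Sum>p\<in>{p\<in>?B. F p = 0}. winding_number ?\<gamma> p * zorder F p) = (\<Sum>p\<in>{p\<in>?D. F p = 0}. winding_number ?\<gamma> p * zorder F p)"
    proof (rule sum.mono_neutral_left[OF that(1)])
      show "{p\<in>?B. F p = 0} \<subseteq> {p\<in>?D. F p = 0}" by auto
      show "\<forall>p\<in>{p\<in>?D. F p = 0} - {p\<in>?B. F p = 0}. winding_number ?\<gamma> p * zorder F p = 0"
      proof
        fix p assume p: "p \<in> {p\<in>?D. F p = 0} - {p\<in>?B. F p = 0}"
        then have "p \<notin> ?B" "p \<notin> ?S" using that(2) by auto
        then have "p \<notin> cball (complex_of_real x) r" by auto
        then show "winding_number ?\<gamma> p * zorder F p = 0" using w0 by simp
      qed
    qed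
    moreover have "(\<Sum>p\<in>{p\<in>?B. F p = 0}. winding_number ?\<gamma> p * zorder F p) = (\<Sum>p\<in>{p\<in>?B. F p = 0}. of_int (zorder F p))"
      using w1 by (intro sum.cong) auto
    ultimately show ?thesis by simp
  qed
  have eq: "(\<Sum>p\<in>{p\<in>?B. X p = 0}. zorder X p) = (\<Sum>p\<in>{p\<in>?B. Y p = 0}. zorder Y p)"
  proof -
    have "complex_of_int (\<Sum>p\<in>{p\<in>?B. X p = 0}. zorder X p) = of_int (\<Sum>p\<in>{p\<in>?B. Y p = 0}. zorder Y p)"
      by (rule trans[OF trans[OF count[OF finX X_sph, symmetric] rouche] count[OF finY Y_sph]])
    then show ?thesis by (simp only: of_int_eq_iff)
  qed
  have mero: "f meromorphic_on {p}" if "f holomorphic_on UNIV" for f p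
    using that by (metis analytic_on_imp_meromorphic_on analytic_on_open analytic_on_subset open_UNIV subset_UNIV)
  have nz: "\<delta> z1 \<noteq> 0" "G z1 \<noteq> 0" "T z1 \<noteq> 0" using X_sph[OF z1] T_sph[OF z1] by (auto simp: X_def)
  have ev: "\<exists>\<^sub>F z in at p. f z \<noteq> 0" if "f holomorphic_on UNIV" "f w \<noteq> 0" for f w p
    by (rule eventually_frequently[OF at_neq_bot eventually_nonzero_at[OF that]])
  have zY: "zorder Y p = 2 * zorder T p" for p
  proof -
    have "zorder Y p = zorder (\<lambda>z. (T z)\<^sup>2) p" unfolding Y_def[abs_def] by (rule zorder_cmult[OF c])
    also have "\<dots> = int 2 * zorder T p" by (rule zorder_power[OF mero[OF Th] ev[OF Th nz(3)]])
    finally show ?thesis by simp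
  qed
  have zX: "zorder X p = 2 * zorder \<delta> p + zorder G p" for p
  proof -
    have \<delta>2: "(\<lambda>z. (\<delta> z)\<^sup>2) holomorphic_on UNIV" "(\<delta> z1)\<^sup>2 \<noteq> 0" using \<delta> nz by (auto intro!: holomorphic_intros)
    have "zorder X p = zorder (\<lambda>z. (\<delta> z)\<^sup>2) p + zorder G p"
      unfolding X_def[abs_def] using \<delta>2
      by (intro zorder_mult mero ev[where w = z1] Gh) (use nz in auto)
    also have "zorder (\<lambda>z. (\<delta> z)\<^sup>2) p = int 2 * zorder \<delta> p" by (rule zorder_power[OF mero[OF \<delta>] ev[OF \<delta> nz(1)]])
    finally show ?thesis by simp
  qed
  have YB: "{p\<in>?B. Y p = 0} = of_real ` gam d ` K" (is "?L = ?M")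
  proof (intro equalityI subsetI)
    fix p assume "p \<in> ?L"
    then obtain k where k: "k \<in> gap_idx d" "p = of_real (gam d k)" "p \<in> ?B" using T0 c by (auto simp: Y_def)
    then have "\<bar>gam d k - x\<bar> < r" using in_ball by metis
    then have "k \<in> K" using inside(1)[OF k(1) gam_bounds(1)[OF k(1)] gam_bounds(2)[OF k(1)]] by blast
    then show "p \<in> ?M" using k(2) by blast
  next
    fix p assume "p \<in> ?M"
    then obtain k where k: "k \<in> K" "p = of_real (gam d k)" by auto
    then have kg: "k \<in> gap_idx d" unfolding K_def by auto
    have "p \<in> ?B"
      unfolding k(2) in_ball using inside(1)[OF kg gam_bounds(1)[OF kg] gam_bounds(2)[OF kg]] k(1) by blast
    moreover have "Y p = 0" using T0[of p] kg k(2) by (simp add: Y_def)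
    ultimately show "p \<in> ?L" by blast
  qed
  have "(\<Sum>p\<in>{p\<in>?B. Y p = 0}. zorder Y p) = (\<Sum>p\<in>{p\<in>?B. Y p = 0}. 2)"
    using c by (intro sum.cong) (auto simp: zY zorder_simple_zero[OF T] Y_def)
  also have "\<dots> = 2 * int (card {p\<in>?B. Y p = 0})" by simp
  also have "card {p\<in>?B. Y p = 0} = card K" unfolding YB image_image
    by (rule card_image) (use gam_inj in \<open>auto simp: inj_on_def K_def\<close>)
  finally have sumY: "(\<Sum>p\<in>{p\<in>?B. Y p = 0}. zorder Y p) = 2 * int (card K)" .
  define J where "J = (\<lambda>k. 2 * k) ` K \<union> (\<lambda>k. 2 * k - 1) ` K"
  define A where "A = complex_of_real ` E ` J"
  have J: "J \<subseteq> edge_idx d" unfolding J_def K_def using edge_idxI by auto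
  have "card J = card K + card K"
    unfolding J_def
  proof (subst card_Un_disjoint)
    show "(\<lambda>k. 2 * k) ` K \<inter> (\<lambda>k. 2 * k - 1) ` K = {}" by (auto, presburger)
    show "card ((\<lambda>k. 2 * k) ` K) + card ((\<lambda>k. 2 * k - 1) ` K) = card K + card K"
      by (simp add: card_image inj_on_def)
  qed (use finK in auto)
  moreover have "inj_on E J"
  proof (rule inj_onI)
    fix i j assume "i \<in> J" "j \<in> J" "E i = E j"
    then show "i = j" using J edge_less[of i j] edge_less[of j i] by (cases i j rule: linorder_cases) auto
  qed
  ultimately have cardA: "card A = card K + card K"
    unfolding A_def image_image by (subst card_image) (auto simp: inj_on_def)
  have AX: "A \<subseteq> {p\<in>?B. X p = 0}" and AG: "\<And>p. p \<in> A \<Longrightarrow> G p = 0"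
  proof -
    show *: "G p = 0" if "p \<in> A" for p
      using that J G0[of p] unfolding A_def edge_set_def by blast
    have "p \<in> ?B" if p: "p \<in> A" for p
    proof -
      obtain k where k: "k \<in> K" "p = of_real (E (2 * k)) \<or> p = of_real (E (2 * k - 1))"
        using p unfolding A_def J_def by blast
      then have kg: "k \<in> gap_idx d" unfolding K_def by auto
      have "\<bar>E (2 * k) - x\<bar> < r" "\<bar>E (2 * k - 1) - x\<bar> < r"
        using inside(1)[OF kg, of "E (2 * k)"] inside(1)[OF kg, of "E (2 * k - 1)"] gap_less[OF kg] k(1)
        by auto
      with k(2) show ?thesis using in_ball by metis
    qed
    with * show "A \<subseteq> {p\<in>?B. X p = 0}" by (auto simp: X_def)
  qed
  have finB: "finite {p\<in>?B. X p = 0}" by (rule finite_subset[OF _ finX]) auto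
  have z0B: "z0 \<in> {p\<in>?B. X p = 0}" 
  proof -
    have "z0 \<in> cball 0 (max \<rho> (norm z0))" by simp
    then show ?thesis using sub X_nonconst by blast
  qed
  have \<delta>pos: "zorder \<delta> p \<ge> 0" "\<delta> p = 0 \<Longrightarrow> zorder \<delta> p \<ge> 1" for p using zorder_entire_nonneg[OF \<delta> nz(1)] by auto
  \<comment> \<open>The edges of the gaps in \<open>K\<close> alone account for the total 2 card K
    that Y allows. A zero of \<open>\<delta>\<close> at z0 would add at least 2, because
    \<open>\<delta>\<close> enters X squared.\<close>
  have "(\<Sum>p\<in>{p\<in>?B. X p = 0}. zorder X p) = 2 * (\<Sum>p\<in>{p\<in>?B. X p = 0}. zorder \<delta> p) + (\<Sum>p\<in>{p\<in>?B. X p = 0}. zorder G p)"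
    by (simp add: zX sum.distrib sum_distrib_left)
  moreover have "(\<Sum>p\<in>{p\<in>?B. X p = 0}. zorder \<delta> p) \<ge> zorder \<delta> z0"
    by (rule member_le_sum[OF z0B _ finB]) (use \<delta>pos in auto)
  moreover have "(\<Sum>p\<in>{p\<in>?B. X p = 0}. zorder G p) \<ge> (\<Sum>p\<in>A. zorder G p)"
    by (rule sum_mono2[OF finB AX]) (simp add: zorder_simple_zero[OF G])
  moreover have "(\<Sum>p\<in>A. zorder G p) = int (card A)"
    using AG by (simp add: zorder_simple_zero[OF G])
  ultimately show False using eq sumY \<delta>pos(2)[OF z0] cardA by linarith
qed

end

section \<open>Uniqueness for the Riemann--Hilbert problem\<close>

text \<open>The determinant of the matrix with rows \<open>u\<close> and \<open>v\<close>. For the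
  rows of two solutions these numbers are, up to sign and order, the entries of Phi adj(Psi), which
  can be used before Psi is known to be invertible.\<close>

definition pairing :: "complex^2 \<Rightarrow> complex^2 \<Rightarrow> complex" where
  "pairing u v = u $ 1 * v $ 2 - u $ 2 * v $ 1"

lemma mat_mult_entry: "(M ** N) $ i $ j = M $ i $ 1 * N $ 1 $ j + M $ i $ 2 * (N $ 2 $ j)"
  for M N :: "complex^2^2"
  by (simp add: matrix_matrix_mult_def sum_2)

text \<open>Multiplicativity of the determinant, for the matrix whose rows are row i of M and row j
  of N.\<close>

lemma pairing_mult: "pairing ((M ** V) $ i) ((N ** V) $ j) = det V * pairing (M $ i) (N $ j)"
  for M N V :: "complex^2^2"
  by (simp add: pairing_def mat_mult_entry det_2 algebra_simps)

lemma pairing_rows: "pairing (M $ 1) (M $ 2) = det M"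
  by (simp add: pairing_def det_2)

lemma pairing_diff_left: "pairing u w - pairing v w = pairing (u - v) w"
  by (simp add: pairing_def algebra_simps)

text \<open>Cramer's rule recovers \<open>u\<close> from its pairings with the rows of M.\<close>

lemma pairing_nondegenerate:
  fixes M :: "complex^2^2"
  assumes "det M \<noteq> 0" "\<And>j. pairing u (M $ j) = 0"
  shows "u = 0"
proof -
  have "u $ 1 * det M = M $ 1 $ 1 * pairing u (M $ 2) - M $ 2 $ 1 * pairing u (M $ 1)"
    "u $ 2 * det M = M $ 1 $ 2 * pairing u (M $ 2) - M $ 2 $ 2 * pairing u (M $ 1)"
    by (simp_all add: pairing_def det_2 algebra_simps)
  then show ?thesis using assms by (simp add: vec_eq_iff forall_2)
qed

lemma tendsto_pairing:
  assumes "(u \<longlongrightarrow> a) F" "(v \<longlongrightarrow> c) F"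
  shows "((\<lambda>z. pairing (u z) (v z)) \<longlongrightarrow> pairing a c) F"
  unfolding pairing_def by (intro tendsto_intros assms)

lemma tendsto_mat_mult:
  fixes M N :: "'a \<Rightarrow> complex^2^2"
  assumes "(M \<longlongrightarrow> a) F" "(N \<longlongrightarrow> c) F"
  shows "((\<lambda>z. M z ** N z) \<longlongrightarrow> a ** c) F"
  by (intro vec_tendstoI) (simp add: mat_mult_entry, intro tendsto_intros assms)

lemma tendsto_det:
  fixes M :: "'a \<Rightarrow> complex^2^2"
  assumes "(M \<longlongrightarrow> a) F"
  shows "((\<lambda>z. det (M z)) \<longlongrightarrow> det a) F"
  unfolding det_2 by (intro tendsto_intros assms)

lemma bigo_inverse_tendsto_0:
  assumes "f \<in> O[to_infinity_within S](\<lambda>z. 1 / z)"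
  shows "(f \<longlongrightarrow> 0) (to_infinity_within S)"
proof -
  obtain c where c: "\<forall>\<^sub>F z in to_infinity_within S. norm (f z) \<le> c * norm (1 / z)"
    using assms landau_o.bigE by blast
  have le: "to_infinity_within S \<le> at_infinity" by (simp add: to_infinity_within_def)
  have "((\<lambda>z::complex. 1 / z) \<longlongrightarrow> 0) at_infinity"
    by (rule Lim_transform_eventually[OF tendsto_inverse_0]) (simp add: divide_inverse)
  then have "((\<lambda>z::complex. c * norm (1 / z)) \<longlongrightarrow> c * norm (0::complex)) at_infinity"
    by (intro tendsto_intros)
  then have "((\<lambda>z::complex. c * norm (1 / z)) \<longlongrightarrow> 0) (to_infinity_within S)"
    using tendsto_mono[OF le] by simp
  then show ?thesis by (rule Lim_null_comparison[OF c])
qed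

lemma det_diag2 [simp]: "det (diag2 a c) = a * c"
  by (simp add: det_2 diag2_def)

lemma det_mat2 [simp]: "det (mat a :: complex^2^2) = a\<^sup>2"
  by (simp add: det_2 mat_def power2_eq_square)

lemma det_U: "det U_mat = \<i>"
proof -
  have "(complex_of_real (sqrt 2))\<^sup>2 = 2" by (simp flip: of_real_power)
  then show ?thesis by (simp add: U_mat_def det_mul det_2[of "vector _"] power_divide)
qed

context candidate_data
begin

text \<open>Conditions that contain neither x nor t, so that they can be stated alike for Phi(x, t +
  L2) S and for Phi(x, t).\<close>

definition rhp_regular :: "(complex \<Rightarrow> complex) \<Rightarrow> (complex \<Rightarrow> complex^2^2) \<Rightarrow> bool" where
  "rhp_regular b \<Phi> \<longleftrightarrow>
     (\<forall>i j. (\<lambda>z. \<Phi> z $ i $ j) holomorphic_on - \<real>) \<and>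
     (\<forall>e\<in>edge_set d. \<forall>i j.
        (\<lambda>z. norm (\<Phi> z $ i $ j))
          \<in> O[at (of_real e) within - \<real>](\<lambda>z. norm (z - of_real e) powr (- 1 / 4))) \<and>
     (\<exists>A. (\<forall>i j. (\<lambda>z. A z $ i $ j) \<in> O[to_infinity_within (disc_complement d)](\<lambda>z. 1 / z)) \<and>
        (\<forall>\<^sub>F z in to_infinity_within (disc_complement d).
            \<Phi> z = U_mat ** (mat 1 + A z) ** B_mat d b z))"

text \<open>The jump matrix is left existential because uniqueness uses only that it is common to
  both functions and has determinant 1.\<close>

definition same_jump :: "(complex \<Rightarrow> complex^2^2) \<Rightarrow> (complex \<Rightarrow> complex^2^2) \<Rightarrow> real \<Rightarrow> bool" where
  "same_jump \<Phi> \<Psi> y \<longleftrightarrow>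
     (\<exists>V \<Phi>p \<Phi>m \<Psi>p \<Psi>m. det V = 1 \<and> \<Phi>p = \<Phi>m ** V \<and> \<Psi>p = \<Psi>m ** V \<and>
        (\<Phi> \<longlongrightarrow> \<Phi>p) (at (of_real y) within {z. Im z > 0}) \<and> (\<Phi> \<longlongrightarrow> \<Phi>m) (at (of_real y) within {z. Im z < 0}) \<and>
        (\<Psi> \<longlongrightarrow> \<Psi>p) (at (of_real y) within {z. Im z > 0}) \<and> (\<Psi> \<longlongrightarrow> \<Psi>m) (at (of_real y) within {z. Im z < 0}))"

text \<open>Jump matrices of determinant one preserve the pairing of rows, and two quartic root
  singularities multiply to a removable one.\<close>

lemma pairing_entire:
  assumes \<Phi>: "rhp_regular b \<Phi>" and \<Psi>: "rhp_regular b \<Psi>"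
    and jump: "\<And>y. y \<notin> edge_set d \<Longrightarrow> same_jump \<Phi> \<Psi> y"
  obtains X where "X holomorphic_on UNIV" "\<And>z. z \<notin> \<real> \<Longrightarrow> X z = pairing (\<Phi> z $ i) (\<Psi> z $ j)"
proof (rule entire_extension[of "edge_set d" "\<lambda>z. pairing (\<Phi> z $ i) (\<Psi> z $ j)"])
  show "(\<lambda>z. pairing (\<Phi> z $ i) (\<Psi> z $ j)) holomorphic_on - \<real>"
    unfolding pairing_def using \<Phi> \<Psi> unfolding rhp_regular_def by (auto intro!: holomorphic_intros)
  fix y assume "y \<notin> edge_set d"
  then obtain V \<Phi>p \<Phi>m \<Psi>p \<Psi>m where V: "det V = 1" "\<Phi>p = \<Phi>m ** V" "\<Psi>p = \<Psi>m ** V"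
    and lim: "(\<Phi> \<longlongrightarrow> \<Phi>p) (at (of_real y) within {z. Im z > 0})" "(\<Phi> \<longlongrightarrow> \<Phi>m) (at (of_real y) within {z. Im z < 0})"
        "(\<Psi> \<longlongrightarrow> \<Psi>p) (at (of_real y) within {z. Im z > 0})" "(\<Psi> \<longlongrightarrow> \<Psi>m) (at (of_real y) within {z. Im z < 0})"
    using jump unfolding same_jump_def by blast
  have "pairing (\<Phi>p $ i) (\<Psi>p $ j) = pairing (\<Phi>m $ i) (\<Psi>m $ j)"
    by (simp add: V pairing_mult)
  moreover have "((\<lambda>z. pairing (\<Phi> z $ i) (\<Psi> z $ j)) \<longlongrightarrow> pairing (\<Phi>p $ i) (\<Psi>p $ j)) (at (of_real y) within {z. Im z > 0})"
    by (intro tendsto_pairing tendsto_vec_nth lim)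
  moreover have "((\<lambda>z. pairing (\<Phi> z $ i) (\<Psi> z $ j)) \<longlongrightarrow> pairing (\<Phi>m $ i) (\<Psi>m $ j)) (at (of_real y) within {z. Im z < 0})"
    by (intro tendsto_pairing tendsto_vec_nth lim)
  ultimately show "\<exists>l. ((\<lambda>z. pairing (\<Phi> z $ i) (\<Psi> z $ j)) \<longlongrightarrow> l) (at (of_real y) within - \<real>)"
    unfolding tendsto_nonreal_iff by auto
next
  fix e assume e: "e \<in> edge_set d"
  let ?F = "at (complex_of_real e) within - \<real>"
  let ?p = "\<lambda>z. norm (z - complex_of_real e) powr (- 1 / 4)"
  have sq: "?p z * ?p z = norm (z - complex_of_real e) powr (- 1 / 2)" for z
    by (simp flip: powr_add)
  have prod: "(\<lambda>z. norm (\<Phi> z $ i $ k) * norm (\<Psi> z $ j $ l)) \<in> O[?F](\<lambda>z. norm (z - complex_of_real e) powr (- 1 / 2))" for k l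
    unfolding sq[symmetric] using \<Phi> \<Psi> e unfolding rhp_regular_def by (intro landau_o.big.mult) auto
  have "(\<lambda>z. norm (\<Phi> z $ i $ 1) * norm (\<Psi> z $ j $ 2) + norm (\<Phi> z $ i $ 2) * norm (\<Psi> z $ j $ 1))
      \<in> O[?F](\<lambda>z. norm (z - complex_of_real e) powr (- 1 / 2))"
    by (intro sum_in_bigo prod)
  moreover have "(\<lambda>z. norm (pairing (\<Phi> z $ i) (\<Psi> z $ j))) \<in> O[?F](\<lambda>z. norm (\<Phi> z $ i $ 1) * norm (\<Psi> z $ j $ 2) + norm (\<Phi> z $ i $ 2) * norm (\<Psi> z $ j $ 1))"
  proof (rule landau_o.bigI[of 1])
    have "norm (norm (pairing (\<Phi> z $ i) (\<Psi> z $ j))) \<le> 1 * norm (norm (\<Phi> z $ i $ 1) * norm (\<Psi> z $ j $ 2) + norm (\<Phi> z $ i $ 2) * norm (\<Psi> z $ j $ 1))" for z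
      using norm_triangle_ineq4[of "\<Phi> z $ i $ 1 * \<Psi> z $ j $ 2" "\<Phi> z $ i $ 2 * \<Psi> z $ j $ 1"]
      by (simp add: pairing_def norm_mult)
    then show "\<forall>\<^sub>F z in ?F. norm (norm (pairing (\<Phi> z $ i) (\<Psi> z $ j))) \<le> 1 * norm (norm (\<Phi> z $ i $ 1) * norm (\<Psi> z $ j $ 2) + norm (\<Phi> z $ i $ 2) * norm (\<Psi> z $ j $ 1))"
      by simp
  qed simp
  ultimately show "(\<lambda>z. norm (pairing (\<Phi> z $ i) (\<Psi> z $ j))) \<in> O[?F](\<lambda>z. norm (z - of_real e) powr (- 1 / 2))"
    using landau_o.big_trans by blast
qed (use that finite_edges in auto)

text \<open>The square makes both half planes agree: the factor \<open>\<i>\<close> above the axis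
  contributes -1 to det B.\<close>

lemma det_B_square: "(det (B_mat d b z))\<^sup>2 = ((b z)\<^sup>2 * (f_prod d 1 z * f_prod d (-1) z))\<^sup>2"
  by (auto simp: B_mat_def det_mul power_mult_distrib)

lemma disc_complement_nonreal: "z \<in> disc_complement d \<Longrightarrow> z \<notin> \<real>"
  by (simp add: disc_complement_def)

lemma eventually_disc_complement: "\<forall>\<^sub>F z in to_infinity_within (disc_complement d). z \<in> disc_complement d"
  unfolding eventually_to_infinity_within by auto

lemma f_prod_nonreal: "z \<notin> \<real> \<Longrightarrow> f_prod d 1 z \<noteq> 0" "z \<notin> \<real> \<Longrightarrow> f_prod d (-1) z \<noteq> 0"
  by (rule f_prod_nonzero; auto)+

lemma rhp_unique:
  assumes b: "is_b d gs b" and \<Phi>: "rhp_regular b \<Phi>" and \<Psi>: "rhp_regular b \<Psi>"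
    and jump: "\<And>y. y \<notin> edge_set d \<Longrightarrow> same_jump \<Phi> \<Psi> y"
    and z: "z \<notin> \<real>"
  shows "\<Phi> z = \<Psi> z"
proof -
  let ?F = "to_infinity_within (disc_complement d)"
  obtain T G where T: "entire_simple_zeros T (gam d ` gap_idx d)" and G: "entire_simple_zeros G (edge_set d)"
    and bnz: "\<And>z. z \<notin> \<real> \<Longrightarrow> b z \<noteq> 0"
    and bTG: "\<And>z. z \<notin> \<real> \<Longrightarrow> ((b z)\<^sup>2 * (f_prod d 1 z * f_prod d (-1) z))\<^sup>2 * G z = (T z)\<^sup>2"
    using b_square_product[OF b] by metis
  have B_nz: "det (B_mat d b z) \<noteq> 0" if "z \<notin> \<real>" for z
    using det_B_square[of b z] bnz[OF that] f_prod_nonreal[OF that] by auto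
  have Tnz: "T z \<noteq> 0" if "z \<notin> \<real>" for z
    using T that unfolding entire_simple_zeros_def by auto
  have expansion: "\<exists>A. (A \<longlongrightarrow> 0) ?F \<and> (\<forall>\<^sub>F z in ?F. X z = U_mat ** (mat 1 + A z) ** B_mat d b z)"
    if X: "rhp_regular b X" for X
  proof -
    obtain A where A: "\<And>i j. (\<lambda>z. A z $ i $ j) \<in> O[?F](\<lambda>z. 1 / z)"
      "\<forall>\<^sub>F z in ?F. X z = U_mat ** (mat 1 + A z) ** B_mat d b z"
      using X unfolding rhp_regular_def by blast
    have "(A \<longlongrightarrow> 0) ?F"
      by (intro vec_tendstoI) (simp add: bigo_inverse_tendsto_0[OF A(1)])
    then show ?thesis using A(2) by blast
  qed
  obtain A1 where A1: "(A1 \<longlongrightarrow> 0) ?F" "\<forall>\<^sub>F z in ?F. \<Phi> z = U_mat ** (mat 1 + A1 z) ** B_mat d b z"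
    using expansion[OF \<Phi>] by blast
  obtain A2 where A2: "(A2 \<longlongrightarrow> 0) ?F" "\<forall>\<^sub>F z in ?F. \<Psi> z = U_mat ** (mat 1 + A2 z) ** B_mat d b z"
    using expansion[OF \<Psi>] by blast
  have jump': "same_jump \<Psi> \<Psi> y" if "y \<notin> edge_set d" for y
    using jump[OF that] unfolding same_jump_def by blast
  obtain \<delta> where \<delta>: "\<delta> holomorphic_on UNIV" "\<And>z. z \<notin> \<real> \<Longrightarrow> \<delta> z = det (\<Psi> z)"
    using pairing_entire[OF \<Psi> \<Psi> jump', of 1 2] unfolding pairing_rows by metis
  have detA2: "((\<lambda>z. det (U_mat ** (mat 1 + A2 z))) \<longlongrightarrow> \<i>) ?F"
  proof -
    have "((\<lambda>z. det (U_mat ** (mat 1 + A2 z))) \<longlongrightarrow> det (U_mat ** (mat 1 + 0))) ?F"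
      by (intro tendsto_det tendsto_mat_mult tendsto_intros A2)
    then show ?thesis by (simp add: det_U)
  qed
  have \<delta>_exp: "\<forall>\<^sub>F z in ?F. \<delta> z = det (U_mat ** (mat 1 + A2 z)) * det (B_mat d b z)"
    using A2(2) eventually_disc_complement
    by eventually_elim (simp add: \<delta>(2) disc_complement_nonreal det_mul)
  \<comment> \<open>G / T^2 is the inverse of (det B)^2 off the real axis, so only the square of det
    (U (1 + A2)) remains, and det U is \<open>\<i>\<close>.\<close>
  have "((\<lambda>z. (\<delta> z)\<^sup>2 * G z / (T z)\<^sup>2) \<longlongrightarrow> \<i>\<^sup>2) ?F"
  proof (rule Lim_transform_eventually)
    show "((\<lambda>z. (det (U_mat ** (mat 1 + A2 z)))\<^sup>2) \<longlongrightarrow> \<i>\<^sup>2) ?F"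
      by (intro tendsto_intros detA2)
    show "\<forall>\<^sub>F z in ?F. (det (U_mat ** (mat 1 + A2 z)))\<^sup>2 = (\<delta> z)\<^sup>2 * G z / (T z)\<^sup>2"
      using \<delta>_exp eventually_disc_complement
    proof eventually_elim
      case (elim z)
      have zr: "z \<notin> \<real>" using elim disc_complement_nonreal by blast
      have "(det (B_mat d b z))\<^sup>2 * G z = (T z)\<^sup>2" using bTG[OF zr] det_B_square by simp
      then have "(\<delta> z)\<^sup>2 * G z = (det (U_mat ** (mat 1 + A2 z)))\<^sup>2 * (T z)\<^sup>2"
        unfolding elim(1) power_mult_distrib by (simp add: mult.assoc)
      then show ?case using Tnz[OF zr] by simp
    qed
  qed
  then have \<delta>nz: "\<delta> z \<noteq> 0" for z using zero_free[OF \<delta>(1) T G] by simp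
  have ortho: "pairing ((\<Phi> z - \<Psi> z) $ i) (\<Psi> z $ j) = 0" for i j
  proof -
    obtain X where X: "X holomorphic_on UNIV" "\<And>z. z \<notin> \<real> \<Longrightarrow> X z = pairing (\<Phi> z $ i) (\<Psi> z $ j)"
      using pairing_entire[OF \<Phi> \<Psi> jump] by metis
    obtain Y where Y: "Y holomorphic_on UNIV" "\<And>z. z \<notin> \<real> \<Longrightarrow> Y z = pairing (\<Psi> z $ i) (\<Psi> z $ j)"
      using pairing_entire[OF \<Psi> \<Psi> jump'] by metis
    \<comment> \<open>X - Y pairs a row of Phi - Psi with a row of Psi. Numerator and
      \<open>\<delta>\<close> both carry the factor det B, so B cancels and what remains is governed
      by A1 - A2, which tends to 0.\<close>
    define w where "w z = (X z - Y z) / \<delta> z" for z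
    have "w holomorphic_on UNIV" unfolding w_def using X Y \<delta> \<delta>nz by (intro holomorphic_intros) auto
    moreover have "(w \<longlongrightarrow> 0) ?F"
    proof (rule Lim_transform_eventually)
      let ?v = "\<lambda>z. pairing ((U_mat ** (A1 z - A2 z)) $ i) ((U_mat ** (mat 1 + A2 z)) $ j) / det (U_mat ** (mat 1 + A2 z))"
      have "(?v \<longlongrightarrow> pairing ((U_mat ** (0 - 0)) $ i) ((U_mat ** (mat 1 + 0)) $ j) / \<i>) ?F"
        by (intro tendsto_intros tendsto_pairing tendsto_mat_mult A1 A2 detA2) auto
      then show "(?v \<longlongrightarrow> 0) ?F" by (simp add: pairing_def mat_mult_entry)
      show "\<forall>\<^sub>F z in ?F. ?v z = w z"
        using A1(2) A2(2) \<delta>_exp eventually_disc_complement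
      proof eventually_elim
        case (elim z)
        have zr: "z \<notin> \<real>" using elim disc_complement_nonreal by blast
        have "\<Phi> z - \<Psi> z = U_mat ** (A1 z - A2 z) ** B_mat d b z"
          unfolding elim(1,2) by (simp add: vec_eq_iff mat_mult_entry algebra_simps)
        then have "X z - Y z = pairing ((U_mat ** (A1 z - A2 z) ** B_mat d b z) $ i) ((U_mat ** (mat 1 + A2 z) ** B_mat d b z) $ j)"
          using X(2)[OF zr] Y(2)[OF zr] pairing_diff_left elim(2) by (metis vector_minus_component)
        also have "\<dots> = det (B_mat d b z) * pairing ((U_mat ** (A1 z - A2 z)) $ i) ((U_mat ** (mat 1 + A2 z)) $ j)"
          by (rule pairing_mult)
        finally show ?case unfolding w_def elim(3) using B_nz[OF zr] by simp
      qed
    qed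
    ultimately have "w z = 0" by (rule entire_zero_if_vanishing)
    then show ?thesis using X(2)[OF z] Y(2)[OF z] \<delta>nz[of z] by (simp add: w_def pairing_diff_left)
  qed
  have "(\<Phi> z - \<Psi> z) $ i = 0" for i
    by (rule pairing_nondegenerate[of "\<Psi> z"]) (use \<delta>(2)[OF z] \<delta>nz[of z] ortho in auto)
  then show ?thesis by (simp add: vec_eq_iff)
qed

end

section \<open>The multiplier\<close>

locale time_period = candidate_data d for d +
  fixes r2 :: "complex \<Rightarrow> complex" and r2p r2m :: "real \<Rightarrow> complex" and L2 :: real
  assumes off_gaps: "holomorphic_off_gaps d r2"
    and bv: "boundary_values r2 (UNIV - spectrum d) r2p r2m"
    and r2_jump: "\<And>y. y \<in> UNIV - spectrum d \<Longrightarrow> r2m y \<noteq> 0 \<and> r2p y = inverse (r2m y)"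
    and asym: "\<exists>A. A \<in> O[to_infinity_within (gap_complement d)](\<lambda>z. 1 / z) \<and>
           (\<forall>\<^sub>F z in to_infinity_within (gap_complement d).
              r2 z = exp (2 * \<i> * z\<^sup>2 * of_real L2) * (1 + A z))"
begin

lemma gap_iff: "y \<in> UNIV - spectrum d \<longleftrightarrow> (\<exists>k\<in>gap_idx d. E (2 * k - 1) < y \<and> y < E (2 * k))"
  by (auto simp: spectrum_def)

lemma gap_complement_iff: "z \<in> gap_complement d \<longleftrightarrow> (\<forall>y\<in>UNIV - spectrum d. z \<noteq> of_real y)"
  by (auto simp: gap_complement_def)

lemma gap_complement_of_real: "of_real y \<in> gap_complement d \<longleftrightarrow> y \<in> spectrum d"
  by (auto simp: gap_complement_def)

lemma nonreal_gap_complement: "- \<real> \<subseteq> gap_complement d"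
  by (auto simp: gap_complement_def)

lemma cnj_gap_complement: "cnj z \<in> gap_complement d \<longleftrightarrow> z \<in> gap_complement d"
  unfolding gap_complement_iff by (metis complex_cnj_cnj complex_cnj_complex_of_real)

lemma edge_spectrum: "e \<in> edge_set d \<Longrightarrow> e \<in> spectrum d"
proof (rule ccontr)
  assume e: "e \<in> edge_set d" "e \<notin> spectrum d"
  then obtain k where k: "k \<in> gap_idx d" "E (2 * k - 1) < e" "e < E (2 * k)" using gap_iff by blast
  obtain l where l: "l \<in> gap_idx d" "e = E (2 * l) \<or> e = E (2 * l - 1)" using e edge_setE by blast
  show False
    using k l gaps_ordered[OF k(1) l(1)] gaps_ordered[OF l(1) k(1)] gap_less[OF l(1)]
    by (cases k l rule: linorder_cases) auto
qed

lemma r2_holomorphic: "open U \<Longrightarrow> U \<subseteq> gap_complement d \<Longrightarrow> r2 holomorphic_on U"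
  using off_gaps unfolding holomorphic_off_gaps_def
  by (meson holomorphic_on_subset interior_maximal)

lemma r2_tendsto:
  "y \<in> spectrum d \<Longrightarrow> (r2 \<longlongrightarrow> r2 (of_real y)) (at (of_real y) within - \<real>)"
  "y \<notin> spectrum d \<Longrightarrow> (r2 \<longlongrightarrow> r2p y) (at (of_real y) within {z. Im z > 0})"
  "y \<notin> spectrum d \<Longrightarrow> (r2 \<longlongrightarrow> r2m y) (at (of_real y) within {z. Im z < 0})"
proof -
  assume "y \<in> spectrum d"
  then have "(r2 \<longlongrightarrow> r2 (of_real y)) (at (of_real y) within gap_complement d)"
    using off_gaps gap_complement_of_real unfolding holomorphic_off_gaps_def continuous_on_def by blast
  then show "(r2 \<longlongrightarrow> r2 (of_real y)) (at (of_real y) within - \<real>)"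
    using nonreal_gap_complement by (rule tendsto_within_subset)
qed (use bv in \<open>auto simp: boundary_values_def\<close>)

section \<open>Reflection in the real axis and the values at the edges\<close>

lemma filterlim_cnj:
  "filterlim cnj (at (of_real y) within - \<real>) (at (of_real y) within - \<real>)"
  "filterlim cnj (at (of_real y) within {z. Im z < 0}) (at (of_real y) within {z. Im z > 0})"
  "filterlim cnj (at (of_real y) within {z. Im z > 0}) (at (of_real y) within {z. Im z < 0})"
proof -
  have c: "(cnj \<longlongrightarrow> of_real y) (at (of_real y) within A)" for A
    using tendsto_cnj[OF tendsto_ident_at, of "of_real y" A] by simp
  show "filterlim cnj (at (of_real y) within - \<real>) (at (of_real y) within - \<real>)"
    unfolding filterlim_at using c by (auto simp: eventually_at_filter Reals_iff_Im complex_eq_iff)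
  show "filterlim cnj (at (of_real y) within {z. Im z < 0}) (at (of_real y) within {z. Im z > 0})"
    unfolding filterlim_at using c by (auto simp: eventually_at_filter complex_eq_iff)
  show "filterlim cnj (at (of_real y) within {z. Im z > 0}) (at (of_real y) within {z. Im z < 0})"
    unfolding filterlim_at using c by (auto simp: eventually_at_filter complex_eq_iff)
qed

lemma r2_cnj_tendsto:
  "y \<in> spectrum d \<Longrightarrow> ((\<lambda>z. r2 (cnj z)) \<longlongrightarrow> r2 (of_real y)) (at (of_real y) within - \<real>)"
  "y \<notin> spectrum d \<Longrightarrow> ((\<lambda>z. r2 (cnj z)) \<longlongrightarrow> r2m y) (at (of_real y) within {z. Im z > 0})"
  "y \<notin> spectrum d \<Longrightarrow> ((\<lambda>z. r2 (cnj z)) \<longlongrightarrow> r2p y) (at (of_real y) within {z. Im z < 0})"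
  using filterlim_compose[OF r2_tendsto(1) filterlim_cnj(1)]
    filterlim_compose[OF r2_tendsto(3) filterlim_cnj(2)]
    filterlim_compose[OF r2_tendsto(2) filterlim_cnj(3)] by auto

text \<open>The product r2(z) r2(cnj z) is not holomorphic, but it is continuous across the whole
  axis: on a gap both one-sided limits equal r2_+ r2_- = 1. By continuity it is still 1 at the end
  points of the gap, where it is the square of r2.\<close>

lemma r2_edge_square:
  assumes e: "e \<in> edge_set d"
  shows "(r2 (of_real e))\<^sup>2 = 1"
proof -
  define l where "l y = (if y \<in> spectrum d then (r2 (of_real y))\<^sup>2 else 1)" for y
  define Q where "Q z = (if z \<in> \<real> then l (Re z) else r2 z * r2 (cnj z))" for z
  have hol: "r2 holomorphic_on - \<real>"
    by (rule r2_holomorphic[OF open_Compl_Reals nonreal_gap_complement])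
  have "continuous_on UNIV Q"
    unfolding Q_def
  proof (rule continuous_on_extend_across_reals)
    have c: "continuous_on (- \<real>) r2" using hol holomorphic_on_imp_continuous_on by blast
    have "continuous_on (- \<real>) (\<lambda>z. r2 (cnj z))"
      by (rule continuous_on_compose2[OF c]) (auto intro!: continuous_intros simp: Reals_iff_Im)
    with c show "continuous_on (UNIV - \<real>) (\<lambda>z. r2 z * r2 (cnj z))"
      by (auto simp: Compl_eq_Diff_UNIV intro!: continuous_intros)
    fix y :: complex assume "y \<in> \<real>"
    then obtain x where y: "y = of_real x" by (auto elim: Reals_cases)
    show "((\<lambda>z. r2 z * r2 (cnj z)) \<longlongrightarrow> l (Re y)) (at y within - \<real>)"
    proof (cases "x \<in> spectrum d")
      case True
      then show ?thesis using tendsto_mult[OF r2_tendsto(1) r2_cnj_tendsto(1)]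
        by (simp add: y l_def power2_eq_square)
    next
      case False
      then have "r2p x * r2m x = 1" "r2m x * r2p x = 1" using r2_jump[of x] by auto
      then show ?thesis
        using tendsto_mult[OF r2_tendsto(2)[OF False] r2_cnj_tendsto(2)[OF False]]
          tendsto_mult[OF r2_tendsto(3)[OF False] r2_cnj_tendsto(3)[OF False]] False
        by (simp add: y l_def tendsto_nonreal_iff)
    qed
  qed auto
  then have c: "continuous_on UNIV (\<lambda>y. Q (of_real y))"
    by (rule continuous_on_compose2) (auto intro!: continuous_intros)
  have cl: "closed {y. Q (complex_of_real y) = 1}"
    using continuous_closed_preimage_constant[OF c closed_UNIV] by simp
  obtain k where k: "k \<in> gap_idx d" "e = E (2 * k) \<or> e = E (2 * k - 1)" using e edge_setE by blast
  have "{E (2 * k - 1)<..<E (2 * k)} \<subseteq> {y. Q (complex_of_real y) = 1}"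
  proof
    fix y assume "y \<in> {E (2 * k - 1)<..<E (2 * k)}"
    then have "y \<notin> spectrum d" using k(1) gap_iff[of y] by auto
    then show "y \<in> {y. Q (complex_of_real y) = 1}" by (simp add: Q_def l_def)
  qed
  then have "closure {E (2 * k - 1)<..<E (2 * k)} \<subseteq> {y. Q (complex_of_real y) = 1}"
    using cl closure_minimal by blast
  then have "{E (2 * k - 1)..E (2 * k)} \<subseteq> {y. Q (complex_of_real y) = 1}"
    using gap_less[OF k(1)] by (simp add: closure_greaterThanLessThan)
  moreover have "e \<in> {E (2 * k - 1)..E (2 * k)}" using k gap_less[OF k(1)] by auto
  ultimately have "e \<in> {y. Q (complex_of_real y) = 1}" by blast
  then show ?thesis using edge_spectrum[OF e] by (simp add: Q_def l_def)
qed

text \<open>Conjugating outside as well as inside keeps the product holomorphic. On a gap its value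
  from above is r2_+ cnj(r2_-) = cnj(r2_-) / r2_-, and its value from below is the inverse of that
  number.\<close>

definition \<rho> :: "complex \<Rightarrow> complex" where "\<rho> z = r2 z * cnj (r2 (cnj z))"

lemma \<rho>_cnj: "\<rho> (cnj z) = cnj (\<rho> z)"
  by (simp add: \<rho>_def)

lemma \<rho>_holomorphic:
  assumes U: "open U" "U \<subseteq> gap_complement d"
  shows "\<rho> holomorphic_on U"
proof -
  have op: "open (cnj ` U)"
  proof -
    have "cnj ` U = cnj -` U" by (auto simp: image_iff) (metis complex_cnj_cnj)
    then show ?thesis using U by (simp add: open_vimage continuous_intros)
  qed
  have sub: "cnj ` U \<subseteq> gap_complement d"
  proof
    fix w assume "w \<in> cnj ` U"
    then obtain u where "u \<in> U" "w = cnj u" by blast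
    then show "w \<in> gap_complement d" using U(2) cnj_gap_complement by auto
  qed
  have "cnj \<circ> r2 \<circ> cnj holomorphic_on U"
    by (rule holomorphic_on_compose_cnj_cnj[OF r2_holomorphic[OF op sub] U(1)])
  then have "(\<lambda>z. cnj (r2 (cnj z))) holomorphic_on U" by (simp add: comp_def)
  then show ?thesis unfolding \<rho>_def[abs_def] by (intro holomorphic_intros r2_holomorphic[OF U])
qed

lemma \<rho>_nonreal_holomorphic: "\<rho> holomorphic_on - \<real>"
  by (rule \<rho>_holomorphic[OF open_Compl_Reals nonreal_gap_complement])

lemma \<rho>_tendsto:
  "y \<in> spectrum d \<Longrightarrow> (\<rho> \<longlongrightarrow> \<rho> (of_real y)) (at (of_real y) within - \<real>)"
  "y \<notin> spectrum d \<Longrightarrow> (\<rho> \<longlongrightarrow> r2p y * cnj (r2m y)) (at (of_real y) within {z. Im z > 0})"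
  "y \<notin> spectrum d \<Longrightarrow> (\<rho> \<longlongrightarrow> r2m y * cnj (r2p y)) (at (of_real y) within {z. Im z < 0})"
  unfolding \<rho>_def[abs_def] complex_cnj_complex_of_real
  by (intro tendsto_mult tendsto_cnj r2_tendsto r2_cnj_tendsto; assumption)+

lemma \<rho>_edge: "e \<in> edge_set d \<Longrightarrow> \<rho> (of_real e) = 1"
proof -
  assume "e \<in> edge_set d"
  then have "r2 (of_real e) = 1 \<or> r2 (of_real e) = -1"
    using r2_edge_square power2_eq_1_iff by blast
  then show ?thesis by (auto simp: \<rho>_def)
qed

lemma s_tendsto: "((\<lambda>z. r2 z * exp (- (2 * \<i> * z\<^sup>2 * of_real L2))) \<longlongrightarrow> 1) (to_infinity_within (gap_complement d))"
proof -
  obtain A where A: "A \<in> O[to_infinity_within (gap_complement d)](\<lambda>z. 1 / z)"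
    "\<forall>\<^sub>F z in to_infinity_within (gap_complement d). r2 z = exp (2 * \<i> * z\<^sup>2 * of_real L2) * (1 + A z)"
    using asym by blast
  show ?thesis
  proof (rule Lim_transform_eventually)
    show "((\<lambda>z. 1 + A z) \<longlongrightarrow> 1) (to_infinity_within (gap_complement d))"
      using tendsto_add[OF tendsto_const bigo_inverse_tendsto_0[OF A(1)], of 1] by simp
    show "\<forall>\<^sub>F z in to_infinity_within (gap_complement d). 1 + A z = r2 z * exp (- (2 * \<i> * z\<^sup>2 * of_real L2))"
      using A(2) by eventually_elim (simp add: exp_minus)
  qed
qed

lemma \<rho>_near_1:
  assumes "e > 0"
  obtains c where "c > 0" "\<And>z. z \<in> gap_complement d \<Longrightarrow> c \<le> norm z \<Longrightarrow> norm (\<rho> z - 1) < e"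
proof -
  let ?F = "to_infinity_within (gap_complement d)"
  define s where "s z = r2 z * exp (- (2 * \<i> * z\<^sup>2 * of_real L2))" for z
  have s: "(s \<longlongrightarrow> 1) ?F" unfolding s_def by (rule s_tendsto)
  have "filterlim cnj ?F ?F"
    unfolding filterlim_iff eventually_to_infinity_within
    by (metis cnj_gap_complement complex_mod_cnj)
  then have "((\<lambda>z. s z * cnj (s (cnj z))) \<longlongrightarrow> 1 * cnj 1) ?F"
    by (intro tendsto_intros s filterlim_compose[OF s])
  moreover have "s z * cnj (s (cnj z)) = \<rho> z" for z
  proof -
    \<comment> \<open>The exponent and the conjugate of its value at \<open>cnj z\<close> are
      negatives of each other because L2 is real.\<close>
    have "exp (- (2 * \<i> * z\<^sup>2 * of_real L2)) * cnj (exp (- (2 * \<i> * (cnj z)\<^sup>2 * of_real L2))) = 1"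
      by (simp add: exp_cnj flip: exp_add)
    moreover have "s z * cnj (s (cnj z)) = \<rho> z * (exp (- (2 * \<i> * z\<^sup>2 * of_real L2)) * cnj (exp (- (2 * \<i> * (cnj z)\<^sup>2 * of_real L2))))"
      by (simp only: s_def \<rho>_def complex_cnj_mult mult_ac)
    ultimately show ?thesis by simp
  qed
  ultimately have "(\<rho> \<longlongrightarrow> 1) ?F" by simp
  then have "\<forall>\<^sub>F z in ?F. norm (\<rho> z - 1) < e" using assms by (simp add: tendsto_iff dist_norm)
  then obtain c where "\<And>z. z \<in> gap_complement d \<Longrightarrow> c \<le> norm z \<Longrightarrow> norm (\<rho> z - 1) < e"
    unfolding eventually_to_infinity_within by blast
  then show ?thesis by (intro that[of "max c 1"]) auto
qed

text \<open>\<open>\<rho> + 1 / \<rho> - 2\<close> does not jump across the gaps, so it is analytic at infinity, where its zeros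
  at the edges accumulate.\<close>

lemma \<rho>_far_infinite:
  assumes inf: "infinite (gap_idx d)"
  shows "\<exists>c. \<forall>z. z \<notin> \<real> \<longrightarrow> c < norm z \<longrightarrow> \<rho> z = 1"
proof -
  obtain c where c: "c > 0" "\<And>z. z \<in> gap_complement d \<Longrightarrow> c \<le> norm z \<Longrightarrow> norm (\<rho> z - 1) < 1/2"
    using \<rho>_near_1[of "1/2"] by auto
  define U where "U = {z::complex. c < norm z}"
  have U: "open U" unfolding U_def by (rule open_Collect_less) (intro continuous_intros)+
  \<comment> \<open>For nonzero a this is a + 1/a - 2, which is invariant under inversion and
    vanishes only at a = 1. The tolerance 1/2 chosen above keeps \<open>\<rho>\<close> away from 0
    and D bounded.\<close>
  define D where "D a = (a - 1)\<^sup>2 / a" for a :: complex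
  have half: "norm a \<ge> 1/2" if "norm (a - 1) < 1/2" for a :: complex
    using norm_triangle_ineq2[of 1 a] that by (simp add: norm_minus_commute)
  have Dbd: "norm (D a) \<le> 1" if "norm (a - 1) < 1/2" for a
  proof -
    have "norm (a - 1) ^ 2 \<le> (1/2)^2" using that by (intro power_mono) auto
    then show ?thesis using half[OF that] unfolding D_def norm_divide norm_power
      by (subst divide_le_eq_1_pos) (auto simp: power2_eq_square)
  qed
  have D_sum: "D a = a + b - 2" if "a * b = 1" for a b
  proof -
    have "D a = (a - 1)\<^sup>2 * b" by (simp add: D_def divide_inverse inverse_unique[OF that])
    also have "\<dots> = a * (a * b) - 2 * (a * b) + b" by (simp add: power2_eq_square algebra_simps)
    finally show ?thesis by (simp add: that)
  qed
  have Dinv: "D a = D b" if "a * b = 1" for a b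
    using D_sum[of a b] D_sum[of b a] that by (simp add: mult.commute)
  have D_tendsto: "((\<lambda>z. D (f z)) \<longlongrightarrow> D a) F" if "(f \<longlongrightarrow> a) F" "a \<noteq> 0" for f a and F :: "complex filter"
    unfolding D_def by (intro tendsto_intros that)
  define l where "l y = (if y \<in> spectrum d then D (\<rho> (of_real y)) else D (r2p y * cnj (r2m y)))" for y
  define H where "H z = (if z \<in> \<real> then l (Re z) else D (\<rho> z))" for z
  have nz: "\<rho> z \<noteq> 0" if "z \<in> gap_complement d" "z \<in> U" for z
    using half[OF c(2)[OF that(1)]] that(2) unfolding U_def by auto
  have lim: "((\<lambda>z. D (\<rho> z)) \<longlongrightarrow> l (Re y)) (at y within - \<real>)" if y: "y \<in> U" "y \<in> \<real>" for y
  proof -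
    obtain x where x: "y = of_real x" using y(2) by (auto elim: Reals_cases)
    show ?thesis
    proof (cases "x \<in> spectrum d")
      case True
      then have "\<rho> y \<noteq> 0" using nz y x gap_complement_of_real by simp
      then show ?thesis using D_tendsto[OF \<rho>_tendsto(1)[OF True]] True by (simp add: x l_def)
    next
      case False
      have 0: "r2m x \<noteq> 0" "r2p x = inverse (r2m x)" using r2_jump[of x] False by auto
      have "D (r2p x * cnj (r2m x)) = D (r2m x * cnj (r2p x))"
        by (rule Dinv) (use 0(1) in \<open>simp add: 0(2) field_simps\<close>)
      then show ?thesis
        using D_tendsto[OF \<rho>_tendsto(2)[OF False]] D_tendsto[OF \<rho>_tendsto(3)[OF False]] 0 False
        by (simp add: x l_def tendsto_nonreal_iff)
    qed
  qed
  have Hhol: "H holomorphic_on U"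
    unfolding H_def
  proof (rule holomorphic_on_extend_across_reals[OF U])
    have "\<rho> holomorphic_on U - \<real>" by (rule holomorphic_on_subset[OF \<rho>_nonreal_holomorphic]) auto
    moreover have "\<rho> z \<noteq> 0" if "z \<in> U - \<real>" for z using that nz nonreal_gap_complement by auto
    ultimately show "(\<lambda>z. D (\<rho> z)) holomorphic_on U - \<real>"
      unfolding D_def by (intro holomorphic_intros) auto
  qed (rule lim)
  have Hbd: "norm (H z) \<le> 1" if z: "z \<in> U" for z
  proof (cases "z \<in> \<real>")
    case False
    then have "norm (\<rho> z - 1) < 1/2" using z nonreal_gap_complement by (intro c(2)) (auto simp: U_def)
    then show ?thesis using Dbd False by (simp add: H_def)
  next
    case True
    obtain x where x: "z = of_real x" using True by (auto elim: Reals_cases)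
    have "\<forall>\<^sub>F w in at z within - \<real>. w \<in> U"
      using eventually_at_in_open'[OF U z] by (rule filter_leD[OF at_le, rotated]) auto
    moreover have "\<forall>\<^sub>F w in at z within - \<real>. w \<in> - \<real>" by (simp add: eventually_at_filter)
    ultimately have ev: "\<forall>\<^sub>F w in at z within - \<real>. norm (D (\<rho> w)) \<le> 1"
    proof eventually_elim
      case (elim w)
      then have "norm (\<rho> w - 1) < 1/2" using nonreal_gap_complement by (intro c(2)) (auto simp: U_def)
      then show ?case by (rule Dbd)
    qed
    have "norm (l (Re z)) \<le> 1"
      by (rule tendsto_upperbound[OF tendsto_norm[OF lim[OF z True]] ev]) (simp add: x)
    then show ?thesis using True by (simp add: H_def)
  qed
  \<comment> \<open>The inversion w = 1/z turns the exterior of the disc of radius c into a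
    punctured disc, where boundedness removes the singularity at 0.\<close>
  define V where "V = ball (0::complex) (1 / c)"
  have inV: "1 / w \<in> U" if "w \<in> V - {0}" for w
    using that c(1) unfolding U_def V_def by (auto simp: norm_divide field_simps)
  have "(\<lambda>w. H (1 / w)) holomorphic_on V - {0}"
  proof -
    have "H \<circ> (\<lambda>w. 1 / w) holomorphic_on V - {0}"
      by (rule holomorphic_on_compose_gen[OF _ Hhol]) (use inV in \<open>auto intro!: holomorphic_intros\<close>)
    then show ?thesis by (simp add: comp_def)
  qed
  moreover have "\<forall>\<^sub>F w in at 0. norm (H (1 / w)) \<le> 1"
    using eventually_at_in_open[of V 0] c(1) Hbd inV unfolding V_def by (auto elim!: eventually_mono)
  moreover have "0 \<in> interior V" using c(1) by (simp add: V_def)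
  ultimately obtain \<kappa> where \<kappa>: "\<kappa> holomorphic_on V" "\<forall>w\<in>V - {0}. \<kappa> w = H (1 / w)"
    using holomorphic_on_extend_bounded[of "\<lambda>w. H (1 / w)" V 0] by blast
  define Z where "Z = {w \<in> V. \<kappa> w = 0}"
  \<comment> \<open>The reciprocals of edges far out are zeros, since \<open>\<rho>\<close> is 1 at
    every edge; with infinitely many gaps they come arbitrarily close to 0.\<close>
  have "0 islimpt Z"
    unfolding islimpt_approachable
  proof (intro allI impI)
    fix e :: real assume e: "e > 0"
    obtain k where k: "k \<in> gap_idx d" "max c (1 / e) < \<bar>E (2 * k)\<bar>" using edges_unbounded[OF inf] by blast
    define w where "w = 1 / complex_of_real (E (2 * k))"
    have E0: "E (2 * k) \<noteq> 0" using k c(1) by auto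
    have "norm w = 1 / \<bar>E (2 * k)\<bar>" by (simp add: w_def norm_divide)
    moreover have "1 / \<bar>E (2 * k)\<bar> < 1 / c" using k c(1) by (intro divide_strict_left_mono) auto
    moreover have "1 / \<bar>E (2 * k)\<bar> < e" using k e E0 by (simp add: field_simps)
    ultimately have w: "w \<in> V - {0}" "norm w < e" using E0 unfolding V_def by (auto simp: w_def)
    have es: "E (2 * k) \<in> spectrum d" using edge_spectrum edge_setI(1)[OF k(1)] by blast
    have "\<kappa> w = H (of_real (E (2 * k)))" using \<kappa>(2) w by (simp add: w_def)
    also have "\<dots> = 0" using es \<rho>_edge[OF edge_setI(1)[OF k(1)]] by (simp add: H_def l_def D_def)
    finally show "\<exists>x'\<in>Z. x' \<noteq> 0 \<and> dist x' 0 < e" using w by (auto simp: Z_def)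
  qed
  moreover have "open V" "connected V" "0 \<in> V" using c(1) by (simp_all add: V_def)
  moreover have "Z \<subseteq> V" "\<And>z. z \<in> Z \<Longrightarrow> \<kappa> z = 0" by (simp_all add: Z_def)
  ultimately have \<kappa>0: "\<kappa> w = 0" if "w \<in> V" for w
    using that by (metis analytic_continuation[OF \<kappa>(1)])
  have "\<rho> z = 1" if z: "z \<notin> \<real>" "c < norm z" for z
  proof -
    have "norm z > 0" using z(2) c(1) by linarith
    then have "1 / z \<in> V - {0}" using z c(1) by (auto simp: V_def norm_divide field_simps)
    then have "H z = 0" using \<kappa>(2) \<kappa>0 by force
    moreover have "\<rho> z \<noteq> 0" using nz[of z] z nonreal_gap_complement by (auto simp: U_def)
    ultimately show ?thesis using z by (simp add: H_def D_def)
  qed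
  then show ?thesis by blast
qed

text \<open>\<open>\<bar>\<rho>\<bar> = 1\<close> on finitely many gaps, so \<open>\<bar>\<rho>\<bar> \<le> 1\<close> by the maximum principle; but \<open>\<rho>\<close> is analytic
  at infinity with value \<open>1\<close> there.\<close>

lemma \<rho>_far_finite:
  assumes fin: "finite (gap_idx d)"
  shows "\<exists>c. \<forall>z. z \<notin> \<real> \<longrightarrow> c < norm z \<longrightarrow> \<rho> z = 1"
proof -
  define K where "K = complex_of_real ` (\<Union>k\<in>gap_idx d. {E (2 * k - 1)..E (2 * k)})"
  have "compact K"
    unfolding K_def by (intro compact_continuous_image compact_UN fin continuous_intros compact_Icc)
  then have clK: "closed K" and bdK: "bounded K" by (auto simp: compact_imp_closed compact_imp_bounded)
  have opK: "open (- K)" using clK by blast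
  have K_gaps: "- K \<subseteq> gap_complement d"
  proof
    fix z assume "z \<in> - K"
    show "z \<in> gap_complement d"
      unfolding gap_complement_iff
    proof (intro ballI notI)
      fix y assume y: "y \<in> UNIV - spectrum d" "z = of_real y"
      then obtain k where k: "k \<in> gap_idx d" "E (2 * k - 1) < y" "y < E (2 * k)" using gap_iff by blast
      then have "y \<in> (\<Union>k\<in>gap_idx d. {E (2 * k - 1)..E (2 * k)})" by (intro UN_I[OF k(1)]) simp
      then have "z \<in> K" unfolding K_def y(2) by (rule imageI)
      then show False using \<open>z \<in> - K\<close> by blast
    qed
  qed
  obtain b where b: "\<And>z. z \<in> K \<Longrightarrow> norm z \<le> b" using bdK bounded_iff by blast
  define l where "l y = (if y \<in> spectrum d then norm (\<rho> (of_real y)) else 1)" for y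
  \<comment> \<open>Across a gap the two boundary values of \<open>\<rho>\<close> may differ, but
    both have modulus 1. So the modulus, unlike \<open>\<rho>\<close>, extends continuously to the
    whole plane.\<close>
  define M where "M z = (if z \<in> \<real> then l (Re z) else norm (\<rho> z))" for z
  have Mc: "continuous_on UNIV M"
    unfolding M_def
  proof (rule continuous_on_extend_across_reals)
    show "continuous_on (UNIV - \<real>) (\<lambda>z. norm (\<rho> z))"
      using holomorphic_on_imp_continuous_on[OF \<rho>_nonreal_holomorphic]
      by (auto simp: Compl_eq_Diff_UNIV intro!: continuous_intros)
    fix y :: complex assume "y \<in> \<real>"
    then obtain x where y: "y = of_real x" by (auto elim: Reals_cases)
    show "((\<lambda>z. norm (\<rho> z)) \<longlongrightarrow> l (Re y)) (at y within - \<real>)"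
    proof (cases "x \<in> spectrum d")
      case True
      then show ?thesis using tendsto_norm[OF \<rho>_tendsto(1)[OF True]] by (simp add: y l_def)
    next
      case False
      have 0: "r2m x \<noteq> 0" "r2p x = inverse (r2m x)" using r2_jump[of x] False by auto
      then have "norm (r2p x * cnj (r2m x)) = 1" "norm (r2m x * cnj (r2p x)) = 1"
        by (simp_all add: norm_mult norm_inverse)
      then show ?thesis
        using tendsto_norm[OF \<rho>_tendsto(2)[OF False]] tendsto_norm[OF \<rho>_tendsto(3)[OF False]] False
        by (simp add: y l_def tendsto_nonreal_iff)
    qed
  qed auto
  have M_off: "M z = norm (\<rho> z)" if "z \<in> gap_complement d" for z
  proof (cases "z \<in> \<real>")
    case True
    then obtain y where y: "z = of_real y" by (auto elim: Reals_cases)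
    then have "y \<in> spectrum d" using that gap_complement_of_real by blast
    then show ?thesis by (simp add: M_def l_def y)
  qed (simp add: M_def)
  have M_K: "M z = 1" if z: "z \<in> K" for z
  proof -
    obtain k y where k: "k \<in> gap_idx d" "E (2 * k - 1) \<le> y" "y \<le> E (2 * k)" "z = of_real y"
      using z unfolding K_def by auto
    show ?thesis
    proof (cases "y \<in> spectrum d")
      case True
      then have "y = E (2 * k - 1) \<or> y = E (2 * k)" using k gap_iff[of y] by force
      then have "y \<in> edge_set d" using edge_setI[OF k(1)] by auto
      then show ?thesis using \<rho>_edge True by (simp add: M_def l_def k(4))
    qed (simp add: M_def l_def k(4))
  qed
  \<comment> \<open>If M exceeded 1 somewhere it would attain its maximum, as it is close to 1 far
    out. The set of maximum points is closed; it avoids K, where M = 1, so by the maximum principle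
    it is also open. It would be the whole plane, contradicting the smaller values far out.\<close>
  have M_le: "M z0 \<le> 1" for z0
  proof (rule ccontr)
    assume gt: "\<not> M z0 \<le> 1"
    obtain c where c: "c > 0" "\<And>z. z \<in> gap_complement d \<Longrightarrow> c \<le> norm z \<Longrightarrow> norm (\<rho> z - 1) < M z0 - 1"
      using \<rho>_near_1[of "M z0 - 1"] gt by auto
    have far: "M z < M z0" if "c \<le> norm z" for z
    proof (cases "z \<in> K")
      case False
      then have g: "z \<in> gap_complement d" using K_gaps by auto
      show ?thesis using M_off[OF g] c(2)[OF g that] norm_triangle_ineq2[of "\<rho> z" 1] by simp
    qed (use gt M_K in auto)
    have "compact (cball (0::complex) (max c (norm z0)))" by simp
    moreover have "cball (0::complex) (max c (norm z0)) \<noteq> {}" using c(1) by auto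
    ultimately obtain z1 where z1: "z1 \<in> cball 0 (max c (norm z0))"
      "\<And>z. z \<in> cball 0 (max c (norm z0)) \<Longrightarrow> M z \<le> M z1"
      using continuous_attains_sup[OF _ _ continuous_on_subset[OF Mc]] by (metis subset_UNIV)
    have z01: "M z0 \<le> M z1" by (rule z1(2)) simp
    have max: "M z \<le> M z1" for z
    proof (cases "c \<le> norm z")
      case True
      then show ?thesis using far[OF True] z01 by linarith
    next
      case False
      then show ?thesis by (intro z1(2)) simp
    qed
    define A where "A = {z. M z = M z1}"
    have "closed A" unfolding A_def using continuous_closed_preimage_constant[OF Mc closed_UNIV] by simp
    moreover have "open A"
      unfolding open_contains_ball
    proof
      fix z assume z: "z \<in> A"
      then have "z \<in> - K" using M_K gt z01 unfolding A_def by force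
      then obtain e where e: "e > 0" "ball z e \<subseteq> - K" using opK open_contains_ball by blast
      have sub: "ball z e \<subseteq> gap_complement d" using e(2) K_gaps by blast
      have "\<rho> constant_on ball z e"
      proof (rule maximum_modulus_principle[OF \<rho>_holomorphic[OF open_ball sub], of "ball z e" z])
        fix w assume w: "w \<in> ball z e"
        show "norm (\<rho> w) \<le> norm (\<rho> z)"
          using max[of w] z M_off[OF subsetD[OF sub w]] M_off[OF subsetD[OF sub, of z]] e(1)
          unfolding A_def by auto
      qed (use e in auto)
      then have \<rho>c: "\<rho> w = \<rho> z" if "w \<in> ball z e" for w
        using that e(1) unfolding constant_on_def by (metis centre_in_ball)
      have "M w = M z" if w: "w \<in> ball z e" for w
      proof -
        have "z \<in> ball z e" using e(1) by simp
        then show ?thesis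
          using M_off[OF subsetD[OF sub w]] M_off[OF subsetD[OF sub]] \<rho>c[OF w] by metis
      qed
      then have "ball z e \<subseteq> A" using z unfolding A_def by auto
      then show "\<exists>e>0. ball z e \<subseteq> A" using e(1) by blast
    qed
    moreover have "z1 \<in> A" by (simp add: A_def)
    ultimately have "A = UNIV" using clopen[of A] by blast
    then have "M (of_real c) = M z1" by (auto simp: A_def)
    then show False using far[of "of_real c"] c(1) z01 by simp
  qed
  define c where "c = max b 1"
  define V where "V = ball (0::complex) (1 / c)"
  have c1: "c > 0" by (simp add: c_def)
  define U where "U = {z::complex. c < norm z}"
  have U: "open U" unfolding U_def by (rule open_Collect_less) (intro continuous_intros)+
  have UK: "U \<subseteq> - K"
  proof
    fix z assume "z \<in> U"
    then show "z \<in> - K" using b[of z] by (auto simp: U_def c_def)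
  qed
  then have Ug: "U \<subseteq> gap_complement d" using K_gaps by blast
  have inV: "1 / w \<in> U" if "w \<in> V - {0}" for w
    using that c1 unfolding U_def V_def by (auto simp: norm_divide field_simps)
  have bd: "norm (\<rho> z) \<le> 1" if "z \<in> U" for z
    using M_le[of z] M_off[of z] Ug that by auto
  have "(\<lambda>w. \<rho> (1 / w)) holomorphic_on V - {0}"
  proof -
    have "\<rho> \<circ> (\<lambda>w. 1 / w) holomorphic_on V - {0}"
      by (rule holomorphic_on_compose_gen[OF _ \<rho>_holomorphic[OF U Ug]]) (use inV in \<open>auto intro!: holomorphic_intros\<close>)
    then show ?thesis by (simp add: comp_def)
  qed
  moreover have ev: "\<forall>\<^sub>F w in at 0. w \<in> V - {0}"
    using eventually_at_in_open[of V 0] c1 unfolding V_def by auto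
  then have "\<forall>\<^sub>F w in at 0. norm (\<rho> (1 / w)) \<le> 1"
    by eventually_elim (use inV bd in blast)
  moreover have "0 \<in> interior V" using c1 by (simp add: V_def)
  ultimately obtain \<kappa> where \<kappa>: "\<kappa> holomorphic_on V" "\<forall>w\<in>V - {0}. \<kappa> w = \<rho> (1 / w)"
    using holomorphic_on_extend_bounded[of "\<lambda>w. \<rho> (1 / w)" V 0] by blast
  have "(\<kappa> \<longlongrightarrow> \<kappa> 0) (at 0)"
    using \<kappa>(1) c1 by (metis V_def centre_in_ball continuous_on_eq_continuous_at divide_pos_pos holomorphic_on_imp_continuous_on isContD open_ball zero_less_one)
  moreover have "(\<kappa> \<longlongrightarrow> 1) (at 0)"
  proof (rule tendstoI)
    fix e :: real assume "e > 0"
    then obtain a where a: "a > 0" "\<And>z. z \<in> gap_complement d \<Longrightarrow> a \<le> norm z \<Longrightarrow> norm (\<rho> z - 1) < e"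
      using \<rho>_near_1 by blast
    have "\<forall>\<^sub>F w in at 0. w \<in> ball (0::complex) (1 / a) - {0}"
      using eventually_at_in_open[of "ball (0::complex) (1 / a)" 0] a(1) by auto
    then show "\<forall>\<^sub>F w in at 0. dist (\<kappa> w) 1 < e"
      using ev
    proof eventually_elim
      case (elim w)
      have "a \<le> norm (1 / w)" using elim a(1) by (auto simp: norm_divide field_simps)
      moreover have "1 / w \<in> gap_complement d" using inV[OF elim(2)] Ug by blast
      ultimately show ?case using a(2) \<kappa>(2) elim by (simp add: dist_norm)
    qed
  qed
  ultimately have \<kappa>0: "\<kappa> 0 = 1" using LIM_unique by blast
  \<comment> \<open>The bound 1 for the modulus is attained at the interior point 0.\<close>
  have "\<kappa> constant_on V"
  proof (rule maximum_modulus_principle[OF \<kappa>(1), of V 0])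
    fix w assume "w \<in> V"
    then show "norm (\<kappa> w) \<le> norm (\<kappa> 0)"
      using \<kappa>0 \<kappa>(2) inV[of w] bd[of "1 / w"] by (cases "w = 0") auto
  qed (use c1 in \<open>auto simp: V_def\<close>)
  then have \<kappa>1: "\<kappa> w = 1" if "w \<in> V" for w
    using that \<kappa>0 c1 unfolding constant_on_def V_def by (metis centre_in_ball divide_pos_pos zero_less_one)
  have "\<rho> z = 1" if z: "c < norm z" for z
  proof -
    have "norm z > 0" using z c1 by linarith
    then have "1 / z \<in> V - {0}" using z c1 by (auto simp: V_def norm_divide field_simps)
    then show ?thesis using \<kappa>(2) \<kappa>1 by force
  qed
  then show ?thesis by blast
qed

text \<open>Inside the upper half plane the identity theorem spreads the value 1 from the half plane
  Im z > |c|, whose points all satisfy |z| > c. The lower half plane follows by reflection, so no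
  path through a band is required.\<close>

lemma \<rho>_eq_1: "z \<notin> \<real> \<Longrightarrow> \<rho> z = 1"
proof -
  obtain c where c: "\<And>z. z \<notin> \<real> \<Longrightarrow> c < norm z \<Longrightarrow> \<rho> z = 1"
    using \<rho>_far_finite \<rho>_far_infinite by blast
  have upper: "\<rho> z = 1" if z: "Im z > 0" for z
  proof (rule analytic_continuation_open[of "{z. Im z > \<bar>c\<bar>}" "{z. Im z > 0}" \<rho> "\<lambda>_. 1"])
    show "\<rho> holomorphic_on {z. Im z > 0}"
      by (rule holomorphic_on_subset[OF \<rho>_nonreal_holomorphic]) (auto simp: Reals_iff_Im)
    have "\<i> * of_real (\<bar>c\<bar> + 1) \<in> {z. Im z > \<bar>c\<bar>}" by simp
    then show "{z. Im z > \<bar>c\<bar>} \<noteq> {}" by blast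
    show "connected {z. Im z > 0}" by (intro convex_connected convex_halfspace_Im_gt)
    show "\<rho> w = 1" if "w \<in> {z. Im z > \<bar>c\<bar>}" for w
      using that abs_Im_le_cmod[of w] by (intro c) (auto simp: Reals_iff_Im)
  qed (use z in \<open>auto intro: open_halfspace_Im_gt\<close>)
  assume "z \<notin> \<real>"
  then consider "Im z > 0" | "Im (cnj z) > 0" unfolding Reals_iff_Im by fastforce
  then show ?thesis
  proof cases
    case 2
    then have "cnj (\<rho> z) = 1" using upper \<rho>_cnj by metis
    then show ?thesis by (metis complex_cnj_cnj complex_cnj_one)
  qed (rule upper)
qed

lemma r2_inverse: "z \<notin> \<real> \<Longrightarrow> r2 z \<noteq> 0 \<and> inverse (r2 z) = cnj (r2 (cnj z))"
  using \<rho>_eq_1[of z] unfolding \<rho>_def by (metis inverse_unique mult_zero_left zero_neq_one)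

text \<open>By continuity \<open>\<rho>\<close> is 1 also on the spectrum, and there it equals the
  squared modulus of r2.\<close>

lemma r2_spectrum_nonzero:
  assumes "y \<in> spectrum d"
  shows "r2 (of_real y) \<noteq> 0"
proof -
  have "(\<rho> \<longlongrightarrow> 1) (at (of_real y) within - \<real>)"
    by (rule Lim_transform_eventually[OF tendsto_const]) (auto simp: eventually_at_filter \<rho>_eq_1)
  then have "\<rho> (of_real y) = 1"
    using tendsto_unique[OF at_nonreal_neq_bot \<rho>_tendsto(1)[OF assms]] by blast
  then show ?thesis by (auto simp: \<rho>_def)
qed

end

section \<open>The shift in time\<close>

lemma matrix_inv_inverse:
  fixes M :: "'a::semiring_1^'n^'n"
  assumes "invertible M"
  shows "M ** matrix_inv M = mat 1" "matrix_inv M ** M = mat 1"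
proof -
  have "M ** matrix_inv M = mat 1 \<and> matrix_inv M ** M = mat 1"
    using assms unfolding invertible_def matrix_inv_def by (rule someI_ex)
  then show "M ** matrix_inv M = mat 1" "matrix_inv M ** M = mat 1" by auto
qed

lemma mult_diag2_entry [simp]:
  "(M ** diag2 a c) $ i $ 1 = M $ i $ 1 * a" "(M ** diag2 a c) $ i $ 2 = M $ i $ 2 * c"
  for M :: "complex^2^2"
  by (simp_all add: mat_mult_entry diag2_def)

lemma diag2_mult_entry [simp]:
  "(diag2 a c ** M) $ 1 $ j = a * M $ 1 $ j" "(diag2 a c ** M) $ 2 $ j = c * M $ 2 $ j"
  for M :: "complex^2^2"
  by (simp_all add: mat_mult_entry diag2_def)

lemma mat_mult_scale [simp]: "(mat a ** M) $ i $ j = a * M $ i $ j" for M :: "complex^2^2"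
  using exhaust_2[of i] by (auto simp: mat_mult_entry mat_def)

lemma diag2_entries [simp]:
  "diag2 a c $ 1 $ 1 = a" "diag2 a c $ 2 $ 2 = c" "diag2 a c $ 1 $ 2 = 0" "diag2 a c $ 2 $ 1 = 0"
  by (simp_all add: diag2_def)

lemma mat_entries [simp]:
  "(mat a :: complex^2^2) $ 1 $ 1 = a" "(mat a :: complex^2^2) $ 2 $ 2 = a"
  "(mat a :: complex^2^2) $ 1 $ 2 = 0" "(mat a :: complex^2^2) $ 2 $ 1 = 0"
  by (simp_all add: mat_def)

lemma sigma1_entries [simp]:
  "sigma1 $ 1 $ 1 = 0" "sigma1 $ 2 $ 2 = 0" "sigma1 $ 1 $ 2 = 1" "sigma1 $ 2 $ 1 = 1"
  by (simp_all add: sigma1_def)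

lemma mat2_eqI:
  "M $ 1 $ 1 = N $ 1 $ 1 \<Longrightarrow> M $ 1 $ 2 = N $ 1 $ 2 \<Longrightarrow> M $ 2 $ 1 = N $ 2 $ 1 \<Longrightarrow> M $ 2 $ 2 = N $ 2 $ 2 \<Longrightarrow> M = N"
  for M N :: "complex^2^2"
  by (simp add: vec_eq_iff forall_2)

lemma tendsto_diag2:
  assumes "(f \<longlongrightarrow> a) F" "(g \<longlongrightarrow> c) F"
  shows "((\<lambda>z. diag2 (f z) (g z)) \<longlongrightarrow> diag2 a c) F"
proof (intro vec_tendstoI)
  fix i j :: 2
  show "((\<lambda>z. diag2 (f z) (g z) $ i $ j) \<longlongrightarrow> diag2 a c $ i $ j) F"
    using exhaust_2[of i] exhaust_2[of j] assms by auto
qed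

lemma det_sigma1: "det sigma1 = -1"
  by (simp add: det_2)

lemma neg_one_powi_square: "((-1 :: complex) powi n)\<^sup>2 = 1"
  by (simp add: power2_eq_square flip: power_int_mult_distrib)

lemma det_jump_gap: "det (jump_gap d gs x t n y) = 1"
  by (simp add: jump_gap_def Let_def det_mul det_sigma1 power_mult_distrib neg_one_powi_square flip: exp_add)

lemma det_jump_band:
  assumes "f_prod d 1 (of_real y) \<noteq> 0" "f_prod d (-1) (of_real y) \<noteq> 0"
  shows "det (jump_band d gs n y) = 1"
  using assms by (simp add: jump_band_def det_mul neg_one_powi_square)

lemma B_mat_commute: "B_mat d b z ** diag2 a c = diag2 a c ** B_mat d b z"
  by (rule mat2_eqI) (auto simp: B_mat_def)

lemma jump_band_commute: "jump_band d gs n y ** diag2 a c = diag2 a c ** jump_band d gs n y"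
  by (rule mat2_eqI) (auto simp: jump_band_def)

text \<open>Moving diag(s, 1/s) past \<open>sigma1\<close> swaps its entries, so on a gap the two
  boundary values enter through their product: it multiplies one nonzero entry of the jump and
  divides the other. The assumed value of \<open>sp * sm\<close> is the change of exp(w) under the
  time shift L.\<close>

lemma jump_gap_shift:
  assumes "sp * sm = exp (- (4 * \<i> * (of_real y)\<^sup>2 * of_real L))"
  shows "jump_gap d gs x (t + L) n y ** diag2 sp (inverse sp) = diag2 sm (inverse sm) ** jump_gap d gs x t n y"
proof -
  define w where "w t = - 2 * \<i> * of_real y * of_real x - 4 * \<i> * (of_real y)\<^sup>2 * complex_of_real t" for t
  have sh: "w (t + L) = w t + - (4 * \<i> * (of_real y)\<^sup>2 * of_real L)"
    by (simp add: w_def algebra_simps)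
  have e: "exp (w (t + L)) = exp (w t) * (sp * sm)"
    unfolding sh exp_add assms ..
  have nz: "sp \<noteq> 0" "sm \<noteq> 0" using assms by (auto dest: sym)
  have e': "exp (- w (t + L)) = exp (- w t) * (inverse sp * inverse sm)"
    unfolding exp_minus e by (simp add: inverse_mult_distrib)
  define c where "c = (-1) powi (n + int (count_m d gs y)) * \<i>"
  have J: "jump_gap d gs x \<tau> n y = mat c ** diag2 (exp (w \<tau>)) (exp (- w \<tau>)) ** sigma1" for \<tau>
    unfolding jump_gap_def Let_def w_def c_def by (rule refl)
  show ?thesis
    unfolding J by (rule mat2_eqI) (use nz in \<open>simp_all add: mat_mult_entry e e'\<close>)
qed

lemma rhp_solution_jumps:
  assumes "rhp_solution d gs b x t \<Phi>"
  obtains \<Phi>p \<Phi>m where "boundary_values \<Phi> (UNIV - edge_set d) \<Phi>p \<Phi>m"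
    "\<And>n y. y \<in> edge_interval d (2 * n - 2) (2 * n - 1) - edge_set d \<Longrightarrow> \<Phi>p y = \<Phi>m y ** jump_band d gs n y"
    "\<And>n y. y \<in> edge_interval d (2 * n - 1) (2 * n) - edge_set d \<Longrightarrow> \<Phi>p y = \<Phi>m y ** jump_gap d gs x t n y"
proof -
  have "\<exists>\<Phi>p \<Phi>m. boundary_values \<Phi> (UNIV - edge_set d) \<Phi>p \<Phi>m \<and>
        (\<forall>n y. y \<in> edge_interval d (2 * n - 2) (2 * n - 1) - edge_set d \<longrightarrow>
            \<Phi>p y = \<Phi>m y ** jump_band d gs n y) \<and>
        (\<forall>n y. y \<in> edge_interval d (2 * n - 1) (2 * n) - edge_set d \<longrightarrow>
            \<Phi>p y = \<Phi>m y ** jump_gap d gs x t n y)"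
    using assms unfolding rhp_solution_def by (elim conjE)
  then show ?thesis by (elim exE conjE) (rule that; blast)
qed

context candidate_data
begin

lemma rhp_solution_regular: "rhp_solution d gs b x t \<Phi> \<Longrightarrow> rhp_regular b \<Phi>"
  unfolding rhp_solution_def rhp_regular_def by blast

text \<open>This makes limits along the filter unique. All discs have radius R and real centres, so
  points of the imaginary axis above height R avoid them.\<close>

lemma to_infinity_neq_bot: "to_infinity_within (disc_complement d) \<noteq> bot"
proof
  assume "to_infinity_within (disc_complement d) = bot"
  then have "eventually (\<lambda>_. False) (to_infinity_within (disc_complement d))" by simp
  then obtain c where c: "\<And>z. z \<in> disc_complement d \<Longrightarrow> \<not> c \<le> norm z"
    unfolding eventually_to_infinity_within by blast
  define z where "z = \<i> * complex_of_real (\<bar>c\<bar> + R + 1)"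
  have Im: "Im z = \<bar>c\<bar> + R + 1" by (simp add: z_def)
  have "R < dist (of_real (ctr k)) z" for k
    using abs_Im_le_cmod[of "of_real (ctr k) - z"] Im R_pos by (simp add: dist_norm)
  then have "z \<in> disc_complement d"
    using Im R_pos by (auto simp: disc_complement_iff Reals_iff_Im)
  then show False using c[of z] abs_Im_le_cmod[of z] Im R_pos by simp
qed

end

context time_period
begin

definition s :: "complex \<Rightarrow> complex" where "s z = r2 z * exp (- (2 * \<i> * z\<^sup>2 * of_real L2))"

definition S :: "complex \<Rightarrow> complex^2^2" where "S z = diag2 (s z) (inverse (s z))"

lemma s_nonzero: "z \<notin> \<real> \<Longrightarrow> s z \<noteq> 0"
  using r2_inverse[of z] by (simp add: s_def)

lemma s_holomorphic: "s holomorphic_on - \<real>"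
  unfolding s_def by (intro holomorphic_intros r2_holomorphic open_Compl_Reals nonreal_gap_complement)

lemma to_infinity_le: "to_infinity_within (disc_complement d) \<le> to_infinity_within (gap_complement d)"
  unfolding to_infinity_within_def using disc_complement_nonreal nonreal_gap_complement
  by (intro inf_mono) auto

lemma s_tendsto_1: "(s \<longlongrightarrow> 1) (to_infinity_within (disc_complement d))"
  using tendsto_mono[OF to_infinity_le s_tendsto] by (simp add: s_def[abs_def])

lemma s_expansion: "(\<lambda>z. s z - 1) \<in> O[to_infinity_within (disc_complement d)](\<lambda>z. 1 / z)"
proof -
  obtain A where A: "A \<in> O[to_infinity_within (gap_complement d)](\<lambda>z. 1 / z)"
    "\<forall>\<^sub>F z in to_infinity_within (gap_complement d). r2 z = exp (2 * \<i> * z\<^sup>2 * of_real L2) * (1 + A z)"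
    using asym by blast
  have "\<forall>\<^sub>F z in to_infinity_within (disc_complement d). s z - 1 = A z"
    using filter_leD[OF to_infinity_le A(2)]
  proof eventually_elim
    case (elim z)
    have "s z = 1 + A z" by (simp add: elim s_def exp_minus)
    then show ?case by simp
  qed
  then show ?thesis
    using landau_o.big.filter_mono[OF to_infinity_le A(1)] by (subst landau_o.big.in_cong)
qed

text \<open>1/s - 1 is (s - 1) times -1/s, and -1/s is bounded far out because s tends to 1.\<close>

lemma inverse_s_expansion: "(\<lambda>z. inverse (s z) - 1) \<in> O[to_infinity_within (disc_complement d)](\<lambda>z. 1 / z)"
proof -
  have "((\<lambda>z. - inverse (s z)) \<longlongrightarrow> - inverse 1) (to_infinity_within (disc_complement d))"
    by (intro tendsto_intros s_tendsto_1) simp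
  then have "(\<lambda>z. - inverse (s z)) \<in> O[to_infinity_within (disc_complement d)](\<lambda>_. 1)"
    by (intro bigoI_tendsto) auto
  from landau_o.big.mult[OF s_expansion this]
  have "(\<lambda>z. (s z - 1) * - inverse (s z)) \<in> O[to_infinity_within (disc_complement d)](\<lambda>z. 1 / z)" by simp
  moreover have "\<forall>\<^sub>F z in to_infinity_within (disc_complement d). inverse (s z) - 1 = (s z - 1) * - inverse (s z)"
    using eventually_disc_complement
  proof eventually_elim
    case (elim z)
    then have "s z \<noteq> 0" using s_nonzero disc_complement_nonreal by blast
    then show ?case by (simp add: field_simps)
  qed
  ultimately show ?thesis by (subst landau_o.big.in_cong)
qed

text \<open>A finite nonzero limit bounds both s and 1/s near an edge, so multiplication by
  \<open>S\<close> preserves the quartic root bound in both columns.\<close>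

lemma s_edge_limit:
  assumes e: "e \<in> edge_set d"
  obtains a where "a \<noteq> 0" "(s \<longlongrightarrow> a) (at (of_real e) within - \<real>)"
proof
  let ?a = "r2 (of_real e) * exp (- (2 * \<i> * (of_real e)\<^sup>2 * of_real L2))"
  have sp: "e \<in> spectrum d" using edge_spectrum[OF e] .
  show "?a \<noteq> 0" using r2_spectrum_nonzero[OF sp] by simp
  show "(s \<longlongrightarrow> ?a) (at (of_real e) within - \<real>)"
    unfolding s_def[abs_def] by (intro tendsto_intros r2_tendsto(1)[OF sp])
qed

lemma shifted_regular:
  assumes \<Phi>: "rhp_regular b \<Phi>"
  shows "rhp_regular b (\<lambda>z. \<Phi> z ** S z)"
  unfolding rhp_regular_def
proof (intro conjI ballI allI)
  fix i j :: 2
  have "(\<lambda>z. \<Phi> z $ i $ j) holomorphic_on - \<real>" using \<Phi> unfolding rhp_regular_def by blast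
  then show "(\<lambda>z. (\<Phi> z ** S z) $ i $ j) holomorphic_on - \<real>"
    using exhaust_2[of j] s_nonzero by (auto simp: S_def intro!: holomorphic_intros s_holomorphic)
next
  fix e and i j :: 2 assume e: "e \<in> edge_set d"
  let ?F = "at (complex_of_real e) within - \<real>"
  let ?p = "\<lambda>z. norm (z - complex_of_real e) powr (- 1 / 4)"
  obtain a where a: "a \<noteq> 0" "(s \<longlongrightarrow> a) ?F" using s_edge_limit[OF e] .
  have b1: "(\<lambda>z. norm (u z)) \<in> O[?F](\<lambda>_. 1)" if "(u \<longlongrightarrow> c) ?F" for u :: "complex \<Rightarrow> complex" and c
    using tendsto_norm[OF that] by (intro bigoI_tendsto) auto
  have \<Phi>e: "(\<lambda>z. norm (\<Phi> z $ i $ j)) \<in> O[?F](?p)" using \<Phi> e unfolding rhp_regular_def by blast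
  have "(\<lambda>z. norm (\<Phi> z $ i $ j) * norm (u z)) \<in> O[?F](?p)" if "(u \<longlongrightarrow> c) ?F" for u :: "complex \<Rightarrow> complex" and c
    using landau_o.big.mult[OF \<Phi>e b1[OF that]] by simp
  from this[OF a(2)] this[OF tendsto_inverse[OF a(2,1)]]
  show "(\<lambda>z. norm ((\<Phi> z ** S z) $ i $ j)) \<in> O[?F](?p)"
    using exhaust_2[of j] by (auto simp: S_def norm_mult)
next
  let ?F = "to_infinity_within (disc_complement d)"
  obtain A where A: "\<And>i j. (\<lambda>z. A z $ i $ j) \<in> O[?F](\<lambda>z. 1 / z)"
    "\<forall>\<^sub>F z in ?F. \<Phi> z = U_mat ** (mat 1 + A z) ** B_mat d b z"
    using \<Phi> unfolding rhp_regular_def by blast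
  \<comment> \<open>\<open>S\<close> and B are diagonal and commute, so U (1 + A) B S = U ((1 + A)
    S) B, and (1 + A) S is again 1 + O(1/z).\<close>
  define A' where "A' z = (mat 1 + A z) ** S z - mat 1" for z
  have "(\<lambda>z. A' z $ i $ j) \<in> O[?F](\<lambda>z. 1 / z)" for i j
  proof -
    have *: "(\<lambda>z. k * (u z - 1) + A z $ i $ j * u z) \<in> O[?F](\<lambda>z. 1 / z)"
      if u: "(u \<longlongrightarrow> 1) ?F" "(\<lambda>z. u z - 1) \<in> O[?F](\<lambda>z. 1 / z)" for u :: "complex \<Rightarrow> complex" and k
    proof -
      have "u \<in> O[?F](\<lambda>_. 1)" by (rule bigoI_tendsto[of _ _ 1]) (use u(1) in auto)
      from landau_o.big.mult[OF A(1)[of i j] this] have "(\<lambda>z. A z $ i $ j * u z) \<in> O[?F](\<lambda>z. 1 / z)" by simp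
      moreover have "(\<lambda>z. k * (u z - 1)) \<in> O[?F](\<lambda>z. 1 / z)" using u(2) by (cases "k = 0") auto
      ultimately show ?thesis by (rule sum_in_bigo(1)[rotated])
    qed
    have si: "((\<lambda>z. inverse (s z)) \<longlongrightarrow> 1) ?F" using tendsto_inverse[OF s_tendsto_1] by simp
    let ?k = "(mat 1 :: complex^2^2) $ i $ j"
    consider "j = 1" | "j = 2" using exhaust_2 by blast
    then show ?thesis
    proof cases
      case 1
      have "(\<lambda>z. A' z $ i $ j) = (\<lambda>z. ?k * (s z - 1) + A z $ i $ j * s z)"
        by (simp add: 1 A'_def S_def algebra_simps)
      then show ?thesis using *[OF s_tendsto_1 s_expansion] by simp
    next
      case 2
      have "(\<lambda>z. A' z $ i $ j) = (\<lambda>z. ?k * (inverse (s z) - 1) + A z $ i $ j * inverse (s z))"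
        by (simp add: 2 A'_def S_def algebra_simps)
      then show ?thesis using *[OF si inverse_s_expansion] by simp
    qed
  qed
  moreover have "\<forall>\<^sub>F z in ?F. \<Phi> z ** S z = U_mat ** (mat 1 + A' z) ** B_mat d b z"
    using A(2)
  proof eventually_elim
    case (elim z)
    show ?case
      unfolding elim A'_def S_def
      by (simp add: B_mat_commute flip: matrix_mul_assoc)
  qed
  ultimately show "\<exists>A. (\<forall>i j. (\<lambda>z. A z $ i $ j) \<in> O[?F](\<lambda>z. 1 / z)) \<and>
      (\<forall>\<^sub>F z in ?F. \<Phi> z ** S z = U_mat ** (mat 1 + A z) ** B_mat d b z)" by blast
qed

lemma shifted_same_jump:
  assumes \<Phi>: "rhp_solution d gs b x (t + L2) \<Phi>" and \<Psi>: "rhp_solution d gs b x t \<Psi>" and y: "y \<notin> edge_set d"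
  shows "same_jump (\<lambda>z. \<Phi> z ** S z) \<Psi> y"
proof -
  let ?up = "at (complex_of_real y) within {z. Im z > 0}" and ?lo = "at (complex_of_real y) within {z. Im z < 0}"
  let ?e = "exp (- (2 * \<i> * (of_real y)\<^sup>2 * of_real L2))"
  obtain \<Phi>p \<Phi>m where bv\<Phi>: "boundary_values \<Phi> (UNIV - edge_set d) \<Phi>p \<Phi>m"
    and band\<Phi>: "\<And>n y. y \<in> edge_interval d (2 * n - 2) (2 * n - 1) - edge_set d \<Longrightarrow> \<Phi>p y = \<Phi>m y ** jump_band d gs n y"
    and gap\<Phi>: "\<And>n y. y \<in> edge_interval d (2 * n - 1) (2 * n) - edge_set d \<Longrightarrow> \<Phi>p y = \<Phi>m y ** jump_gap d gs x (t + L2) n y"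
    by (rule rhp_solution_jumps[OF \<Phi>]) (rule that; assumption)
  obtain \<Psi>p \<Psi>m where bv\<Psi>: "boundary_values \<Psi> (UNIV - edge_set d) \<Psi>p \<Psi>m"
    and band\<Psi>: "\<And>n y. y \<in> edge_interval d (2 * n - 2) (2 * n - 1) - edge_set d \<Longrightarrow> \<Psi>p y = \<Psi>m y ** jump_band d gs n y"
    and gap\<Psi>: "\<And>n y. y \<in> edge_interval d (2 * n - 1) (2 * n) - edge_set d \<Longrightarrow> \<Psi>p y = \<Psi>m y ** jump_gap d gs x t n y"
    by (rule rhp_solution_jumps[OF \<Psi>]) (rule that; assumption)
  have lim: "(\<Phi> \<longlongrightarrow> \<Phi>p y) ?up" "(\<Phi> \<longlongrightarrow> \<Phi>m y) ?lo" "(\<Psi> \<longlongrightarrow> \<Psi>p y) ?up" "(\<Psi> \<longlongrightarrow> \<Psi>m y) ?lo"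
    using bv\<Phi> bv\<Psi> y unfolding boundary_values_def by auto
  have S_lim: "(S \<longlongrightarrow> diag2 (a * ?e) (inverse (a * ?e))) (at (of_real y) within X)"
    if "(r2 \<longlongrightarrow> a) (at (of_real y) within X)" "a \<noteq> 0" for a X
    unfolding S_def[abs_def] s_def[abs_def] by (intro tendsto_diag2 tendsto_intros that) (use that in auto)
  have combine: "same_jump (\<lambda>z. \<Phi> z ** S z) \<Psi> y"
    if "det V = 1" "\<Psi>p y = \<Psi>m y ** V" "(S \<longlongrightarrow> Sp) ?up" "(S \<longlongrightarrow> Sm) ?lo" "\<Phi>p y ** Sp = \<Phi>m y ** Sm ** V" for V Sp Sm
    unfolding same_jump_def
  proof (intro exI conjI)
    show "((\<lambda>z. \<Phi> z ** S z) \<longlongrightarrow> \<Phi>p y ** Sp) ?up" "((\<lambda>z. \<Phi> z ** S z) \<longlongrightarrow> \<Phi>m y ** Sm) ?lo"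
      by (intro tendsto_mat_mult lim that)+
  qed (fact that lim)+
  from y show ?thesis
  proof (cases rule: real_cases)
    case (gap n)
    then have ns: "y \<notin> spectrum d" using gap_iff by blast
    have iv: "y \<in> edge_interval d (2 * n - 1) (2 * n) - edge_set d"
      using edge_intervalI_gap[OF gap(1)] gap y by simp
    have r: "r2m y \<noteq> 0" "r2p y = inverse (r2m y)" using r2_jump[of y] ns by auto
    \<comment> \<open>Since r2_+ r2_- = 1, twice the exponent 2 i y^2 L2 is left: exactly the change
      of 4 i y^2 t when t increases by L2.\<close>
    have "r2p y * ?e * (r2m y * ?e) = ?e * ?e" using r by simp
    also have "\<dots> = exp (- (4 * \<i> * (of_real y)\<^sup>2 * of_real L2))" by (simp add: mult_ac flip: exp_add)
    finally have prod: "r2p y * ?e * (r2m y * ?e) = exp (- (4 * \<i> * (of_real y)\<^sup>2 * of_real L2))" .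
    show ?thesis
    proof (rule combine[OF det_jump_gap gap\<Psi>[OF iv] S_lim[OF r2_tendsto(2)[OF ns]] S_lim[OF r2_tendsto(3)[OF ns]]])
      show "\<Phi>p y ** diag2 (r2p y * ?e) (inverse (r2p y * ?e))
          = \<Phi>m y ** diag2 (r2m y * ?e) (inverse (r2m y * ?e)) ** jump_gap d gs x t n y"
        unfolding gap\<Phi>[OF iv] by (simp only: jump_gap_shift[OF prod] flip: matrix_mul_assoc)
    qed (use r in auto)
  next
    case (band n)
    have sp: "y \<in> spectrum d" using band(1) gap_iff[of y] by force
    have iv: "y \<in> edge_interval d (2 * n - 2) (2 * n - 1) - edge_set d" using band(2) y by simp
    \<comment> \<open>All gamma_k lie in closed gaps, so neither f^+ nor f^- vanishes at y; the
      quotients in the jump are genuine and its determinant is 1.\<close>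
    have "complex_of_real y \<noteq> of_real (gam d k)" if "k \<in> gap_idx d" for k
      using band(1)[OF that] gam_bounds[OF that] by auto
    then have f: "f_prod d 1 (of_real y) \<noteq> 0" "f_prod d (-1) (of_real y) \<noteq> 0"
      by (intro f_prod_nonzero; blast)+
    have r: "r2 (of_real y) \<noteq> 0" by (rule r2_spectrum_nonzero[OF sp])
    have l: "(r2 \<longlongrightarrow> r2 (of_real y)) ?up" "(r2 \<longlongrightarrow> r2 (of_real y)) ?lo"
      using r2_tendsto(1)[OF sp] unfolding tendsto_nonreal_iff by auto
    show ?thesis
    proof (rule combine[OF det_jump_band[OF f] band\<Psi>[OF iv] S_lim[OF l(1) r] S_lim[OF l(2) r]])
      show "\<Phi>p y ** diag2 (r2 (of_real y) * ?e) (inverse (r2 (of_real y) * ?e))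
          = \<Phi>m y ** diag2 (r2 (of_real y) * ?e) (inverse (r2 (of_real y) * ?e)) ** jump_band d gs n y"
        unfolding band\<Phi>[OF iv] by (simp only: jump_band_commute flip: matrix_mul_assoc)
    qed
  qed
qed

lemma potential_periodic:
  assumes b: "is_b d gs b"
    and \<Phi>: "rhp_solution d gs b x (t + L2) \<Phi>" and \<Psi>: "rhp_solution d gs b x t \<Psi>"
    and q1: "has_potential d b \<Phi> q1" and q2: "has_potential d b \<Psi> q2"
  shows "q1 = q2"
proof -
  let ?F = "to_infinity_within (disc_complement d)"
  let ?P = "\<lambda>\<Phi> z. mat (\<i> * z) ** commutator sigma3 (matrix_inv U_mat ** \<Phi> z ** matrix_inv (B_mat d b z))"
  have eq: "\<Psi> z = \<Phi> z ** S z" if "z \<notin> \<real>" for z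
    by (rule rhp_unique[OF b shifted_regular rhp_solution_regular shifted_same_jump, symmetric])
      (use rhp_solution_regular \<Phi> \<Psi> that in auto)
  obtain T G where bnz: "\<And>z. z \<notin> \<real> \<Longrightarrow> b z \<noteq> 0" using b_square_product[OF b] by metis
  obtain Q1 where Q1: "(?P \<Phi> \<longlongrightarrow> Q1) ?F" "q1 = Q1 $ 1 $ 2" using q1 unfolding has_potential_def by blast
  obtain Q2 where Q2: "(?P \<Psi> \<longlongrightarrow> Q2) ?F" "q2 = Q2 $ 1 $ 2" using q2 unfolding has_potential_def by blast
  \<comment> \<open>The (1,2) entry of the commutator with \<open>sigma3\<close> is twice the (1,2)
    entry of its argument. Multiplication by \<open>S\<close> on the right divides this entry by s,
    which tends to 1, so the limit is unchanged.\<close>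
  have "((\<lambda>z. ?P \<Phi> z $ 1 $ 2 * inverse (s z)) \<longlongrightarrow> Q1 $ 1 $ 2 * inverse 1) ?F"
    by (intro tendsto_intros Q1 s_tendsto_1) simp
  moreover have "\<forall>\<^sub>F z in ?F. ?P \<Phi> z $ 1 $ 2 * inverse (s z) = ?P \<Psi> z $ 1 $ 2"
    using eventually_disc_complement
  proof eventually_elim
    case (elim z)
    have zr: "z \<notin> \<real>" using elim disc_complement_nonreal by blast
    let ?B = "B_mat d b z"
    have "det ?B \<noteq> 0"
      using det_B_square[of b z] bnz[OF zr] f_prod_nonreal[OF zr] by auto
    then have inv: "invertible ?B" by (simp add: invertible_det_nz)
    have "S z ** matrix_inv ?B = matrix_inv ?B ** ?B ** (S z ** matrix_inv ?B)"
      by (simp add: matrix_inv_inverse(2)[OF inv])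
    also have "\<dots> = matrix_inv ?B ** (?B ** S z) ** matrix_inv ?B"
      by (simp add: matrix_mul_assoc)
    also have "\<dots> = matrix_inv ?B ** S z ** (?B ** matrix_inv ?B)"
      unfolding S_def B_mat_commute by (simp add: matrix_mul_assoc)
    also have "\<dots> = matrix_inv ?B ** S z"
      by (simp add: matrix_inv_inverse(1)[OF inv])
    finally have comm: "S z ** matrix_inv ?B = matrix_inv ?B ** S z" .
    define N where "N = matrix_inv U_mat ** \<Phi> z ** matrix_inv ?B"
    have "matrix_inv U_mat ** \<Psi> z ** matrix_inv ?B = matrix_inv U_mat ** \<Phi> z ** (S z ** matrix_inv ?B)"
      unfolding eq[OF zr] by (simp add: matrix_mul_assoc)
    also have "\<dots> = N ** S z" unfolding comm N_def by (simp add: matrix_mul_assoc)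
    finally have "matrix_inv U_mat ** \<Psi> z ** matrix_inv ?B = N ** S z" .
    then show ?case
      by (simp add: commutator_def sigma3_def S_def algebra_simps flip: N_def)
  qed
  ultimately have "((\<lambda>z. ?P \<Psi> z $ 1 $ 2) \<longlongrightarrow> Q1 $ 1 $ 2) ?F"
    using Lim_transform_eventually by fastforce
  moreover have "((\<lambda>z. ?P \<Psi> z $ 1 $ 2) \<longlongrightarrow> Q2 $ 1 $ 2) ?F"
    by (intro tendsto_vec_nth Q2)
  ultimately show ?thesis using tendsto_unique[OF to_infinity_neq_bot] Q1 Q2 by blast
qed

end

theorem theorem6p2:
  fixes d :: spectral_data and gs :: real and b :: "complex \<Rightarrow> complex"
    and \<Phi> :: "real \<Rightarrow> real \<Rightarrow> complex \<Rightarrow> complex^2^2"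
    and q :: "real \<Rightarrow> real \<Rightarrow> complex"
    and r2 :: "complex \<Rightarrow> complex" and r2p r2m :: "real \<Rightarrow> complex"
    and L2 :: real
  assumes "candidate_spectral_data d"
    and "products_converge d"
    and "is_gamma_star d gs"
    and "is_b d gs b"
    and "\<And>x t. rhp_solution d gs b x t (\<Phi> x t)"
    and "\<And>x t. has_potential d b (\<Phi> x t) (q x t)"
    and "holomorphic_off_gaps d r2"
    and "boundary_values r2 (UNIV - spectrum d) r2p r2m"
    and "\<And>y. y \<in> UNIV - spectrum d \<Longrightarrow> r2m y \<noteq> 0 \<and> r2p y = inverse (r2m y)"
    and "L2 > 0"
    and "\<exists>A. A \<in> O[to_infinity_within (gap_complement d)](\<lambda>z. 1 / z) \<and>
           (\<forall>\<^sub>F z in to_infinity_within (gap_complement d).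
              r2 z = exp (2 * \<i> * z\<^sup>2 * of_real L2) * (1 + A z))"
    and "r2 \<in> A2 (disc_complement d)"
  shows "\<forall>x t. q x (t + L2) = q x t"
proof -
  interpret time_period d r2 r2p r2m L2
    by unfold_locales (use assms in blast)+
  show ?thesis
    using potential_periodic[OF assms(4) assms(5) assms(5) assms(6) assms(6)] by blast
qed

end
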